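(* There is an absolute constant $C>0$ such that the following holds. Let $n\ge 1$, $d\ge 2$ and $m\ge 6n$ be integers. Let $q_0,\dots,q_{d-1}\in\{0,1\}^n$ be pairwise distinct and let $\alpha_0,\dots,\alpha_{d-1}\in\mathbb{C}$ satisfy $\sum_{i=0}^{d-1}|\alpha_i|^2=1$. Then there is a quantum circuit $U$ acting on $n+m$ qubits such that $$U\,|0\rangle^{\otimes n}|0\rangle^{\otimes m}=\sum_{i=0}^{d-1}\alpha_i\,|q_i\rangle\,|0\rangle^{\otimes m},$$ whose depth is at most $C\left(\frac{nd\log m}{m\log(m/n)}+\log(nd)\right)$ and whose size is at most $C\left(\frac{nd}{\log(m/n)}+\frac{nd}{\log d}\right)$.
   Context: All logarithms are base 2. Quantum circuits are built from arbitrary single-qubit unitary gates and CNOT gates. The size of a circuit is its number of gates; its depth is the minimum number of layers into which the gates can be arranged so that the gates within a layer act on pairwise disjoint qubits. The $m$ extra qubits are ancillary qubits: they start in $|0\rangle$ and must be returned to $|0\rangle$. *)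

theory Defs
  imports Complex_Main
begin

text \<open>Computational basis states of N qubits are bool lists of length N
  (qubit k is the k-th entry). A state is a function from bool lists to
  complex amplitudes; only its values on lists of length N are meaningful.\<close>

type_synonym qstate = "bool list \<Rightarrow> complex"

type_synonym mat2 = "bool \<Rightarrow> bool \<Rightarrow> complex"

definition unitary2 :: "mat2 \<Rightarrow> bool" where
  "unitary2 U \<longleftrightarrow>
     (\<forall>a a'. (\<Sum>b\<in>UNIV. cnj (U b a) * U b a') = (if a = a' then 1 else 0))"

datatype gate = G1 mat2 nat | CNOT nat nat

fun gate_qubits :: "gate \<Rightarrow> nat set" where
  "gate_qubits (G1 U j) = {j}"
| "gate_qubits (CNOT c t) = {c, t}"

fun valid_gate :: "nat \<Rightarrow> gate \<Rightarrow> bool" where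
  "valid_gate N (G1 U j) \<longleftrightarrow> unitary2 U \<and> j < N"
| "valid_gate N (CNOT c t) \<longleftrightarrow> c < N \<and> t < N \<and> c \<noteq> t"

fun apply_gate :: "gate \<Rightarrow> qstate \<Rightarrow> qstate" where
  "apply_gate (G1 U j) psi = (\<lambda>x. \<Sum>b\<in>UNIV. U (x ! j) b * psi (x[j := b]))"
| "apply_gate (CNOT c t) psi = (\<lambda>x. psi (x[t := (x ! t \<noteq> x ! c)]))"

type_synonym layer = "gate list"

definition valid_layer :: "nat \<Rightarrow> layer \<Rightarrow> bool" where
  "valid_layer N l \<longleftrightarrow> (\<forall>g \<in> set l. valid_gate N g) \<and>
     (\<forall>i < length l. \<forall>j < length l. i \<noteq> j \<longrightarrow>
        gate_qubits (l ! i) \<inter> gate_qubits (l ! j) = {})"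

definition apply_layer :: "layer \<Rightarrow> qstate \<Rightarrow> qstate" where
  "apply_layer l psi = fold apply_gate l psi"

text \<open>A circuit is given by an arrangement into layers (applied first to last).
  Its depth is at most the number of layers, its size is the number of gates.\<close>
type_synonym circuit = "layer list"

definition valid_circuit :: "nat \<Rightarrow> circuit \<Rightarrow> bool" where
  "valid_circuit N C \<longleftrightarrow> (\<forall>l \<in> set C. valid_layer N l)"

definition run_circuit :: "circuit \<Rightarrow> qstate \<Rightarrow> qstate" where
  "run_circuit C psi = fold apply_layer C psi"

definition circuit_depth :: "circuit \<Rightarrow> nat" where
  "circuit_depth C = length C"

definition circuit_size :: "circuit \<Rightarrow> nat" where
  "circuit_size C = sum_list (map length C)"

definition basis_state :: "bool list \<Rightarrow> qstate" where
  "basis_state v = (\<lambda>x. if x = v then 1 else 0)"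

end

theory Submission
  imports Defs
begin

text \<open>The state is built in batches. Next to the \<open>n\<close> data qubits there is a flag qubit; after some
  batches the state is the partial sum of the \<open>\<alpha> i |q i>\<close> with flag 0, plus a multiple of
  \<open>|0...0>\<close> with flag 1. A batch of \<open>B\<close> strings first splits the excitation of the flag over
  \<open>B\<close> further qubits by a binary tree of two-qubit rotations, which gives a one-hot index. The
  index is then turned into the string by a linear map over the two-element field, and erased by
  adding to its \<open>i\<close>-th qubit the test whether the data (including the flag) equal \<open>q i\<close>; the tests
  fail on all earlier branches because the strings are distinct and on the flagged branch because
  of the flag.

  Both the map and the tests are factored through blocks of \<open>k\<close> bits, with
  \<open>4 ^ k\<close> about \<open>min (m / n) d\<close>: the \<open>2 ^ k\<close> possible values of a block are shared by all strings,
  so a string costs \<open>O(n / k)\<close> gates and ancillas instead of \<open>O(n)\<close>, and all steps have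
  logarithmic depth because they run along binary trees. Hence batches of about \<open>k m / n\<close> strings
  fit into the ancillas.\<close>

section \<open>Layered circuits and their gates\<close>

text \<open>The obstacle to logarithmic depth is sharing: an index qubit controls every block and a
  table entry serves many strings, but gates on a common qubit cannot lie in one layer. Hence every
  incidence of a linear map gets a scratch qubit of its own; sources are copied into these, targets
  collect their parities, and the copies are erased. The choice of \<open>k\<close> balances the two
  costs of a batch of \<open>B\<close> strings, about \<open>B * n / k\<close> for the strings and
  \<open>n * 2 ^ k\<close> for the shared table. The bound \<open>4 ^ k <= m / n\<close> makes the
  table fit into the ancillas, and \<open>4 ^ k <= d\<close> makes it affordable even if one batch
  holds all strings. The total size is then \<open>O(n d / k)\<close>, and the two sides of the
  minimum produce the two summands of the claimed size. The summand \<open>log (n d)\<close> of the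
  depth covers the case of a single full batch, the other summand the case in which the ancillas
  limit the batch. Programs stay flat gate lists with a derivation of \<open>dep\<close> certifying
  their depth; layers are built only once, at the end. Thus semantics is a mere \<open>fold\<close>,
  and depth bounds compose by sequence, disjoint parallelism and reversal.\<close>

inductive dep :: "('g \<Rightarrow> 'q set) \<Rightarrow> 'g list \<Rightarrow> nat \<Rightarrow> bool" for supp where
  dep_Nil: "dep supp [] D"
| dep_single: "dep supp [g] (Suc D)"
| dep_seq: "dep supp a D1 \<Longrightarrow> dep supp b D2 \<Longrightarrow> dep supp (a @ b) (D1 + D2)"
| dep_par: "dep supp a D \<Longrightarrow> dep supp b D \<Longrightarrow> \<Union>(supp ` set a) \<inter> \<Union>(supp ` set b) = {} \<Longrightarrow> dep supp (a @ b) D"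

lemma dep_mono: "dep supp a D \<Longrightarrow> D \<le> D' \<Longrightarrow> dep supp a D'"
proof (induction arbitrary: D' rule: dep.induct)
  case (dep_single g D)
  then show ?case by (cases D') (auto intro: dep.intros)
next
  case (dep_seq a D1 b D2)
  have "dep supp (a @ b) (D1 + (D' - D1))"
    using dep_seq by (intro dep.dep_seq) auto
  then show ?case using dep_seq.prems by simp
qed (auto intro: dep.intros)

lemma dep_rev: "dep supp a D \<Longrightarrow> dep supp (rev a) D"
proof (induction rule: dep.induct)
  case (dep_seq a D1 b D2)
  show ?case using dep.dep_seq[OF dep_seq.IH(2) dep_seq.IH(1)] by (simp add: add.commute)
next
  case (dep_par a D b)
  have "\<Union>(supp ` set (rev b)) \<inter> \<Union>(supp ` set (rev a)) = {}"
    using dep_par.hyps by (simp add: Int_commute)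
  then show ?case using dep.dep_par[OF dep_par.IH(2,1)] by simp
qed (auto intro: dep.intros)

lemma dep_length: "dep supp a (length a)"
proof (induction a)
  case (Cons g a)
  then show ?case using dep_seq[OF dep_single[of supp g 0] Cons] by simp
qed (auto intro: dep.intros)

text \<open>The gates of one operation run one after another in at most \<open>c\<close> layers, and
  parallel operations stay parallel because an injective placement keeps disjoint supports
  disjoint.\<close>

lemma dep_expand:
  assumes "dep supp a D"
    and "\<And>g. g \<in> set a \<Longrightarrow> length (f g) \<le> c"
    and "\<And>g h. g \<in> set a \<Longrightarrow> h \<in> set (f g) \<Longrightarrow> supp' h \<subseteq> loc ` supp g"
    and "inj_on loc R" and "\<And>g. g \<in> set a \<Longrightarrow> supp g \<subseteq> R"
  shows "dep supp' (concat (map f a)) (c * D)"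
  using assms(1,2,3,5)
proof (induction rule: dep.induct)
  case (dep_single g D)
  then have "length (f g) \<le> c * Suc D" by (simp add: trans_le_add1)
  then show ?case
    using dep_mono[OF dep_length[of supp' "f g"], of "c * Suc D"] by simp
next
  case (dep_seq a D1 b D2)
  then show ?case by (simp add: distrib_left dep.dep_seq)
next
  case (dep_par a D b)
  have "loc ` \<Union>(supp ` set a) \<inter> loc ` \<Union>(supp ` set b) = {}"
  proof -
    have "\<Union>(supp ` set a) \<subseteq> R" "\<Union>(supp ` set b) \<subseteq> R" using dep_par.prems(3) by auto
    then have "loc ` \<Union>(supp ` set a) \<inter> loc ` \<Union>(supp ` set b)
        = loc ` (\<Union>(supp ` set a) \<inter> \<Union>(supp ` set b))"
      by (rule inj_on_image_Int[OF assms(4), symmetric])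
    then show ?thesis using dep_par.hyps by simp
  qed
  moreover have "\<Union>(supp' ` set (concat (map f l))) \<subseteq> loc ` \<Union>(supp ` set l)"
    if "\<And>g h. g \<in> set l \<Longrightarrow> h \<in> set (f g) \<Longrightarrow> supp' h \<subseteq> loc ` supp g" for l
  proof
    fix x assume "x \<in> \<Union>(supp' ` set (concat (map f l)))"
    then obtain g h where "g \<in> set l" "h \<in> set (f g)" "x \<in> supp' h" by auto
    then have "x \<in> loc ` supp g" using that by blast
    then show "x \<in> loc ` \<Union>(supp ` set l)" using \<open>g \<in> set l\<close> by (simp add: image_UN) blast
  qed
  from this[of a] this[of b]
  have "\<Union>(supp' ` set (concat (map f a))) \<subseteq> loc ` \<Union>(supp ` set a)"
    "\<Union>(supp' ` set (concat (map f b))) \<subseteq> loc ` \<Union>(supp ` set b)"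
    using dep_par.prems(2) by simp_all
  ultimately have "\<Union>(supp' ` set (concat (map f a))) \<inter> \<Union>(supp' ` set (concat (map f b))) = {}"
    by (metis (no_types, lifting) Int_mono subset_empty)
  moreover have "dep supp' (concat (map f a)) (c * D)" "dep supp' (concat (map f b)) (c * D)"
    using dep_par.IH dep_par.prems by auto
  ultimately show ?case by (simp add: dep.dep_par)
qed (auto intro: dep.intros)

section \<open>Gate lists and their arrangement into layers\<close>

abbreviation run_gates :: "gate list \<Rightarrow> qstate \<Rightarrow> qstate" where
  "run_gates \<equiv> fold apply_gate"

lemma apply_gate_commute:
  assumes "gate_qubits g \<inter> gate_qubits h = {}"
  shows "apply_gate g (apply_gate h psi) = apply_gate h (apply_gate g psi)"
proof (cases g; cases h)
  fix U j V k assume "g = G1 U j" "h = G1 V k"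
  then show ?thesis using assms
    by (simp add: UNIV_bool list_update_swap[of j k] algebra_simps)
next
  fix U j c t assume "g = G1 U j" "h = CNOT c t"
  then show ?thesis using assms
    by (simp add: UNIV_bool list_update_swap[of j t])
next
  fix U j c t assume "h = G1 U j" "g = CNOT c t"
  then show ?thesis using assms
    by (simp add: UNIV_bool list_update_swap[of j t])
next
  fix c t c' t' assume "g = CNOT c t" "h = CNOT c' t'"
  then show ?thesis using assms
    by (simp add: list_update_swap[of t t'])
qed

lemma apply_gates_commute1:
  assumes "gate_qubits g \<inter> \<Union>(gate_qubits ` set b) = {}"
  shows "apply_gate g (run_gates b psi) = run_gates b (apply_gate g psi)"
  using assms
proof (induction b arbitrary: psi)
  case (Cons h b)
  then show ?case using apply_gate_commute[of g h] by (simp add: Int_Un_distrib)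
qed simp

lemma apply_gates_commute:
  assumes "\<Union>(gate_qubits ` set a) \<inter> \<Union>(gate_qubits ` set b) = {}"
  shows "run_gates a (run_gates b psi) = run_gates b (run_gates a psi)"
  using assms
proof (induction a arbitrary: psi)
  case (Cons g a)
  have "gate_qubits g \<inter> \<Union>(gate_qubits ` set b) = {}" using Cons.prems by auto
  then show ?case using Cons apply_gates_commute1[of g b] by (simp add: Int_Un_distrib2)
qed simp

text \<open>Zips two circuits layer by layer, so that the depth is the maximum and not the sum;
  intended for circuits on disjoint qubits.\<close>

fun par :: "circuit \<Rightarrow> circuit \<Rightarrow> circuit" where
  "par [] D = D"
| "par C [] = C"
| "par (k # C) (l # D) = (k @ l) # par C D"

lemma par_length: "length (par C D) = max (length C) (length D)"
  by (induction C D rule: par.induct) auto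

lemma par_size: "circuit_size (par C D) = circuit_size C + circuit_size D"
  by (induction C D rule: par.induct) (auto simp: circuit_size_def)

lemma par_set: "set (concat (par C D)) = set (concat C) \<union> set (concat D)"
  by (induction C D rule: par.induct) auto

lemma run_circuit_concat: "run_circuit C psi = run_gates (concat C) psi"
  by (induction C arbitrary: psi) (auto simp: run_circuit_def apply_layer_def)

lemma par_run:
  assumes "\<Union>(gate_qubits ` set (concat C)) \<inter> \<Union>(gate_qubits ` set (concat D)) = {}"
  shows "run_gates (concat (par C D)) psi
    = run_gates (concat D) (run_gates (concat C) psi)"
  using assms
proof (induction C D arbitrary: psi rule: par.induct)
  case (3 k C l D)
  \<comment> \<open>Merging moves the first layer \<open>l\<close> of the second circuit in front of
    the rest \<open>C\<close> of the first one, which is harmless because they commute.\<close>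
  have "\<Union>(gate_qubits ` set l) \<inter> \<Union>(gate_qubits ` set (concat C)) = {}" using "3.prems" by auto
  then have "run_gates l (run_gates (concat C) phi)
      = run_gates (concat C) (run_gates l phi)" for phi
    by (rule apply_gates_commute)
  moreover have "\<Union>(gate_qubits ` set (concat C)) \<inter> \<Union>(gate_qubits ` set (concat D)) = {}"
    using "3.prems" by auto
  ultimately show ?case using "3.IH" by simp
qed auto

lemma valid_layer_append:
  assumes "valid_layer N k" "valid_layer N l"
    "\<Union>(gate_qubits ` set k) \<inter> \<Union>(gate_qubits ` set l) = {}"
  shows "valid_layer N (k @ l)"
proof -
  have *: "gate_qubits g \<inter> gate_qubits h = {}" if "g \<in> set k" "h \<in> set l" for g h
    using that assms(3) by blast
  have K: "gate_qubits (k ! i) \<inter> gate_qubits (k ! j) = {}"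
    if "i < length k" "j < length k" "i \<noteq> j" for i j
    using assms(1) that unfolding valid_layer_def by blast
  have L: "gate_qubits (l ! i) \<inter> gate_qubits (l ! j) = {}"
    if "i < length l" "j < length l" "i \<noteq> j" for i j
    using assms(2) that unfolding valid_layer_def by blast
  have "gate_qubits ((k @ l) ! i) \<inter> gate_qubits ((k @ l) ! j) = {}"
    if ij: "i < length k + length l" "j < length k + length l" "i \<noteq> j" for i j
  proof -
    consider "i < length k" "j < length k" | "i < length k" "\<not> j < length k"
      | "\<not> i < length k" "j < length k" | "\<not> i < length k" "\<not> j < length k" by blast
    then show ?thesis
    proof cases
      case 1
      then show ?thesis using K[of i j] ij by (simp add: nth_append)
    next
      case 2
      then show ?thesis using *[of "k ! i" "l ! (j - length k)"] ij by (simp add: nth_append)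
    next
      case 3
      then show ?thesis using *[of "k ! j" "l ! (i - length k)"] ij
        by (simp add: nth_append Int_commute)
    next
      case 4
      then have "i - length k \<noteq> j - length k" "i - length k < length l" "j - length k < length l"
        using ij by linarith+
      then show ?thesis using L[of "i - length k" "j - length k"] 4 by (simp add: nth_append)
    qed
  qed
  moreover have "valid_gate N g" if "g \<in> set (k @ l)" for g
    using assms(1,2) that unfolding valid_layer_def by auto
  ultimately show ?thesis unfolding valid_layer_def by simp
qed

lemma par_valid:
  assumes "\<Union>(gate_qubits ` set (concat C)) \<inter> \<Union>(gate_qubits ` set (concat D)) = {}"
    "valid_circuit N C" "valid_circuit N D"
  shows "valid_circuit N (par C D)"
  using assms
proof (induction C D rule: par.induct)
  case (3 k C l D)
  have d: "\<Union>(gate_qubits ` set k) \<inter> \<Union>(gate_qubits ` set l) = {}"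
    "\<Union>(gate_qubits ` set (concat C)) \<inter> \<Union>(gate_qubits ` set (concat D)) = {}"
    using "3.prems"(1) by auto
  have v: "valid_layer N k" "valid_layer N l" "valid_circuit N C" "valid_circuit N D"
    using "3.prems"(2,3) by (simp_all add: valid_circuit_def)
  show ?case
    using valid_layer_append[OF v(1,2) d(1)] "3.IH"[OF d(2) v(3,4)] by (simp add: valid_circuit_def)
qed simp_all

text \<open>Induction over the certificate: sequence becomes concatenation of layer lists, parallel
  composition becomes \<open>par\<close>. The equation for \<open>set (concat C)\<close> is carried
  along because \<open>dep_par\<close> states disjointness for the flat gate lists, while
  \<open>par\<close> needs it for the circuits built from them.\<close>

lemma layering:
  assumes "dep gate_qubits gs D" "\<And>g. g \<in> set gs \<Longrightarrow> valid_gate N g"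
  shows "\<exists>C. valid_circuit N C \<and> circuit_depth C \<le> D \<and> circuit_size C = length gs \<and>
    set (concat C) = set gs \<and> (\<forall>psi. run_circuit C psi = run_gates gs psi)"
  using assms
proof (induction rule: dep.induct)
  case (dep_Nil D)
  show ?case by (rule exI[of _ "[]"])
      (auto simp: valid_circuit_def circuit_depth_def circuit_size_def run_circuit_def)
next
  case (dep_single g D)
  then show ?case by (intro exI[of _ "[[g]]"])
      (auto simp: valid_circuit_def valid_layer_def circuit_depth_def circuit_size_def run_circuit_concat)
next
  case (dep_seq a D1 b D2)
  have "\<And>g. g \<in> set a \<Longrightarrow> valid_gate N g" "\<And>g. g \<in> set b \<Longrightarrow> valid_gate N g"
    using dep_seq.prems by simp_all
  from dep_seq.IH(1)[OF this(1)] dep_seq.IH(2)[OF this(2)] obtain A B where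
    A: "valid_circuit N A" "circuit_depth A \<le> D1" "circuit_size A = length a"
    "set (concat A) = set a" "\<And>psi. run_circuit A psi = run_gates a psi"
    and B: "valid_circuit N B" "circuit_depth B \<le> D2" "circuit_size B = length b"
    "set (concat B) = set b" "\<And>psi. run_circuit B psi = run_gates b psi"
    by blast
  show ?case
  proof (intro exI[of _ "A @ B"] conjI allI)
    show "valid_circuit N (A @ B)" using A(1) B(1) by (auto simp: valid_circuit_def)
    show "circuit_depth (A @ B) \<le> D1 + D2" using A(2) B(2) by (simp add: circuit_depth_def)
    show "circuit_size (A @ B) = length (a @ b)" using A(3) B(3) by (simp add: circuit_size_def)
    show "set (concat (A @ B)) = set (a @ b)" using A(4) B(4) by simp
    show "run_circuit (A @ B) psi = run_gates (a @ b) psi" for psi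
      using A(5) B(5) by (simp add: run_circuit_def)
  qed
next
  case (dep_par a D b)
  have "\<And>g. g \<in> set a \<Longrightarrow> valid_gate N g" "\<And>g. g \<in> set b \<Longrightarrow> valid_gate N g"
    using dep_par.prems by simp_all
  from dep_par.IH(1)[OF this(1)] dep_par.IH(2)[OF this(2)] obtain A B where
    A: "valid_circuit N A" "circuit_depth A \<le> D" "circuit_size A = length a"
    "set (concat A) = set a" "\<And>psi. run_circuit A psi = run_gates a psi"
    and B: "valid_circuit N B" "circuit_depth B \<le> D" "circuit_size B = length b"
    "set (concat B) = set b" "\<And>psi. run_circuit B psi = run_gates b psi"
    by blast
  have d: "\<Union>(gate_qubits ` set (concat A)) \<inter> \<Union>(gate_qubits ` set (concat B)) = {}"
    unfolding A(4) B(4) by (rule dep_par.hyps)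
  show ?case
  proof (intro exI[of _ "par A B"] conjI allI)
    show "valid_circuit N (par A B)" using A(1) B(1) by (rule par_valid[OF d])
    show "circuit_depth (par A B) \<le> D" using A(2) B(2) by (simp add: circuit_depth_def par_length)
    show "circuit_size (par A B) = length (a @ b)" using A(3) B(3) by (simp add: par_size)
    show "set (concat (par A B)) = set (a @ b)" unfolding par_set A(4) B(4) by simp
    show "run_circuit (par A B) psi = run_gates (a @ b) psi" for psi
      using A(5) B(5) unfolding run_circuit_concat par_run[OF d] by simp
  qed
qed

section \<open>Action of the gates on basis states\<close>

definition ket :: "nat \<Rightarrow> (nat \<Rightarrow> bool) \<Rightarrow> qstate" where
  "ket N s = basis_state (map s [0..<N])"

lemma apply_gate_sum:
  "apply_gate g (\<lambda>x. \<Sum>i\<in>I. c i * f i x) = (\<lambda>x. \<Sum>i\<in>I. c i * apply_gate g (f i) x)"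
  by (cases g) (auto simp: fun_eq_iff UNIV_bool sum_distrib_left sum.distrib algebra_simps)

lemma apply_gates_sum:
  "run_gates gs (\<lambda>x. \<Sum>i\<in>I. c i * f i x) = (\<lambda>x. \<Sum>i\<in>I. c i * run_gates gs (f i) x)"
  by (induction gs arbitrary: f) (simp_all only: fold_simps apply_gate_sum)

lemma apply_gates_add:
  "run_gates gs (\<lambda>x. f x + h x) = (\<lambda>x. run_gates gs f x + run_gates gs h x)"
  using apply_gates_sum[of gs "\<lambda>_. 1" "\<lambda>i x. if i then f x else h x" UNIV]
  by (simp add: UNIV_bool add.commute if_distrib[of "fold _ _"] )

lemma apply_gates_scale:
  "run_gates gs (\<lambda>x. c * f x) = (\<lambda>x. c * run_gates gs f x)"
  using apply_gates_sum[of gs "\<lambda>_. c" "\<lambda>i x. f x" "{0::nat}"]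
  by simp

lemma eq_map_upt: "x = map s [0..<N] \<longleftrightarrow> length x = N \<and> (\<forall>i<N. x ! i = s i)"
proof -
  have "x = map s [0..<N] \<longleftrightarrow> length x = N \<and> (\<forall>i<length x. x ! i = map s [0..<N] ! i)"
    unfolding list_eq_iff_nth_eq[of x] by (simp only: length_map length_upt diff_zero)
  also have "\<dots> \<longleftrightarrow> length x = N \<and> (\<forall>i<N. x ! i = s i)"
    by (rule conj_cong[OF refl]) simp
  finally show ?thesis .
qed

lemma ket_apply: "ket N s x = (if length x = N \<and> (\<forall>i<N. x ! i = s i) then 1 else 0)"
  unfolding ket_def basis_state_def eq_map_upt ..

text \<open>A gate reads its input state at a list with one entry changed. Moving the change from
  the argument to the basis state turns this pullback definition of \<open>apply_gate\<close> into a
  forward action on assignments.\<close>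

lemma ket_update:
  assumes "j < N"
  shows "ket N s (x[j := b]) = (if b = s j then ket N (s(j := x ! j)) x else 0)"
proof -
  have "(\<forall>i<N. x[j := b] ! i = s i) \<longleftrightarrow> b = s j \<and> (\<forall>i<N. x ! i = (s(j := x ! j)) i)"
    if "length x = N"
  proof
    assume L: "\<forall>i<N. x[j := b] ! i = s i"
    have "b = s j" using L assms that by (metis nth_list_update_eq)
    moreover have "x ! i = (s(j := x ! j)) i" if "i < N" for i
      using L that by (cases "i = j") auto
    ultimately show "b = s j \<and> (\<forall>i<N. x ! i = (s(j := x ! j)) i)" by blast
  next
    assume R: "b = s j \<and> (\<forall>i<N. x ! i = (s(j := x ! j)) i)"
    have "x[j := b] ! i = s i" if "i < N" for i
    proof (cases "i = j")
      case True
      then show ?thesis using R assms \<open>length x = N\<close> by simp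
    next
      case False
      then show ?thesis using R that by simp
    qed
    then show "\<forall>i<N. x[j := b] ! i = s i" by blast
  qed
  then show ?thesis unfolding ket_apply length_list_update by (cases "length x = N") simp_all
qed

lemma ket_fun_upd:
  assumes "j < N" "b \<noteq> x ! j"
  shows "ket N (s(j := b)) x = 0"
proof -
  have "\<not> (\<forall>i<N. x ! i = (s(j := b)) i)" using assms by (metis fun_upd_same)
  then show ?thesis unfolding ket_apply by simp
qed

lemma apply_CNOT_ket:
  assumes "c < N" "t < N" "c \<noteq> t"
  shows "apply_gate (CNOT c t) (ket N s) = ket N (s(t := (s t \<noteq> s c)))"
proof
  fix x
  have c: "x ! c = s c" if "ket N (s(t := b)) x \<noteq> 0" for b
  proof -
    have "\<forall>i<N. x ! i = (s(t := b)) i" using that unfolding ket_apply by (simp split: if_splits)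
    then show ?thesis using assms by simp
  qed
  have "ket N (s(t := (s t \<noteq> s c))) x =
      (if (s t \<noteq> s c) = x ! t then ket N (s(t := x ! t)) x else 0)"
    using ket_fun_upd[OF assms(2)] by simp
  moreover have "apply_gate (CNOT c t) (ket N s) x =
      (if (x ! t \<noteq> x ! c) = s t then ket N (s(t := x ! t)) x else 0)"
    using assms by (simp add: ket_update)
  moreover have "((s t \<noteq> s c) = x ! t) = ((x ! t \<noteq> x ! c) = s t)" if "ket N (s(t := x ! t)) x \<noteq> 0"
    using c[OF that] by blast
  ultimately show "apply_gate (CNOT c t) (ket N s) x = ket N (s(t := (s t \<noteq> s c))) x"
    by (cases "ket N (s(t := x ! t)) x = 0") simp_all
qed

lemma apply_G1_ket:
  assumes "j < N"
  shows "apply_gate (G1 U j) (ket N s) = (\<lambda>x. \<Sum>b\<in>UNIV. U b (s j) * ket N (s(j := b)) x)"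
proof
  fix x
  show "apply_gate (G1 U j) (ket N s) x = (\<Sum>b\<in>UNIV. U b (s j) * ket N (s(j := b)) x)"
    using ket_fun_upd[OF assms, of "\<not> x ! j" x s] assms
    by (cases "s j"; cases "x ! j") (simp_all add: UNIV_bool ket_update)
qed

section \<open>Elementary unitaries and the Toffoli gate\<close>

definition pauliX :: mat2 where "pauliX a b = (if a = b then 0 else 1)"
definition phase :: "complex \<Rightarrow> mat2" where
  "phase w a b = (if a = b then if a then w else 1 else 0)"
definition hadamard :: mat2 where
  "hadamard a b = (if a \<and> b then -1 else 1) / complex_of_real (sqrt 2)"

lemma csqrt2: "complex_of_real (sqrt 2) * complex_of_real (sqrt 2) = 2"
  by (metis of_real_mult of_real_numeral real_sqrt_mult_self abs_numeral)

lemma unitary_pauliX: "unitary2 pauliX"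
  by (auto simp: unitary2_def pauliX_def UNIV_bool)

lemma unitary_phase: "cmod w = 1 \<Longrightarrow> unitary2 (phase w)"
  by (auto simp: unitary2_def phase_def UNIV_bool complex_norm_square[symmetric] mult.commute)

lemma unitary_hadamard: "unitary2 hadamard"
  by (auto simp: unitary2_def hadamard_def UNIV_bool csqrt2)

lemma apply_pauliX_ket:
  "j < N \<Longrightarrow> apply_gate (G1 pauliX j) (ket N s) = ket N (s(j := \<not> s j))"
  by (cases "s j") (auto simp: apply_G1_ket pauliX_def UNIV_bool simp del: apply_gate.simps)

lemma apply_phase_ket:
  "j < N \<Longrightarrow> apply_gate (G1 (phase w) j) (ket N s) = (\<lambda>x. (if s j then w else 1) * ket N s x)"
  by (cases "s j") (auto simp: apply_G1_ket phase_def UNIV_bool fun_upd_idem simp del: apply_gate.simps)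

lemma apply_hadamard_ket:
  "j < N \<Longrightarrow> apply_gate (G1 hadamard j) (ket N s) =
    (\<lambda>x. 1 / complex_of_real (sqrt 2) * ket N (s(j := False)) x
       + (if s j then -1 else 1) / complex_of_real (sqrt 2) * ket N (s(j := True)) x)"
  by (cases "s j") (auto simp: apply_G1_ket hadamard_def UNIV_bool simp del: apply_gate.simps)

definition omega8 :: complex where "omega8 = cis (pi / 4)"

lemma omega8: "omega8 * cnj omega8 = 1" "cnj omega8 * omega8 = 1" "omega8 * omega8 = \<i>"
  by (simp_all add: omega8_def cis_mult cis_cnj)

text \<open>The phase polynomial of the doubly controlled sign: \<open>(-1)^(x y z)\<close> is
  \<open>omega8\<close> to the power \<open>x + y + z - (x+y) - (x+z) - (y+z) + (x+y+z)\<close>, the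
  sums in parentheses taken modulo 2. The CNOTs produce these seven parities in turn, and each
  receives \<open>omega8\<close> or its conjugate.\<close>

definition ccz_gates :: "nat \<Rightarrow> nat \<Rightarrow> nat \<Rightarrow> gate list" where
  "ccz_gates a b t = [CNOT b t, G1 (phase (cnj omega8)) t, CNOT a t, G1 (phase omega8) t,
     CNOT b t, G1 (phase (cnj omega8)) t, CNOT a t, G1 (phase omega8) b, G1 (phase omega8) t,
     CNOT a b, G1 (phase omega8) a, G1 (phase (cnj omega8)) b, CNOT a b]"

lemma ccz_gates_ket:
  assumes "a < N" "b < N" "t < N" "a \<noteq> b" "a \<noteq> t" "b \<noteq> t"
  shows "run_gates (ccz_gates a b t) (ket N s) =
    (\<lambda>x. (if s a \<and> s b \<and> s t then -1 else 1) * ket N s x)"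
proof -
  \<comment> \<open>Indexing by the three bits reduces the claim to eight explicit computations with
    eighth roots of unity.\<close>
  define K where "K x y z = ket N (s(a := x, b := y, t := z))" for x y z
  have c1: "apply_gate (CNOT b t) (K x y z) = K x y (z \<noteq> y)"
    "apply_gate (CNOT a t) (K x y z) = K x y (z \<noteq> x)"
    "apply_gate (CNOT a b) (K x y z) = K x (y \<noteq> x) z" for x y z
    using assms unfolding K_def
    by (simp_all add: apply_CNOT_ket fun_upd_twist del: apply_gate.simps)
  have c2: "apply_gate (G1 (phase w) t) (K x y z) = (\<lambda>v. (if z then w else 1) * K x y z v)"
    "apply_gate (G1 (phase w) b) (K x y z) = (\<lambda>v. (if y then w else 1) * K x y z v)"
    "apply_gate (G1 (phase w) a) (K x y z) = (\<lambda>v. (if x then w else 1) * K x y z v)" for w x y z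
    using assms unfolding K_def by (simp_all add: apply_phase_ket del: apply_gate.simps)
  have sc: "apply_gate g (\<lambda>x. c * f x) = (\<lambda>x. c * apply_gate g f x)" for g c f
    using apply_gates_scale[of "[g]" c f] by simp
  have sc': "apply_gate g (\<lambda>x. - f x) = (\<lambda>x. - apply_gate g f x)" for g f
    using sc[of g "-1" f] by simp
  have cc: "cnj omega8 * cnj omega8 = - \<i>"
    using arg_cong[OF omega8(3), of cnj] by simp
  have om: "omega8 * (omega8 * z) = \<i> * z" "omega8 * (cnj omega8 * z) = z"
    "cnj omega8 * (omega8 * z) = z" "cnj omega8 * (cnj omega8 * z) = - \<i> * z" for z
    by (simp_all add: mult.assoc[symmetric] omega8 cc)
  have "run_gates (ccz_gates a b t) (K x y z) = (\<lambda>v. (if x \<and> y \<and> z then -1 else 1) * K x y z v)"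
    for x y z
    unfolding ccz_gates_def
    by (cases x; cases y; cases z) (simp_all add: c1 c2 sc sc' om omega8 cc del: apply_gate.simps)
  then have "run_gates (ccz_gates a b t) (K (s a) (s b) (s t)) =
    (\<lambda>v. (if s a \<and> s b \<and> s t then -1 else 1) * K (s a) (s b) (s t) v)" .
  then show ?thesis unfolding K_def by simp
qed

text \<open>Conjugation by Hadamard gates turns a sign on the target into a flip. With the 13 gates
  above this makes 15, the factor in \<open>compile_prog\<close>.\<close>

definition toffoli_gates :: "nat \<Rightarrow> nat \<Rightarrow> nat \<Rightarrow> gate list" where
  "toffoli_gates a b t = G1 hadamard t # ccz_gates a b t @ [G1 hadamard t]"

lemma toffoli_gates_ket:
  assumes "a < N" "b < N" "t < N" "a \<noteq> b" "a \<noteq> t" "b \<noteq> t"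
  shows "run_gates (toffoli_gates a b t) (ket N s) = ket N (s(t := (s t \<noteq> (s a \<and> s b))))"
proof -
  define r where "r = 1 / complex_of_real (sqrt 2)"
  define e where "e = (if s t then -1 else 1 :: complex)"
  define z where "z = (if s a \<and> s b then -1 else 1 :: complex)"
  define k0 where "k0 = ket N (s(t := False))"
  define k1 where "k1 = ket N (s(t := True))"
  have r: "r * r = 1 / 2" by (simp add: r_def csqrt2)
  have H: "apply_gate (G1 hadamard t) (ket N s) = (\<lambda>x. r * k0 x + (e * r) * k1 x)"
    using assms by (simp add: apply_hadamard_ket r_def e_def k0_def k1_def del: apply_gate.simps)
  have H0: "apply_gate (G1 hadamard t) k0 = (\<lambda>x. r * k0 x + r * k1 x)"
    and H1: "apply_gate (G1 hadamard t) k1 = (\<lambda>x. r * k0 x + - r * k1 x)"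
    using assms unfolding k0_def k1_def
    by (simp_all add: apply_hadamard_ket r_def del: apply_gate.simps)
  have Z: "run_gates (ccz_gates a b t) k0 = k0"
    "run_gates (ccz_gates a b t) k1 = (\<lambda>x. z * k1 x)"
    using assms unfolding k0_def k1_def z_def by (simp_all add: ccz_gates_ket)
  have "run_gates (toffoli_gates a b t) (ket N s) =
      apply_gate (G1 hadamard t) (\<lambda>x. r * k0 x + (e * r) * (z * k1 x))"
    unfolding toffoli_gates_def
    by (simp add: H apply_gates_add apply_gates_scale Z del: apply_gate.simps)
  also have "\<dots> = (\<lambda>x. r * (r * k0 x + r * k1 x) + (e * r) * (z * (r * k0 x + - r * k1 x)))"
    using apply_gates_add[of "[G1 hadamard t]" "\<lambda>x. r * k0 x" "\<lambda>x. (e * r) * (z * k1 x)"]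
      apply_gates_scale[of "[G1 hadamard t]" r k0]
      apply_gates_scale[of "[G1 hadamard t]" "e * r" "\<lambda>x. z * k1 x"]
      apply_gates_scale[of "[G1 hadamard t]" z k1]
    by (simp add: H0 H1 del: apply_gate.simps)
  \<comment> \<open>Here \<open>r * r = 1 / 2\<close> and \<open>e * z\<close> is a sign, so exactly
    one coefficient survives; it is that of \<open>k1\<close> iff \<open>e * z = -1\<close>, that
    is, iff \<open>s t\<close> differs from the conjunction.\<close>
  also have "\<dots> = (\<lambda>x. r * r * ((1 + e * z) * k0 x + (1 - e * z) * k1 x))"
    by (simp add: fun_eq_iff algebra_simps)
  also have "\<dots> = ket N (s(t := (s t \<noteq> (s a \<and> s b))))"
    unfolding r by (auto simp: e_def z_def k0_def k1_def fun_upd_idem)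
  finally show ?thesis .
qed

section \<open>Reversible programs over named registers and their compilation\<close>

datatype 'q op = Flip 'q | Cnot 'q 'q | Tof 'q 'q 'q

fun osupp :: "'q op \<Rightarrow> 'q set" where
  "osupp (Flip t) = {t}"
| "osupp (Cnot a t) = {a, t}"
| "osupp (Tof a b t) = {a, b, t}"

fun owf :: "'q op \<Rightarrow> bool" where
  "owf (Flip t) \<longleftrightarrow> True"
| "owf (Cnot a t) \<longleftrightarrow> a \<noteq> t"
| "owf (Tof a b t) \<longleftrightarrow> a \<noteq> b \<and> a \<noteq> t \<and> b \<noteq> t"

fun exec :: "'q op \<Rightarrow> ('q \<Rightarrow> bool) \<Rightarrow> 'q \<Rightarrow> bool" where
  "exec (Flip t) s = s(t := \<not> s t)"
| "exec (Cnot a t) s = s(t := (s t \<noteq> s a))"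
| "exec (Tof a b t) s = s(t := (s t \<noteq> (s a \<and> s b)))"

fun compile :: "('q \<Rightarrow> nat) \<Rightarrow> 'q op \<Rightarrow> gate list" where
  "compile loc (Flip t) = [G1 pauliX (loc t)]"
| "compile loc (Cnot a t) = [CNOT (loc a) (loc t)]"
| "compile loc (Tof a b t) = toffoli_gates (loc a) (loc b) (loc t)"

abbreviation run :: "'q op list \<Rightarrow> ('q \<Rightarrow> bool) \<Rightarrow> 'q \<Rightarrow> bool" where
  "run P \<equiv> fold exec P"

abbreviation supps :: "'q op list \<Rightarrow> 'q set" where
  "supps P \<equiv> \<Union>(osupp ` set P)"

text \<open>Programs name their registers symbolically and meet qubits only here; a qubit outside
  the layout holds 0. So every batch may bring its own registers and its own layout.\<close>

definition place :: "('q \<Rightarrow> nat) \<Rightarrow> 'q set \<Rightarrow> ('q \<Rightarrow> bool) \<Rightarrow> nat \<Rightarrow> bool" where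
  "place loc R s j \<longleftrightarrow> j \<in> loc ` R \<and> s (inv_into R loc j)"

lemma place_loc [simp]: "inj_on loc R \<Longrightarrow> r \<in> R \<Longrightarrow> place loc R s (loc r) = s r"
  by (simp add: place_def)

lemma place_upd:
  assumes "inj_on loc R" "r \<in> R"
  shows "place loc R (s(r := b)) = (place loc R s)(loc r := b)"
proof
  fix j
  show "place loc R (s(r := b)) j = ((place loc R s)(loc r := b)) j"
  proof (cases "j \<in> loc ` R")
    case True
    then obtain r' where "r' \<in> R" "j = loc r'" by blast
    then show ?thesis using assms by (auto simp: inj_on_eq_iff)
  next
    case False
    then show ?thesis using assms by (auto simp: place_def)
  qed
qed

lemma compile_ket:
  assumes "inj_on loc R" "loc ` R \<subseteq> {..<N}" "osupp g \<subseteq> R" "owf g"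
  shows "run_gates (compile loc g) (ket N (place loc R s)) = ket N (place loc R (exec g s))"
proof -
  have lt: "loc r < N" if "r \<in> R" for r using assms(2) that by blast
  have ne: "loc r \<noteq> loc r'" if "r \<in> R" "r' \<in> R" "r \<noteq> r'" for r r'
    using assms(1) that by (simp add: inj_on_eq_iff)
  show ?thesis using assms(1,3,4)
    by (cases g) (simp_all add: apply_pauliX_ket apply_CNOT_ket toffoli_gates_ket lt ne place_upd
        del: apply_gate.simps)
qed

lemma compile_valid:
  assumes "inj_on loc R" "loc ` R \<subseteq> {..<N}" "osupp g \<subseteq> R" "owf g" "h \<in> set (compile loc g)"
  shows "valid_gate N h" "gate_qubits h \<subseteq> loc ` osupp g"
proof -
  have lt: "loc r < N" if "r \<in> R" for r using assms(2) that by blast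
  have ne: "loc r \<noteq> loc r'" if "r \<in> R" "r' \<in> R" "r \<noteq> r'" for r r'
    using assms(1) that by (simp add: inj_on_eq_iff)
  have om: "cmod omega8 = 1" "cmod (cnj omega8) = 1" by (simp_all add: omega8_def)
  show "valid_gate N h" using assms(3-)
    by (cases g) (auto simp: toffoli_gates_def ccz_gates_def lt ne unitary_pauliX unitary_hadamard
        unitary_phase om)
  show "gate_qubits h \<subseteq> loc ` osupp g" using assms(5)
    by (cases g) (auto simp: toffoli_gates_def ccz_gates_def)
qed

lemma compile_length: "length (compile loc g) \<le> 15"
  by (cases g) (simp_all add: toffoli_gates_def ccz_gates_def)

lemma compile_prog:
  assumes "inj_on loc R" "loc ` R \<subseteq> {..<N}" "supps P \<subseteq> R" "\<And>g. g \<in> set P \<Longrightarrow> owf g"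
    "dep osupp P D"
  shows "\<exists>gs. dep gate_qubits gs (15 * D) \<and> length gs \<le> 15 * length P \<and>
    (\<forall>g\<in>set gs. valid_gate N g) \<and>
    (\<forall>s. run_gates gs (ket N (place loc R s)) = ket N (place loc R (run P s)))"
proof (intro exI[of _ "concat (map (compile loc) P)"] conjI allI ballI)
  have S: "osupp g \<subseteq> R" if "g \<in> set P" for g using assms(3) that by blast
  note cv = compile_valid[OF assms(1,2) S assms(4)]
  show "dep gate_qubits (concat (map (compile loc) P)) (15 * D)"
    using assms(5) compile_length cv(2) assms(1) S by (rule dep_expand)
  have "sum_list (map (\<lambda>g. length (compile loc g)) P) \<le> 15 * length P"
    using sum_list_mono[of P "\<lambda>g. length (compile loc g)" "\<lambda>_. 15", OF compile_length]
    by (simp add: sum_list_triv mult.commute)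
  then show "length (concat (map (compile loc) P)) \<le> 15 * length P"
    by (simp add: length_concat comp_def)
  show "valid_gate N h" if "h \<in> set (concat (map (compile loc) P))" for h
    using that cv(1) by auto
  show "run_gates (concat (map (compile loc) P)) (ket N (place loc R s)) =
      ket N (place loc R (run P s))" for s
    using S assms(4)
  proof (induction P arbitrary: s)
    case (Cons g P)
    then show ?case using compile_ket[OF assms(1,2), of g s] by simp
  qed simp
qed

section \<open>Programs of classical reversible operations\<close>

lemma exec_exec: "owf g \<Longrightarrow> exec g (exec g s) = s"
  by (cases g) (auto simp: fun_eq_iff)

lemma exec_outside: "q \<notin> osupp g \<Longrightarrow> exec g s q = s q"
  by (cases g) auto

lemma exec_cong: "osupp g \<subseteq> A \<Longrightarrow> \<forall>q\<in>A. s q = s' q \<Longrightarrow> \<forall>q\<in>A. exec g s q = exec g s' q"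
  by (cases g) auto

lemma run_rev: "\<forall>g\<in>set P. owf g \<Longrightarrow> run (rev P) (run P s) = s"
  by (induction P arbitrary: s) (auto simp: exec_exec)

lemma run_outside: "q \<notin> supps P \<Longrightarrow> run P s q = s q"
  by (induction P arbitrary: s) (auto simp: exec_outside)

lemma run_cong: "supps P \<subseteq> A \<Longrightarrow> \<forall>q\<in>A. s q = s' q \<Longrightarrow> \<forall>q\<in>A. run P s q = run P s' q"
proof (induction P arbitrary: s s')
  case (Cons g P)
  then show ?case using exec_cong[of g A s s'] by simp
qed simp

text \<open>Well-formedness is included because it makes each operation its own inverse, so that
  reversing the list undoes the program (\<open>run_rev\<close>).\<close>

definition prog :: "'q op list \<Rightarrow> nat \<Rightarrow> nat \<Rightarrow> 'q set \<Rightarrow> bool" where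
  "prog P D S A \<longleftrightarrow> dep osupp P D \<and> length P \<le> S \<and> (\<forall>g\<in>set P. owf g) \<and> supps P \<subseteq> A"

lemma prog_mono: "prog P D S A \<Longrightarrow> D \<le> D' \<Longrightarrow> S \<le> S' \<Longrightarrow> A \<subseteq> A' \<Longrightarrow> prog P D' S' A'"
  unfolding prog_def using dep_mono[of osupp P D D'] by (meson order_trans)

lemma prog_Nil: "prog [] D S A"
  by (simp add: prog_def dep_Nil)

lemma prog_single: "owf g \<Longrightarrow> osupp g \<subseteq> A \<Longrightarrow> prog [g] 1 1 A"
  using dep_single[of osupp g 0] by (simp add: prog_def)

lemma prog_seq: "prog P D S A \<Longrightarrow> prog Q D' S' A \<Longrightarrow> prog (P @ Q) (D + D') (S + S') A"
  unfolding prog_def by (auto intro: dep_seq)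

lemma prog_par:
  assumes "prog P D S A" "prog Q D S' B" "A \<inter> B = {}"
  shows "prog (P @ Q) D (S + S') (A \<union> B)"
proof -
  have "supps P \<inter> supps Q = {}" 
  proof -
    have "supps P \<subseteq> A" "supps Q \<subseteq> B" using assms(1,2) unfolding prog_def by simp_all
    then show ?thesis using assms(3) by blast
  qed
  then have "dep osupp (P @ Q) D" using assms unfolding prog_def by (intro dep_par) auto
  then show ?thesis using assms unfolding prog_def by auto
qed

lemma prog_rev: "prog P D S A \<Longrightarrow> prog (rev P) D S A"
  unfolding prog_def by (simp add: dep_rev)

lemma prog_conj:
  assumes "prog F D S A" "prog G D' S' A"
  shows "prog (F @ G @ rev F) (2 * D + D') (2 * S + S') A"
  by (rule prog_mono[OF prog_seq[OF assms(1) prog_seq[OF assms(2) prog_rev[OF assms(1)]]]]) simp_all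

lemma prog_outside: "prog P D S A \<Longrightarrow> q \<notin> A \<Longrightarrow> run P s q = s q"
  unfolding prog_def using run_outside[of q P s] by blast

lemma prog_cong: "prog P D S A \<Longrightarrow> (\<And>q. q \<in> A \<Longrightarrow> s q = s' q) \<Longrightarrow> q \<in> A \<Longrightarrow> run P s q = run P s' q"
  unfolding prog_def using run_cong[of P A s s'] by blast

lemma prog_run_rev: "prog P D S A \<Longrightarrow> run (rev P) (run P s) = s"
  unfolding prog_def using run_rev by blast

text \<open>Compute, use, uncompute. Within \<open>A\<close> the middle program leaves what
  \<open>F\<close> produced, so \<open>rev F\<close> restores the input there; the change on
  \<open>T\<close> survives since \<open>F\<close> does not touch \<open>T\<close>. This is how
  scratch registers get back to 0.\<close>

lemma run_conj:
  assumes "prog F D S A" "\<And>q. q \<notin> T \<Longrightarrow> run G (run F s) q = run F s q" "A \<inter> T = {}"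
  shows "run (F @ G @ rev F) s = (\<lambda>q. if q \<in> T then run G (run F s) q else s q)"
proof
  fix q
  note R = prog_rev[OF assms(1)]
  show "run (F @ G @ rev F) s q = (if q \<in> T then run G (run F s) q else s q)"
  proof (cases "q \<in> A")
    case True
    then have "run (rev F) (run G (run F s)) q = run (rev F) (run F s) q"
      using assms(2,3) by (intro prog_cong[OF R]) blast+
    then show ?thesis using True assms(3) prog_run_rev[OF assms(1)] by auto
  next
    case False
    then show ?thesis
      using prog_outside[OF R False] prog_outside[OF assms(1) False] assms(2)[of q] by auto
  qed
qed

text \<open>Programs on disjoint registers neither see nor change each other's data, so the sizes
  add up while the depth is shared.\<close>

lemma prog_concat:
  assumes "distinct xs" "\<And>i. i \<in> set xs \<Longrightarrow> prog (P i) D (S i) (A i)"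
    "\<And>i j. i \<in> set xs \<Longrightarrow> j \<in> set xs \<Longrightarrow> i \<noteq> j \<Longrightarrow> A i \<inter> A j = {}"
  shows "prog (concat (map P xs)) D (\<Sum>i\<in>set xs. S i) (\<Union>i\<in>set xs. A i) \<and>
    (\<forall>s. \<forall>i\<in>set xs. \<forall>q\<in>A i. run (concat (map P xs)) s q = run (P i) s q)"
  using assms
proof (induction xs)
  case (Cons i xs)
  have d: "A i \<inter> (\<Union>j\<in>set xs. A j) = {}"
    using Cons.prems(1) Cons.prems(3)[of i] by fastforce
  have IH: "prog (concat (map P xs)) D (\<Sum>i\<in>set xs. S i) (\<Union>i\<in>set xs. A i)"
    "\<And>s j q. j \<in> set xs \<Longrightarrow> q \<in> A j \<Longrightarrow> run (concat (map P xs)) s q = run (P j) s q"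
    using Cons by simp_all
  have P: "prog (P i) D (S i) (A i)" using Cons.prems(2) by simp
  have "prog (concat (map P (i # xs))) D (\<Sum>i\<in>set (i # xs). S i) (\<Union>i\<in>set (i # xs). A i)"
    using prog_par[OF P IH(1) d] Cons.prems(1) by simp
  moreover have "run (concat (map P (i # xs))) s q = run (P j) s q"
    if j: "j \<in> set (i # xs)" "q \<in> A j" for s j q
  proof (cases "j = i")
    case True
    then have "q \<notin> (\<Union>j\<in>set xs. A j)" using d j by blast
    then show ?thesis using prog_outside[OF IH(1)] True by simp
  next
    case False
    then have ji: "j \<in> set xs" using j by simp
    have "run (P i) s q' = s q'" if "q' \<in> A j" for q'
      using prog_outside[OF P] that d ji by blast
    then have "run (P j) (run (P i) s) q = run (P j) s q"
      using j by (intro prog_cong[OF Cons.prems(2)[OF j(1)]]) auto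
    then show ?thesis using IH(2)[OF ji j(2), of "run (P i) s"] by simp
  qed
  ultimately show ?case by blast
qed (simp add: prog_Nil)

lemma prog_family:
  assumes "finite I" "\<And>i. i \<in> I \<Longrightarrow> prog (P i) D (S i) (A i)"
    "\<And>i j. i \<in> I \<Longrightarrow> j \<in> I \<Longrightarrow> i \<noteq> j \<Longrightarrow> A i \<inter> A j = {}"
  obtains Q where "prog Q D (\<Sum>i\<in>I. S i) (\<Union>i\<in>I. A i)"
    "\<And>s i q. i \<in> I \<Longrightarrow> q \<in> A i \<Longrightarrow> run Q s q = run (P i) s q"
    "\<And>s q. q \<notin> (\<Union>i\<in>I. A i) \<Longrightarrow> run Q s q = s q"
proof -
  obtain xs where xs: "set xs = I" "distinct xs" using finite_distinct_list[OF assms(1)] by blast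
  have "prog (concat (map P xs)) D (\<Sum>i\<in>I. S i) (\<Union>i\<in>I. A i) \<and>
    (\<forall>s. \<forall>i\<in>I. \<forall>q\<in>A i. run (concat (map P xs)) s q = run (P i) s q)"
    using prog_concat[of xs P D S A] xs assms(2,3) by simp
  then show ?thesis using that[of "concat (map P xs)"] prog_outside[of "concat (map P xs)"] by metis
qed

text \<open>The induction behind all binary trees here (copying, parity, conjunction, splitting of
  amplitudes): halving a longer list gives two nonempty lists of at most \<open>2 ^ D\<close>
  entries, so each unit of \<open>D\<close> pays for one level of the tree.\<close>

lemma halving_induct [consumes 2, case_names single split]:
  assumes "L \<noteq> []" "length L \<le> 2 ^ D"
    and single: "\<And>x D. Q D [x]"
    and split: "\<And>D L1 L2. L1 \<noteq> [] \<Longrightarrow> L2 \<noteq> [] \<Longrightarrow> Q D L1 \<Longrightarrow> Q D L2 \<Longrightarrow> Q (Suc D) (L1 @ L2)"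
  shows "Q D L"
  using assms(1,2)
proof (induction D arbitrary: L)
  case 0
  then obtain x where "L = [x]" by (cases L) auto
  then show ?case using single by simp
next
  case (Suc D)
  show ?case
  proof (cases "length L = 1")
    case True
    then obtain x where "L = [x]" by (cases L) auto
    then show ?thesis using single by simp
  next
    case False
    moreover have "length L \<noteq> 0" using Suc.prems by simp
    ultimately have l: "length L \<ge> 2" by linarith
    define h where "h = length L div 2"
    have h: "0 < h" "h < length L" "h \<le> 2 ^ D" "length L - h \<le> 2 ^ D"
      using l Suc.prems(2) unfolding h_def by auto
    have "Q (Suc D) (take h L @ drop h L)"
      using h l by (intro split Suc.IH) auto
    then show ?thesis by simp
  qed
qed

text \<open>One CNOT copies the head of the left half to the head of the right half, then both
  halves proceed at the same time. Only the tail must be clean, as the head holds the value to be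
  copied.\<close>

lemma fan_list:
  assumes "L \<noteq> []" "length L \<le> 2 ^ D" "distinct L"
  shows "\<exists>P. prog P D (length L - 1) (set L) \<and>
    (\<forall>s. (\<forall>l\<in>set (tl L). \<not> s l) \<longrightarrow> (\<forall>l\<in>set L. run P s l = s (hd L)))"
  using assms
proof (induction rule: halving_induct)
  case (single x D)
  show ?case by (rule exI[of _ "[]"]) (simp add: prog_Nil)
next
  case (split D L1 L2)
  have dis: "distinct L1" "distinct L2" "set L1 \<inter> set L2 = {}" using split.prems by auto
  from split.IH(1)[OF dis(1)] obtain P1 where
    P1: "prog P1 D (length L1 - 1) (set L1)"
      "\<forall>s. (\<forall>l\<in>set (tl L1). \<not> s l) \<longrightarrow> (\<forall>l\<in>set L1. run P1 s l = s (hd L1))"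
    by (elim exE conjE)
  from split.IH(2)[OF dis(2)] obtain P2 where
    P2: "prog P2 D (length L2 - 1) (set L2)"
      "\<forall>s. (\<forall>l\<in>set (tl L2). \<not> s l) \<longrightarrow> (\<forall>l\<in>set L2. run P2 s l = s (hd L2))"
    by (elim exE conjE)
  define h1 h2 where "h1 = hd L1" and "h2 = hd L2"
  have h: "h1 \<in> set L1" "h2 \<in> set L2" "h1 \<noteq> h2" "h1 \<notin> set L2" "h2 \<notin> set L1"
    using split.hyps(1,2) dis(3) by (simp_all add: h1_def h2_def disjoint_iff) (metis hd_in_set)+
  let ?C = "Cnot h1 h2"
  let ?P = "[?C] @ (P1 @ P2)"
  have "prog ?P (1 + D) (1 + (length L1 - 1 + (length L2 - 1))) (set L1 \<union> set L2)"
    using h by (intro prog_seq prog_single prog_par P1(1) P2(1) dis(3)) auto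
  moreover have "1 + (length L1 - 1 + (length L2 - 1)) \<le> length (L1 @ L2) - 1"
    using split.hyps by (cases L1; cases L2) auto
  ultimately have "prog ?P (Suc D) (length (L1 @ L2) - 1) (set (L1 @ L2))"
    by (elim prog_mono) auto
  moreover have "run ?P s l = s (hd (L1 @ L2))"
    if z: "\<forall>l\<in>set (tl (L1 @ L2)). \<not> s l" and l: "l \<in> set (L1 @ L2)" for s l
  proof -
    define s1 where "s1 = exec ?C s"
    have tl2: "set L2 \<subseteq> set (tl (L1 @ L2))" "set (tl L1) \<subseteq> set (tl (L1 @ L2))"
      using split.hyps by (cases L1; auto)+
    have s1: "s1 h1 = s h1" "s1 h2 = s h1" using h z tl2 by (auto simp: s1_def)
    have z1: "\<not> s1 l" if "l \<in> set (tl L1)" for l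
    proof -
      have "l \<in> set L1" using that list.set_sel(2) split.hyps by metis
      then have "l \<noteq> h2" using h by blast
      then show ?thesis using z tl2 that by (auto simp: s1_def)
    qed
    have z2: "\<not> s1 l" if "l \<in> set (tl L2)" for l
    proof -
      have "l \<in> set L2" "l \<noteq> h2" using that dis(2) split.hyps
        by (cases L2; auto simp: h2_def)+
      then show ?thesis using z tl2 by (auto simp: s1_def)
    qed
    define s2 where "s2 = run P1 s1"
    have s2: "s2 q = s1 q" if "q \<in> set L2" for q
      unfolding s2_def using prog_outside[OF P1(1)] that dis(3) by blast
    have "run P2 s2 l = s h1"
    proof (cases "l \<in> set L1")
      case True
      then have "l \<notin> set L2" using dis(3) by blast
      then have "run P2 s2 l = run P1 s1 l" using prog_outside[OF P2(1)] by (simp add: s2_def)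
      also have "\<dots> = s1 h1" using P1(2)[rule_format, of s1 l] z1 True unfolding h1_def by simp
      finally show ?thesis by (simp add: s1)
    next
      case False
      then have l2: "l \<in> set L2" using l by simp
      have "\<forall>l\<in>set (tl L2). \<not> s2 l"
      proof
        fix l assume a: "l \<in> set (tl L2)"
        then have "l \<in> set L2" using list.set_sel(2) split.hyps by metis
        then show "\<not> s2 l" using s2 z2 a by simp
      qed
      then have "run P2 s2 l = s2 h2" using P2(2)[rule_format, of s2 l] l2 unfolding h2_def by simp
      then show ?thesis using s2[OF h(2)] s1 by simp
    qed
    then show ?thesis using split.hyps by (simp add: s1_def s2_def h1_def)
  qed
  ultimately show ?case by blast
qed

text \<open>The mirror image of copying: each half gathers its parity in its head, then the right
  head is added to the left one. The other entries are left altered, which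
  \<open>parity_gate\<close> repairs.\<close>

lemma sum_list_tree:
  assumes "L \<noteq> []" "length L \<le> 2 ^ D" "distinct L"
  shows "\<exists>P. prog P D (length L - 1) (set L) \<and>
    (\<forall>s. run P s (hd L) \<longleftrightarrow> odd (card {l \<in> set L. s l}))"
  using assms
proof (induction rule: halving_induct)
  case (single x D)
  have "{l. l = x \<and> s l} = (if s x then {x} else {})" for s :: "'a \<Rightarrow> bool" by auto
  then show ?case by (intro exI[of _ "[]"]) (simp add: prog_Nil)
next
  case (split D L1 L2)
  have dis: "distinct L1" "distinct L2" "set L1 \<inter> set L2 = {}" using split.prems by auto
  from split.IH(1)[OF dis(1)] obtain P1 where
    P1: "prog P1 D (length L1 - 1) (set L1)"
      "\<forall>s. run P1 s (hd L1) \<longleftrightarrow> odd (card {l \<in> set L1. s l})"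
    by (elim exE conjE)
  from split.IH(2)[OF dis(2)] obtain P2 where
    P2: "prog P2 D (length L2 - 1) (set L2)"
      "\<forall>s. run P2 s (hd L2) \<longleftrightarrow> odd (card {l \<in> set L2. s l})"
    by (elim exE conjE)
  define h1 h2 where "h1 = hd L1" and "h2 = hd L2"
  have h: "h1 \<in> set L1" "h2 \<in> set L2" "h1 \<noteq> h2" "h1 \<notin> set L2" "h2 \<notin> set L1"
    using split.hyps(1,2) dis(3) by (simp_all add: h1_def h2_def disjoint_iff) (metis hd_in_set)+
  let ?C = "Cnot h2 h1"
  let ?P = "(P1 @ P2) @ [?C]"
  have "prog ?P (D + 1) ((length L1 - 1 + (length L2 - 1)) + 1) (set L1 \<union> set L2)"
    using h by (intro prog_seq prog_single prog_par P1(1) P2(1) dis(3)) auto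
  moreover have "(length L1 - 1 + (length L2 - 1)) + 1 \<le> length (L1 @ L2) - 1"
    using split.hyps by (cases L1; cases L2) auto
  ultimately have "prog ?P (Suc D) (length (L1 @ L2) - 1) (set (L1 @ L2))"
    by (elim prog_mono) auto
  moreover have "run ?P s (hd (L1 @ L2)) \<longleftrightarrow> odd (card {l \<in> set (L1 @ L2). s l})" for s
  proof -
    have "run P2 (run P1 s) h1 = run P1 s h1" using prog_outside[OF P2(1)] h by blast
    moreover have "run P2 (run P1 s) h2 = run P2 s h2"
      using h dis(3) prog_outside[OF P1(1)] by (intro prog_cong[OF P2(1)]) auto
    moreover have "{l \<in> set (L1 @ L2). s l} = {l \<in> set L1. s l} \<union> {l \<in> set L2. s l}" by auto
    then have "card {l \<in> set (L1 @ L2). s l} = card {l \<in> set L1. s l} + card {l \<in> set L2. s l}"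
      using dis(3) by (simp add: card_Un_disjoint disjoint_iff)
    ultimately show ?thesis using P1(2)[rule_format, of s] P2(2)[rule_format, of s] split.hyps
      by (auto simp: h1_def[symmetric] h2_def[symmetric])
  qed
  ultimately show ?case by blast
qed

text \<open>The conjunction at an inner node of the tree is stored in the ancilla \<open>anc (hd L2)\<close>, where
  \<open>L2\<close> is the right half of the node's list; distinct nodes have distinct \<open>hd L2\<close>.\<close>

lemma and_list:
  assumes "L \<noteq> []" "length L \<le> 2 ^ D" "distinct L" "inj_on anc (set L)" "anc ` set L \<inter> set L = {}"
  shows "\<exists>P r. prog P D (length L - 1) (set L \<union> anc ` set (tl L)) \<and>
    r \<in> set L \<union> anc ` set (tl L) \<and>
    (\<forall>s. (\<forall>l\<in>set (tl L). \<not> s (anc l)) \<longrightarrow> (run P s r \<longleftrightarrow> (\<forall>l\<in>set L. s l)))"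
  using assms
proof (induction rule: halving_induct)
  case (single x D)
  show ?case by (intro exI[of _ "[]"] exI[of _ x]) (simp add: prog_Nil)
next
  case (split D L1 L2)
  have dis: "distinct L1" "distinct L2" "set L1 \<inter> set L2 = {}"
    and inj: "inj_on anc (set L1)" "inj_on anc (set L2)"
    and anc: "anc ` set L1 \<inter> set L1 = {}" "anc ` set L2 \<inter> set L2 = {}"
    using split.prems by (auto simp: inj_on_Un)
  define A1 A2 where "A1 = set L1 \<union> anc ` set (tl L1)" and "A2 = set L2 \<union> anc ` set (tl L2)"
  from split.IH(1)[OF dis(1) inj(1) anc(1)] obtain P1 r1 where
    P1: "prog P1 D (length L1 - 1) A1" "r1 \<in> A1"
      "\<forall>s. (\<forall>l\<in>set (tl L1). \<not> s (anc l)) \<longrightarrow> (run P1 s r1 \<longleftrightarrow> (\<forall>l\<in>set L1. s l))"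
    unfolding A1_def by (elim exE conjE)
  from split.IH(2)[OF dis(2) inj(2) anc(2)] obtain P2 r2 where
    P2: "prog P2 D (length L2 - 1) A2" "r2 \<in> A2"
      "\<forall>s. (\<forall>l\<in>set (tl L2). \<not> s (anc l)) \<longrightarrow> (run P2 s r2 \<longleftrightarrow> (\<forall>l\<in>set L2. s l))"
    unfolding A2_def by (elim exE conjE)
  have tl: "set (tl L1) \<subseteq> set L1" "set (tl L2) \<subseteq> set L2"
    using list.set_sel(2)[OF split.hyps(1)] list.set_sel(2)[OF split.hyps(2)] by auto
  have ne: "anc x \<noteq> y" if "x \<in> set L1 \<or> x \<in> set L2" "y \<in> set L1 \<or> y \<in> set L2" for x y
    using split.prems(3) that by (metis IntI UnI1 UnI2 empty_iff image_eqI set_append)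
  have inj': "x = y" if "anc x = anc y" "x \<in> set L1 \<or> x \<in> set L2" "y \<in> set L1 \<or> y \<in> set L2" for x y
    using inj_onD[OF split.prems(2) that(1)] that(2,3) by simp
  have sep: "x \<noteq> y" if "x \<in> set L1" "y \<in> set L2" for x y
    using dis(3) that by (meson disjoint_iff)
  have A1: "q \<in> set L1 \<or> (\<exists>x. q = anc x \<and> x \<in> set L1)" if "q \<in> A1" for q
    using that tl(1) unfolding A1_def by auto
  have A2: "q \<in> set L2 \<or> (\<exists>x. q = anc x \<and> x \<in> set (tl L2) \<and> x \<in> set L2)" if "q \<in> A2" for q
    using that tl(2) unfolding A2_def by auto
  have A12: "A1 \<inter> A2 = {}"
  proof (rule equals0I, elim IntE)
    fix q assume "q \<in> A1" "q \<in> A2"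
    from A1[OF this(1)] A2[OF this(2)] show False
    proof (elim disjE exE conjE)
      assume "q \<in> set L1" "q \<in> set L2"
      then show False using sep[of q q] by simp
    next
      fix x assume "q \<in> set L1" "q = anc x" "x \<in> set L2"
      then show False using ne[of x q] by simp
    next
      fix x assume "q = anc x" "x \<in> set L1" "q \<in> set L2"
      then show False using ne[of x q] by simp
    next
      fix x y assume "q = anc x" "x \<in> set L1" "q = anc y" "y \<in> set L2"
      then show False using inj'[of x y] sep[of x y] by simp
    qed
  qed
  define r where "r = anc (hd L2)"
  have hd2: "hd L2 \<in> set L2" "hd L2 \<notin> set (tl L2)"
    using split.hyps(2) dis(2) by (cases L2; simp)+
  have r: "r \<notin> A1" "r \<notin> A2"
  proof -
    show "r \<notin> A1"
    proof
      assume "r \<in> A1"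
      from A1[OF this] show False
        using ne[of "hd L2" "anc (hd L2)"] inj'[of "hd L2"] sep hd2(1) unfolding r_def by metis
    qed
    show "r \<notin> A2"
    proof
      assume "r \<in> A2"
      from A2[OF this] show False
        using ne[of "hd L2" "anc (hd L2)"] inj'[of "hd L2"] hd2 unfolding r_def by metis
    qed
  qed
  have r12: "r1 \<noteq> r2" "r1 \<noteq> r" "r2 \<noteq> r" "r1 \<notin> A2" using P1(2) P2(2) A12 r by auto
  let ?A = "set (L1 @ L2) \<union> anc ` set (tl (L1 @ L2))"
  have tl12: "set (tl (L1 @ L2)) = set (tl L1) \<union> set L2" using split.hyps by (cases L1) auto
  have sub: "A1 \<union> A2 \<subseteq> ?A" "r \<in> ?A"
    using hd2 tl unfolding A1_def A2_def tl12 r_def by auto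
  let ?C = "Tof r1 r2 r"
  let ?P = "(P1 @ P2) @ [?C]"
  have "prog (P1 @ P2) D (length L1 - 1 + (length L2 - 1)) (A1 \<union> A2)"
    using prog_par[OF P1(1) P2(1) A12] .
  then have "prog (P1 @ P2) D (length L1 - 1 + (length L2 - 1)) ?A"
    by (rule prog_mono) (use sub in auto)
  moreover have "prog [?C] 1 1 ?A"
    using r12 sub P1(2) P2(2) by (intro prog_single) auto
  ultimately have "prog ?P (D + 1) ((length L1 - 1 + (length L2 - 1)) + 1) ?A"
    by (rule prog_seq)
  moreover have "(length L1 - 1 + (length L2 - 1)) + 1 \<le> length (L1 @ L2) - 1"
    using split.hyps by (cases L1; cases L2) auto
  ultimately have "prog ?P (Suc D) (length (L1 @ L2) - 1) ?A"
    by (elim prog_mono) auto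
  moreover have "run ?P s r \<longleftrightarrow> (\<forall>l\<in>set (L1 @ L2). s l)"
    if z: "\<forall>l\<in>set (tl (L1 @ L2)). \<not> s (anc l)" for s
  proof -
    have z1: "\<forall>l\<in>set (tl L1). \<not> s (anc l)" and z2: "\<forall>l\<in>set (tl L2). \<not> s (anc l)"
      and zr: "\<not> s r" using z tl hd2 unfolding tl12 r_def by auto
    have "run P2 (run P1 s) r1 = run P1 s r1" using prog_outside[OF P2(1)] r12 by blast
    moreover have "run P2 (run P1 s) r2 = run P2 s r2"
      using P2(2) A12 prog_outside[OF P1(1)] by (intro prog_cong[OF P2(1)]) auto
    moreover have "run P2 (run P1 s) r = s r"
      using prog_outside[OF P1(1)] prog_outside[OF P2(1)] r by simp
    ultimately show ?thesis using mp[OF spec[OF P1(3)] z1] mp[OF spec[OF P2(3)] z2] zr by auto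
  qed
  ultimately show ?case using sub(2) by blast
qed

lemma fanout:
  assumes "finite A" "card A \<le> 2 ^ D" "c \<notin> A"
  obtains P where "prog P (D + 1) (card A) (insert c A)"
    "\<And>s. (\<forall>a\<in>A. \<not> s a) \<Longrightarrow> run P s = (\<lambda>q. if q \<in> A then s c else s q)"
proof -
  obtain L where L: "set L = A" "distinct L" using finite_distinct_list[OF assms(1)] by blast
  have len: "length L = card A" using L distinct_card by fastforce
  show ?thesis
  proof (cases "L = []")
    case True
    then show ?thesis using that[of "[]"] L by (auto simp: prog_Nil)
  next
    case False
    obtain P where P: "prog P D (length L - 1) (set L)"
      "\<And>s. (\<forall>l\<in>set (tl L). \<not> s l) \<Longrightarrow> (\<forall>l\<in>set L. run P s l = s (hd L))"
      using fan_list[OF False] assms(2) L len by metis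
    have hd: "hd L \<in> A" "hd L \<noteq> c" "hd L \<notin> set (tl L)" "set (tl L) \<subseteq> A"
      using False L assms(3) by (cases L; auto)+
    have "prog ([Cnot c (hd L)] @ P) (1 + D) (1 + (length L - 1)) (insert c A)"
      using hd by (intro prog_seq prog_single prog_mono[OF P(1)]) (auto simp: L)
    then have 1: "prog ([Cnot c (hd L)] @ P) (D + 1) (card A) (insert c A)"
      using False len by (cases L) (simp_all add: add.commute)
    have 2: "run ([Cnot c (hd L)] @ P) s = (\<lambda>q. if q \<in> A then s c else s q)"
      if z: "\<forall>a\<in>A. \<not> s a" for s
    proof
      fix q
      define s1 where "s1 = exec (Cnot c (hd L)) s"
      have s1: "s1 (hd L) = s c" "\<forall>l\<in>set (tl L). \<not> s1 l" using z hd by (auto simp: s1_def)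
      have R: "run ([Cnot c (hd L)] @ P) s = run P s1" by (simp add: s1_def)
      show "run ([Cnot c (hd L)] @ P) s q = (if q \<in> A then s c else s q)"
      proof (cases "q \<in> A")
        case True
        then show ?thesis using P(2)[OF s1(2)] s1(1) L unfolding R by simp
      next
        case False
        then have "run P s1 q = s1 q" using prog_outside[OF P(1)] L by simp
        then show ?thesis using False hd unfolding R by (auto simp: s1_def)
      qed
    qed
    show ?thesis using that[OF 1 2] .
  qed
qed

text \<open>The tree overwrites its inputs, so it is run, its root is added to \<open>t\<close>, and
  it is run backwards: \<open>2 * (card A - 1) + 1\<close> operations. \<open>and_gate\<close>
  follows the same pattern.\<close>

lemma parity_gate:
  assumes "finite A" "card A \<le> 2 ^ D" "t \<notin> A"
  obtains P where "prog P (2 * D + 1) (2 * card A) (insert t A)"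
    "\<And>s. run P s = s(t := (s t \<noteq> odd (card {a \<in> A. s a})))"
proof -
  obtain L where L: "set L = A" "distinct L" using finite_distinct_list[OF assms(1)] by blast
  have len: "length L = card A" using L distinct_card by fastforce
  show ?thesis
  proof (cases "L = []")
    case True
    then show ?thesis using that[of "[]"] L by (auto simp: prog_Nil)
  next
    case False
    obtain P where P: "prog P D (length L - 1) A"
      "\<And>s. run P s (hd L) \<longleftrightarrow> odd (card {l \<in> A. s l})"
      using sum_list_tree[OF False] assms(2) L len by metis
    have hd: "hd L \<in> A" "hd L \<noteq> t" using False L assms(3) by auto
    let ?P = "P @ [Cnot (hd L) t] @ rev P"
    have "prog ?P (2 * D + 1) (2 * (length L - 1) + 1) (insert t A)"
      using hd by (intro prog_conj prog_single prog_mono[OF P(1)]) auto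
    moreover have "2 * (length L - 1) + 1 \<le> 2 * card A"
      using False len[symmetric] by (cases L) simp_all
    ultimately have 1: "prog ?P (2 * D + 1) (2 * card A) (insert t A)"
      by (rule prog_mono[OF _ le_refl _ order_refl])
    have 2: "run ?P s = s(t := (s t \<noteq> odd (card {a \<in> A. s a})))" for s
    proof -
      have "run ?P s = (\<lambda>q. if q \<in> {t} then run [Cnot (hd L) t] (run P s) q else s q)"
        using assms(3) by (intro run_conj[OF P(1)]) auto
      then show ?thesis using P(2) prog_outside[OF P(1) assms(3)] by auto
    qed
    show ?thesis using that[OF 1 2] .
  qed
qed

lemma and_gate:
  assumes "finite A" "A \<noteq> {}" "card A \<le> 2 ^ D" "t \<notin> A" "t \<notin> anc ` A"
    "inj_on anc A" "anc ` A \<inter> A = {}"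
  obtains P where "prog P (2 * D + 1) (2 * card A) (insert t (A \<union> anc ` A))"
    "\<And>s. (\<forall>a\<in>A. \<not> s (anc a)) \<Longrightarrow> run P s = s(t := (s t \<noteq> (\<forall>a\<in>A. s a)))"
proof -
  obtain L where L: "set L = A" "distinct L" using finite_distinct_list[OF assms(1)] by blast
  have len: "length L = card A" using L distinct_card by fastforce
  have ne: "L \<noteq> []" using L assms(2) by auto
  have tl: "set (tl L) \<subseteq> A" using L ne list.set_sel(2) by fast
  obtain P r where P: "prog P D (length L - 1) (set L \<union> anc ` set (tl L))"
      "r \<in> set L \<union> anc ` set (tl L)"
      "\<And>s. (\<forall>l\<in>set (tl L). \<not> s (anc l)) \<Longrightarrow> (run P s r \<longleftrightarrow> (\<forall>l\<in>set L. s l))"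
    using and_list[OF ne, of D anc] assms(3,6,7) L len by metis
  have P1: "prog P D (length L - 1) (A \<union> anc ` A)" using P(1) by (rule prog_mono) (use L tl in auto)
  have r: "r \<in> A \<union> anc ` A" "r \<noteq> t" using P(2) L tl assms(4,5) by auto
  let ?P = "P @ [Cnot r t] @ rev P"
  have "prog ?P (2 * D + 1) (2 * (length L - 1) + 1) (insert t (A \<union> anc ` A))"
    using r by (intro prog_conj prog_single prog_mono[OF P1]) auto
  moreover have "2 * (length L - 1) + 1 \<le> 2 * card A"
    using ne len[symmetric] by (cases L) simp_all
  ultimately have 1: "prog ?P (2 * D + 1) (2 * card A) (insert t (A \<union> anc ` A))"
    by (rule prog_mono[OF _ le_refl _ order_refl])
  have 2: "run ?P s = s(t := (s t \<noteq> (\<forall>a\<in>A. s a)))" if z: "\<forall>a\<in>A. \<not> s (anc a)" for s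
  proof -
    have "run ?P s = (\<lambda>q. if q \<in> {t} then run [Cnot r t] (run P s) q else s q)"
      using assms(4,5) by (intro run_conj[OF P1]) auto
    moreover have "run P s r \<longleftrightarrow> (\<forall>l\<in>A. s l)" using P(3)[of s] z tl L by auto
    moreover have "run P s t = s t" using prog_outside[OF P1] assms(4,5) by simp
    ultimately show ?thesis by (simp only: fun_eq_iff fold_simps exec.simps) simp
  qed
  show ?thesis using that[OF 1 2] .
qed

section \<open>Layers of linear maps and conjunctions\<close>

lemma sum_card_fibres: "finite E \<Longrightarrow> (\<Sum>u\<in>f ` E. card {e \<in> E. f e = u}) = card E"
  using sum.image_gen[of E "\<lambda>_. 1::nat" f] by (simp only: card_eq_sum)

lemma not_layer:
  assumes "finite A"
  obtains P where "prog P 1 (card A) A" "\<And>s. run P s = (\<lambda>q. if q \<in> A then \<not> s q else s q)"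
proof -
  have N: "prog [Flip a] 1 1 {a}" for a :: 'a by (rule prog_single) simp_all
  obtain Q where Q: "prog Q 1 (\<Sum>a\<in>A. 1) (\<Union>a\<in>A. {a})"
    "\<And>s a q. a \<in> A \<Longrightarrow> q \<in> {a} \<Longrightarrow> run Q s q = run [Flip a] s q"
    "\<And>s q. q \<notin> (\<Union>a\<in>A. {a}) \<Longrightarrow> run Q s q = s q"
    by (rule prog_family[of A "\<lambda>a. [Flip a]" 1 "\<lambda>_. 1" "\<lambda>a. {a}", OF assms N])
      (blast, rule that)
  have "run Q s = (\<lambda>q. if q \<in> A then \<not> s q else s q)" for s
  proof
    fix q
    show "run Q s q = (if q \<in> A then \<not> s q else s q)"
      using Q(2)[of q q s] Q(3)[of q s] by auto
  qed
  moreover have "prog Q 1 (card A) A" using Q(1) by simp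
  ultimately show ?thesis using that by blast
qed

text \<open>\<open>E\<close> is the incidence relation of a linear map over the two-element field,
  and \<open>sl\<close> gives each incidence its own register. These slots are partitioned by source
  as well as by target: so all copies into them run in parallel, then all parities out of them, and
  undoing the copies clears them. The depth is \<open>2 * (D + 1) + (2 * D + 1)\<close>, the size
  \<open>2 * card E + 2 * card E\<close>.\<close>

lemma linear_layer:
  fixes sl :: "'q \<times> 'q \<Rightarrow> 'q"
  assumes fin: "finite E" and disj: "fst ` E \<inter> snd ` E = {}"
    and inj: "inj_on sl E" and slots: "sl ` E \<inter> (fst ` E \<union> snd ` E) = {}"
    and outdeg: "\<And>u. card {e \<in> E. fst e = u} \<le> 2 ^ D"
    and indeg: "\<And>v. card {e \<in> E. snd e = v} \<le> 2 ^ D"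
  obtains P where "prog P (4 * D + 3) (4 * card E) (fst ` E \<union> snd ` E \<union> sl ` E)"
    "\<And>s. (\<forall>e\<in>E. \<not> s (sl e)) \<Longrightarrow>
      run P s = (\<lambda>q. if q \<in> snd ` E then s q \<noteq> odd (card {u. (u, q) \<in> E \<and> s u}) else s q)"
proof -
  define Out where "Out u = sl ` {e \<in> E. fst e = u}" for u
  define In where "In v = sl ` {e \<in> E. snd e = v}" for v
  have sl_eq: "e = e'" if "sl e = sl e'" "e \<in> E" "e' \<in> E" for e e'
    using inj that by (auto dest: inj_onD)
  have sl_fst: "sl e \<noteq> fst e'" "sl e \<noteq> snd e'" if "e \<in> E" "e' \<in> E" for e e'
    using slots that by (metis IntI UnI1 UnI2 empty_iff image_eqI)+
  have cards: "card (Out u) = card {e \<in> E. fst e = u}" "card (In u) = card {e \<in> E. snd e = u}" for u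
    unfolding Out_def In_def by (rule card_image, rule inj_on_subset[OF inj], blast)+
  have finOI: "finite (Out u)" "finite (In u)" for u using fin by (simp_all add: Out_def In_def)
  have "\<exists>P. prog P (D + 1) (card (Out u)) (insert u (Out u)) \<and>
      (\<forall>s. (\<forall>a\<in>Out u. \<not> s a) \<longrightarrow> run P s = (\<lambda>q. if q \<in> Out u then s u else s q))"
    if u: "u \<in> fst ` E" for u
  proof -
    have "u \<notin> Out u"
    proof
      assume "u \<in> Out u"
      then obtain e where "e \<in> E" "u = sl e" unfolding Out_def by blast
      then show False using sl_fst(1)[of e] u by auto
    qed
    then show ?thesis
    proof (rule fanout[of "Out u" D u, rotated 2])
      show "finite (Out u)" "card (Out u) \<le> 2 ^ D" using finOI outdeg[of u] cards(1)[of u] by simp_all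
      fix P assume "prog P (D + 1) (card (Out u)) (insert u (Out u))"
        "\<And>s. (\<forall>a\<in>Out u. \<not> s a) \<Longrightarrow> run P s = (\<lambda>q. if q \<in> Out u then s u else s q)"
      then show ?thesis by blast
    qed
  qed
  then have "\<forall>u\<in>fst ` E. \<exists>P. prog P (D + 1) (card (Out u)) (insert u (Out u)) \<and>
      (\<forall>s. (\<forall>a\<in>Out u. \<not> s a) \<longrightarrow> run P s = (\<lambda>q. if q \<in> Out u then s u else s q))"
    by blast
  from bchoice[OF this] obtain PF where PF_all: "\<forall>u\<in>fst ` E. prog (PF u) (D + 1) (card (Out u)) (insert u (Out u)) \<and>
      (\<forall>s. (\<forall>a\<in>Out u. \<not> s a) \<longrightarrow> run (PF u) s = (\<lambda>q. if q \<in> Out u then s u else s q))"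
    by (elim exE)
  note PF = bspec[OF PF_all, THEN conjunct1] bspec[OF PF_all, THEN conjunct2, THEN spec, THEN mp]
  have "\<exists>P. prog P (2 * D + 1) (2 * card (In v)) (insert v (In v)) \<and>
      (\<forall>s. run P s = s(v := (s v \<noteq> odd (card {a \<in> In v. s a}))))"
    if v: "v \<in> snd ` E" for v
  proof -
    have "v \<notin> In v"
    proof
      assume "v \<in> In v"
      then obtain e where "e \<in> E" "v = sl e" unfolding In_def by blast
      then show False using sl_fst(2)[of e] v by auto
    qed
    then show ?thesis
    proof (rule parity_gate[of "In v" D v, rotated 2])
      show "finite (In v)" "card (In v) \<le> 2 ^ D" using finOI indeg[of v] cards(2)[of v] by simp_all
      fix P assume "prog P (2 * D + 1) (2 * card (In v)) (insert v (In v))"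
        "\<And>s. run P s = s(v := (s v \<noteq> odd (card {a \<in> In v. s a})))"
      then show ?thesis by blast
    qed
  qed
  then have "\<forall>v\<in>snd ` E. \<exists>P. prog P (2 * D + 1) (2 * card (In v)) (insert v (In v)) \<and>
      (\<forall>s. run P s = s(v := (s v \<noteq> odd (card {a \<in> In v. s a}))))"
    by blast
  from bchoice[OF this] obtain PG where PG_all: "\<forall>v\<in>snd ` E. prog (PG v) (2 * D + 1) (2 * card (In v)) (insert v (In v)) \<and>
      (\<forall>s. run (PG v) s = s(v := (s v \<noteq> odd (card {a \<in> In v. s a}))))"
    by (elim exE)
  note PG = bspec[OF PG_all, THEN conjunct1] bspec[OF PG_all, THEN conjunct2, THEN spec]
  have dF: "insert u (Out u) \<inter> insert u' (Out u') = {}" if uu: "u \<in> fst ` E" "u' \<in> fst ` E" "u \<noteq> u'" for u u'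
  proof -
    have no: "w \<notin> Out w'" if w: "w \<in> fst ` E" for w w'
    proof
      assume "w \<in> Out w'"
      then obtain e where "e \<in> E" "w = sl e" unfolding Out_def by blast
      moreover obtain e' where "e' \<in> E" "w = fst e'" using w by blast
      ultimately show False using sl_fst(1)[of e e'] by simp
    qed
    have "Out u \<inter> Out u' = {}"
    proof (rule equals0I, elim IntE)
      fix a assume "a \<in> Out u" "a \<in> Out u'"
      then obtain e e' where "e \<in> E" "e' \<in> E" "a = sl e" "a = sl e'" "fst e = u" "fst e' = u'"
        unfolding Out_def by blast
      then show False using sl_eq[of e e'] uu(3) by simp
    qed
    then show ?thesis using uu no[OF uu(1), of u'] no[OF uu(2), of u] by simp
  qed
  obtain F where F: "prog F (D + 1) (\<Sum>u\<in>fst ` E. card (Out u)) (\<Union>u\<in>fst ` E. insert u (Out u))"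
    "\<And>s u q. u \<in> fst ` E \<Longrightarrow> q \<in> insert u (Out u) \<Longrightarrow> run F s q = run (PF u) s q"
    "\<And>s q. q \<notin> (\<Union>u\<in>fst ` E. insert u (Out u)) \<Longrightarrow> run F s q = s q"
    by (rule prog_family[of "fst ` E" PF "D + 1" "\<lambda>u. card (Out u)" "\<lambda>u. insert u (Out u)",
          OF finite_imageI[OF fin] PF(1) dF]) (assumption+, rule that)
  have dG: "insert u (In u) \<inter> insert u' (In u') = {}" if uu: "u \<in> snd ` E" "u' \<in> snd ` E" "u \<noteq> u'" for u u'
  proof -
    have no: "w \<notin> In w'" if w: "w \<in> snd ` E" for w w'
    proof
      assume "w \<in> In w'"
      then obtain e where "e \<in> E" "w = sl e" unfolding In_def by blast
      moreover obtain e' where "e' \<in> E" "w = snd e'" using w by blast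
      ultimately show False using sl_fst(2)[of e e'] by simp
    qed
    have "In u \<inter> In u' = {}"
    proof (rule equals0I, elim IntE)
      fix a assume "a \<in> In u" "a \<in> In u'"
      then obtain e e' where "e \<in> E" "e' \<in> E" "a = sl e" "a = sl e'" "snd e = u" "snd e' = u'"
        unfolding In_def by blast
      then show False using sl_eq[of e e'] uu(3) by simp
    qed
    then show ?thesis using uu no[OF uu(1), of u'] no[OF uu(2), of u] by simp
  qed
  obtain G where G: "prog G (2 * D + 1) (\<Sum>v\<in>snd ` E. 2 * card (In v)) (\<Union>v\<in>snd ` E. insert v (In v))"
    "\<And>s v q. v \<in> snd ` E \<Longrightarrow> q \<in> insert v (In v) \<Longrightarrow> run G s q = run (PG v) s q"
    "\<And>s q. q \<notin> (\<Union>v\<in>snd ` E. insert v (In v)) \<Longrightarrow> run G s q = s q"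
    by (rule prog_family[of "snd ` E" PG "2 * D + 1" "\<lambda>v. 2 * card (In v)" "\<lambda>v. insert v (In v)",
          OF finite_imageI[OF fin] PG(1) dG]) (assumption+, rule that)
  let ?A = "fst ` E \<union> snd ` E \<union> sl ` E"
  have UF: "(\<Union>u\<in>fst ` E. insert u (Out u)) = fst ` E \<union> sl ` E" unfolding Out_def by auto
  have UG: "(\<Union>v\<in>snd ` E. insert v (In v)) = snd ` E \<union> sl ` E" unfolding In_def by auto
  have sF: "(\<Sum>u\<in>fst ` E. card (Out u)) = card E" by (simp add: cards sum_card_fibres[OF fin])
  have sG: "(\<Sum>v\<in>snd ` E. 2 * card (In v)) = 2 * card E"
    by (simp add: cards sum_card_fibres[OF fin] sum_distrib_left[symmetric])
  have F1: "prog F (D + 1) (card E) (fst ` E \<union> sl ` E)" using F(1) unfolding UF sF .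
  have "prog F (D + 1) (card E) ?A" using F1 by (rule prog_mono) auto
  moreover have "prog G (2 * D + 1) (2 * card E) ?A"
    using G(1) unfolding UG sG by (rule prog_mono) auto
  ultimately have "prog (F @ G @ rev F) (2 * (D + 1) + (2 * D + 1)) (2 * card E + 2 * card E) ?A"
    by (rule prog_conj)
  then have 1: "prog (F @ G @ rev F) (4 * D + 3) (4 * card E) ?A"
    by (rule prog_mono) auto
  have 2: "run (F @ G @ rev F) s =
      (\<lambda>q. if q \<in> snd ` E then s q \<noteq> odd (card {u. (u, q) \<in> E \<and> s u}) else s q)"
    if z: "\<forall>e\<in>E. \<not> s (sl e)" for s
  proof -
    have Fsl: "run F s (sl e) = s (fst e)" if e: "e \<in> E" for e
    proof -
      have "sl e \<in> Out (fst e)" using e by (auto simp: Out_def)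
      moreover have "\<forall>a\<in>Out (fst e). \<not> s a" using z by (auto simp: Out_def)
      ultimately show ?thesis using F(2)[of "fst e" "sl e" s] PF(2)[of "fst e" s] e by simp
    qed
    have Fv: "run F s v = s v" if "v \<in> snd ` E" for v
      using that disj slots by (intro prog_outside[OF F1]) blast
    have Gv: "run G s1 v = (s1 v \<noteq> odd (card {a \<in> In v. s1 a}))" if "v \<in> snd ` E" for s1 v
      using G(2)[of v v s1] PG(2)[of v s1] that by simp
    \<comment> \<open>A parity program changes only its target, so the slots come out as they went
      in; hence \<open>G\<close> as a whole acts on the targets alone, as \<open>run_conj\<close>
      demands.\<close>
    have Gout: "run G s1 q = s1 q" if "q \<notin> snd ` E" for s1 q
    proof (cases "q \<in> sl ` E")
      case True
      then obtain e where e: "e \<in> E" "q = sl e" by blast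
      then have "q \<in> In (snd e)" "q \<noteq> snd e" using sl_fst(2) by (auto simp: In_def)
      then show ?thesis using G(2)[of "snd e" q s1] PG(2)[of "snd e" s1] e by simp
    next
      case False
      then show ?thesis using G(3)[of q s1] that unfolding UG by simp
    qed
    have "run (F @ G @ rev F) s = (\<lambda>q. if q \<in> snd ` E then run G (run F s) q else s q)"
      using disj slots by (intro run_conj[OF F1] Gout) auto
    moreover have "card {a \<in> In v. run F s a} = card {u. (u, v) \<in> E \<and> s u}" for v
    proof -
      have "{a \<in> In v. run F s a} = (\<lambda>u. sl (u, v)) ` {u. (u, v) \<in> E \<and> s u}"
        unfolding In_def using Fsl by (auto simp: image_iff; force)
      moreover have "inj_on (\<lambda>u. sl (u, v)) {u. (u, v) \<in> E \<and> s u}"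
        using sl_eq by (auto simp: inj_on_def)
      ultimately show ?thesis by (simp add: card_image)
    qed
    ultimately show ?thesis using Gv Fv by (simp add: fun_eq_iff)
  qed
  show ?thesis using that[OF 1 2] .
qed

text \<open>Disjoint argument sets have disjoint ancillas because \<open>anc\<close> is injective,
  so all conjunctions run in parallel.\<close>

lemma and_family:
  assumes fin: "finite I" "\<And>i. i \<in> I \<Longrightarrow> finite (A i)"
    and ne: "\<And>i. i \<in> I \<Longrightarrow> A i \<noteq> {}" and deg: "\<And>i. i \<in> I \<Longrightarrow> card (A i) \<le> 2 ^ D"
    and B: "B = (\<Union>i\<in>I. A i)"
    and disj: "\<And>i j. i \<in> I \<Longrightarrow> j \<in> I \<Longrightarrow> i \<noteq> j \<Longrightarrow> A i \<inter> A j = {}"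
    and t: "inj_on t I" "t ` I \<inter> (B \<union> anc ` B) = {}"
    and anc: "inj_on anc B" "anc ` B \<inter> B = {}"
  obtains P where "prog P (2 * D + 1) (2 * card B) (t ` I \<union> B \<union> anc ` B)"
    "\<And>s i. (\<forall>a\<in>B. \<not> s (anc a)) \<Longrightarrow> i \<in> I \<Longrightarrow> run P s (t i) \<longleftrightarrow> s (t i) \<noteq> (\<forall>a\<in>A i. s a)"
    "\<And>s q. (\<forall>a\<in>B. \<not> s (anc a)) \<Longrightarrow> q \<notin> t ` I \<Longrightarrow> run P s q = s q"
proof -
  have "\<exists>P. prog P (2 * D + 1) (2 * card (A i)) (insert (t i) (A i \<union> anc ` A i)) \<and>
    (\<forall>s. (\<forall>a\<in>A i. \<not> s (anc a)) \<longrightarrow> run P s = s(t i := (s (t i) \<noteq> (\<forall>a\<in>A i. s a))))"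
    if i: "i \<in> I" for i
  proof -
    have AB: "A i \<subseteq> B" using i B by auto
    have "t i \<notin> B \<union> anc ` B" using t(2) i by blast
    then have ti: "t i \<notin> A i" "t i \<notin> anc ` A i" using AB by auto
    have inj: "inj_on anc (A i)" using inj_on_subset[OF anc(1) AB] .
    have dis: "anc ` A i \<inter> A i = {}"
    proof -
      have "anc ` A i \<inter> A i \<subseteq> anc ` B \<inter> B" using AB by (intro Int_mono image_mono)
      then show ?thesis using anc(2) by simp
    qed
    show ?thesis
    proof (rule and_gate[OF fin(2)[OF i] ne[OF i] deg[OF i] ti inj dis])
      fix P assume "prog P (2 * D + 1) (2 * card (A i)) (insert (t i) (A i \<union> anc ` A i))"
        "\<And>s. (\<forall>a\<in>A i. \<not> s (anc a)) \<Longrightarrow> run P s = s(t i := (s (t i) \<noteq> (\<forall>a\<in>A i. s a)))"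
      then show ?thesis by blast
    qed
  qed
  then have "\<forall>i\<in>I. \<exists>P. prog P (2 * D + 1) (2 * card (A i)) (insert (t i) (A i \<union> anc ` A i)) \<and>
    (\<forall>s. (\<forall>a\<in>A i. \<not> s (anc a)) \<longrightarrow> run P s = s(t i := (s (t i) \<noteq> (\<forall>a\<in>A i. s a))))"
    by blast
  from bchoice[OF this] obtain PA where PA_all: "\<forall>i\<in>I. prog (PA i) (2 * D + 1) (2 * card (A i)) (insert (t i) (A i \<union> anc ` A i)) \<and>
    (\<forall>s. (\<forall>a\<in>A i. \<not> s (anc a)) \<longrightarrow> run (PA i) s = s(t i := (s (t i) \<noteq> (\<forall>a\<in>A i. s a))))"
    by (elim exE)
  note PA = bspec[OF PA_all, THEN conjunct1] bspec[OF PA_all, THEN conjunct2, THEN spec, THEN mp]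
  have d: "insert (t i) (A i \<union> anc ` A i) \<inter> insert (t j) (A j \<union> anc ` A j) = {}"
    if ij: "i \<in> I" "j \<in> I" "i \<noteq> j" for i j
  proof -
    have AB: "A i \<subseteq> B" "A j \<subseteq> B" using ij B by auto
    have no: "t l \<notin> B" "t l \<notin> anc ` B" if "l \<in> I" for l using t(2) that by blast+
    have "t i \<noteq> t j" using t(1) ij by (simp add: inj_on_eq_iff)
    moreover have "t l \<notin> A l'" "t l \<notin> anc ` A l'" if "l \<in> I" "l' \<in> {i, j}" for l l'
      using no[OF that(1)] AB that(2) by auto
    moreover have "anc ` A i \<inter> anc ` A j = {}"
      using inj_on_image_Int[OF anc(1) AB] disj[OF ij] by simp
    moreover have "anc ` A i \<inter> A j \<subseteq> anc ` B \<inter> B" "anc ` A j \<inter> A i \<subseteq> anc ` B \<inter> B"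
      using AB by (intro Int_mono image_mono; simp)+
    then have "anc ` A i \<inter> A j = {}" "anc ` A j \<inter> A i = {}" unfolding anc(2) subset_empty .
    then have "anc ` A i \<inter> A j = {}" "A i \<inter> anc ` A j = {}" by (simp_all add: Int_commute)
    ultimately show ?thesis using disj[OF ij] ij
      by (simp add: Int_Un_distrib Int_Un_distrib2)
  qed
  obtain Q where Q: "prog Q (2 * D + 1) (\<Sum>i\<in>I. 2 * card (A i)) (\<Union>i\<in>I. insert (t i) (A i \<union> anc ` A i))"
    "\<And>s i q. i \<in> I \<Longrightarrow> q \<in> insert (t i) (A i \<union> anc ` A i) \<Longrightarrow> run Q s q = run (PA i) s q"
    "\<And>s q. q \<notin> (\<Union>i\<in>I. insert (t i) (A i \<union> anc ` A i)) \<Longrightarrow> run Q s q = s q"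
    by (rule prog_family[OF fin(1), of PA "2 * D + 1" "\<lambda>i. 2 * card (A i)"
          "\<lambda>i. insert (t i) (A i \<union> anc ` A i)", OF PA(1) d]) (assumption+, rule that)
  have U: "(\<Union>i\<in>I. insert (t i) (A i \<union> anc ` A i)) = t ` I \<union> B \<union> anc ` B" unfolding B by auto
  have "card B = (\<Sum>i\<in>I. card (A i))"
    unfolding B by (rule card_UN_disjoint) (use fin disj in auto)
  then have "prog Q (2 * D + 1) (2 * card B) (t ` I \<union> B \<union> anc ` B)"
    using Q(1) unfolding U by (simp add: sum_distrib_left)
  moreover have "run Q s (t i) \<longleftrightarrow> s (t i) \<noteq> (\<forall>a\<in>A i. s a)"
    if "\<forall>a\<in>B. \<not> s (anc a)" "i \<in> I" for s i
  proof -
    have "\<forall>a\<in>A i. \<not> s (anc a)" using that B by blast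
    then show ?thesis using Q(2)[OF that(2), of "t i" s] PA(2)[OF that(2), of s] by simp
  qed
  moreover have "run Q s q = s q" if z: "\<forall>a\<in>B. \<not> s (anc a)" and q: "q \<notin> t ` I" for s q
  proof (cases "q \<in> (\<Union>i\<in>I. insert (t i) (A i \<union> anc ` A i))")
    case True
    then obtain i where i: "i \<in> I" "q \<in> insert (t i) (A i \<union> anc ` A i)" by blast
    moreover have "q \<noteq> t i" using q i(1) by blast
    moreover have "\<forall>a\<in>A i. \<not> s (anc a)" using z B i(1) by blast
    ultimately show ?thesis using Q(2)[OF i, of s] PA(2)[OF i(1), of s] by simp
  next
    case False
    then show ?thesis by (rule Q(3))
  qed
  ultimately show ?thesis by (rule that)
qed

section \<open>Loading a batch of strings in chunks\<close>

text \<open>Registers: \<open>RX p\<close> is the data (\<open>p < n\<close>), the flag (\<open>p = n\<close>) or padding (\<open>p > n\<close>);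
  \<open>RE i\<close> is the one-hot index. Blocks are numbered by \<open>c\<close>, and a set \<open>w\<close> of offsets is a
  value of a block: \<open>RY c w\<close> receives the sum of the \<open>RE i\<close> whose string has value \<open>w\<close> on block
  \<open>c\<close>, \<open>RL c w j\<close> the test whether bit \<open>j\<close> of block \<open>c\<close> agrees with \<open>w\<close>, \<open>RZ c w\<close> the
  conjunction of these tests over \<open>j\<close>, and \<open>RT i c\<close> a copy of \<open>RZ c w\<close> for string \<open>i\<close>.
  \<open>Slot u w\<close> holds the summand that \<open>u\<close> contributes to \<open>w\<close>, \<open>Anc\<close> a partial conjunction.\<close>

datatype reg = RX nat | RE nat | RY nat "nat set" | RL nat "nat set" nat | RZ nat "nat set"
  | RT nat nat | Slot reg reg | Anc reg

abbreviation off :: "nat \<Rightarrow> bool" where "off \<equiv> \<lambda>_. False"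

definition st :: "(nat \<Rightarrow> bool) \<Rightarrow> (nat \<Rightarrow> bool) \<Rightarrow> reg \<Rightarrow> bool" where
  "st x e r = (case r of RX p \<Rightarrow> x p | RE i \<Rightarrow> e i | _ \<Rightarrow> False)"

lemma st_simps [simp]: "st x e (RX p) = x p" "st x e (RE i) = e i" "\<not> st x e (RY c w)"
  "\<not> st x e (RL c w j)" "\<not> st x e (RZ c w)" "\<not> st x e (RT i c)" "\<not> st x e (Slot u v)" "\<not> st x e (Anc u)"
  by (simp_all add: st_def)

abbreviation slot :: "reg \<times> reg \<Rightarrow> reg" where "slot \<equiv> case_prod Slot"

lemma inj_slot: "inj_on slot E"
  by (auto simp: inj_on_def)

lemma card_le_image: "S \<subseteq> f ` A \<Longrightarrow> finite A \<Longrightarrow> card A \<le> m \<Longrightarrow> card S \<le> m"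
  using surj_card_le order_trans by blast

lemma card_Un_le_add: "card A \<le> a \<Longrightarrow> card B \<le> b \<Longrightarrow> card (A \<union> B) \<le> a + b"
  using card_Un_le[of A B] by linarith

lemma snd_iff: "q \<in> snd ` E \<longleftrightarrow> (\<exists>u. (u, q) \<in> E)"
  by force

text \<open>\<open>v i p\<close> is bit \<open>p\<close> of string \<open>i\<close>. The strict
  \<open>n < K * k\<close> puts the flag position \<open>n\<close> inside a block, so that the
  equality tests see the flag. The bounds \<open>deg\<close> dominate the degrees \<open>b\<close>,
  \<open>K\<close>, \<open>k\<close> and \<open>2 ^ k\<close> of the maps and conjunctions below,
  whose trees therefore have depth \<open>O(D)\<close>.\<close>

locale chunks =
  fixes n k K b D :: nat and v :: "nat \<Rightarrow> nat \<Rightarrow> bool"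
  assumes k: "k \<ge> 1" and nK: "n < K * k"
    and deg: "b \<le> 2 ^ D" "K \<le> 2 ^ D" "k \<le> D"
    and supp: "\<And>i p. i < b \<Longrightarrow> v i p \<Longrightarrow> p \<le> n"
    and inj: "\<And>i j. i < b \<Longrightarrow> j < b \<Longrightarrow> i \<noteq> j \<Longrightarrow> v i \<noteq> v j"
begin

definition "W = Pow {..<k}"
definition "code i c = {j. j < k \<and> v i (c * k + j)}"
definition "IC = {..<b} \<times> {..<K}"
definition "J = {..<K} \<times> W \<times> {..<k}"
text \<open>Incidences of the four linear maps: index to block values, block values to data, data to
  bitwise tests, and tests of block values to strings.\<close>

definition "E1 = (\<lambda>(i, c). (RE i, RY c (code i c))) ` IC"
definition "E2 = (\<lambda>(c, w, j). (RY c w, RX (c * k + j))) ` {(c, w, j). (c, w, j) \<in> J \<and> j \<in> w}"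
definition "E3 = (\<lambda>(c, w, j). (RX (c * k + j), RL c w j)) ` J"
definition "E4 = (\<lambda>(i, c). (RZ c (code i c), RT i c)) ` IC"
definition "LL = (\<lambda>(c, w, j). RL c w j) ` J"
definition "TT = (\<lambda>(i, c). RT i c) ` IC"
text \<open>The index registers are kept out: the tests of \<open>unload\<close> are computed within
  \<open>R0\<close>, so they can be uncomputed after the index has changed.\<close>

definition "R0 = RX ` {..<K * k} \<union> (\<lambda>(c, w). RY c w) ` ({..<K} \<times> W) \<union> (\<lambda>(c, w). RZ c w) ` ({..<K} \<times> W)
   \<union> LL \<union> TT \<union> slot ` E1 \<union> slot ` E2 \<union> slot ` E3 \<union> slot ` E4 \<union> Anc ` LL \<union> Anc ` TT"
definition "RR = R0 \<union> RE ` {..<b}"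

lemma code_W: "code i c \<in> W"
  by (auto simp: code_def W_def)

lemma fin: "finite W" "finite IC" "finite J" "finite {(c, w, j). (c, w, j) \<in> J \<and> j \<in> w}"
  "finite E1" "finite E2" "finite E3" "finite E4" "finite LL" "finite TT" "finite R0" "finite RR"
proof -
  show W: "finite W" "finite IC" by (simp_all add: W_def IC_def)
  then show J: "finite J" by (simp add: J_def)
  have "{(c, w, j). (c, w, j) \<in> J \<and> j \<in> w} \<subseteq> J" by auto
  then show J2: "finite {(c, w, j). (c, w, j) \<in> J \<and> j \<in> w}" using J by (rule finite_subset)
  show E: "finite E1" "finite E2" "finite E3" "finite E4" "finite LL" "finite TT"
    using W J J2 by (simp_all add: E1_def E2_def E3_def E4_def LL_def TT_def)
  show "finite R0" using W E by (simp add: R0_def)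
  then show "finite RR" by (simp add: RR_def)
qed

lemma card_bounds: "card W = 2 ^ k" "card IC = b * K" "card J = K * k * 2 ^ k"
  "card {(c, w, j). (c, w, j) \<in> J \<and> j \<in> w} \<le> K * k * 2 ^ k"
  "card E1 \<le> b * K" "card E2 \<le> K * k * 2 ^ k" "card E3 \<le> K * k * 2 ^ k" "card E4 \<le> b * K"
  "card LL \<le> K * k * 2 ^ k" "card TT \<le> b * K"
proof -
  show W: "card W = 2 ^ k" "card IC = b * K" by (simp_all add: W_def IC_def card_Pow)
  then show J: "card J = K * k * 2 ^ k" by (simp add: J_def card_cartesian_product)
  have "card {(c, w, j). (c, w, j) \<in> J \<and> j \<in> w} \<le> card J"
    by (rule card_mono) (use fin in auto)
  then show J2: "card {(c, w, j). (c, w, j) \<in> J \<and> j \<in> w} \<le> K * k * 2 ^ k" using J by simp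
  show "card E1 \<le> b * K" "card E4 \<le> b * K" "card TT \<le> b * K"
    unfolding E1_def E4_def TT_def using card_image_le[OF fin(2)] W by metis+
  show "card E3 \<le> K * k * 2 ^ k" "card LL \<le> K * k * 2 ^ k"
    unfolding E3_def LL_def using card_image_le[OF fin(3)] J by metis+
  show "card E2 \<le> K * k * 2 ^ k"
    unfolding E2_def using card_image_le[OF fin(4)] J2 le_trans by blast
qed

text \<open>Four families have size at most \<open>b * K\<close> (\<open>TT\<close>, its ancillas,
  the slots of \<open>E1\<close> and \<open>E4\<close>) and six have size at most
  \<open>K * k * 2 ^ k\<close> (\<open>RY\<close>, \<open>RZ\<close>, \<open>LL\<close>, its
  ancillas, the slots of \<open>E2\<close> and \<open>E3\<close>).\<close>

lemma card_RR: "card RR \<le> K * k + b + 4 * (b * K) + 6 * (K * k * 2 ^ k)"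
proof -
  have im: "card (f ` A) \<le> a" if "finite A" "card A \<le> a" for f :: "'x \<Rightarrow> reg" and A a
    using card_image_le[OF that(1), of f] that(2) by simp
  have KW: "finite ({..<K} \<times> W)" "card ({..<K} \<times> W) \<le> K * 2 ^ k"
    using fin card_bounds by (simp_all add: card_cartesian_product)
  have "card RR \<le> K * k + K * 2 ^ k + K * 2 ^ k + K * k * 2 ^ k + b * K + b * K + K * k * 2 ^ k
      + K * k * 2 ^ k + b * K + K * k * 2 ^ k + b * K + b"
    unfolding RR_def R0_def
    by (intro card_Un_le_add im card_bounds fin KW) simp_all
  moreover have "K * 2 ^ k \<le> K * k * 2 ^ k" using k by simp
  ultimately show ?thesis by linarith
qed

lemma pow_deg: "2 ^ k \<le> (2 ^ D :: nat)" "k \<le> 2 ^ D"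
proof -
  show "2 ^ k \<le> (2 ^ D :: nat)" using deg(3) by simp
  then show "k \<le> 2 ^ D" using less_exp[of k] by linarith
qed

lemma index_less: "c < K \<Longrightarrow> j < k \<Longrightarrow> c * k + j < K * k"
proof -
  assume "c < K" "j < k"
  then have "c * k + j < Suc c * k" "Suc c * k \<le> K * k" by (simp, intro mult_le_mono1) simp
  then show ?thesis by simp
qed

lemma mem_R0:
  "p < K * k \<Longrightarrow> RX p \<in> R0"
  "c < K \<Longrightarrow> w \<in> W \<Longrightarrow> RY c w \<in> R0"
  "c < K \<Longrightarrow> w \<in> W \<Longrightarrow> RZ c w \<in> R0"
  "c < K \<Longrightarrow> w \<in> W \<Longrightarrow> j < k \<Longrightarrow> RL c w j \<in> LL"
  "i < b \<Longrightarrow> c < K \<Longrightarrow> RT i c \<in> TT"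
proof -
  show "p < K * k \<Longrightarrow> RX p \<in> R0" by (simp add: R0_def)
  show "RL c w j \<in> LL" if "c < K" "w \<in> W" "j < k"
    unfolding LL_def J_def using that by (intro image_eqI[of _ _ "(c, w, j)"]) auto
  show "RT i c \<in> TT" if "i < b" "c < K"
    unfolding TT_def IC_def using that by (intro image_eqI[of _ _ "(i, c)"]) auto
  assume "c < K" "w \<in> W"
  then have "RY c w \<in> (\<lambda>(c, w). RY c w) ` ({..<K} \<times> W)" "RZ c w \<in> (\<lambda>(c, w). RZ c w) ` ({..<K} \<times> W)"
    by (auto intro: image_eqI[of _ _ "(c, w)"])
  then show "RY c w \<in> R0" "RZ c w \<in> R0" unfolding R0_def by blast+
qed

lemma sub_R0: "LL \<subseteq> R0" "TT \<subseteq> R0" "Anc ` LL \<subseteq> R0" "Anc ` TT \<subseteq> R0"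
  "slot ` E1 \<subseteq> R0" "slot ` E2 \<subseteq> R0" "slot ` E3 \<subseteq> R0" "slot ` E4 \<subseteq> R0" "R0 \<subseteq> RR"
  unfolding RR_def R0_def by blast+

lemma ends:
  "fst ` E1 \<subseteq> RR" "snd ` E1 \<subseteq> R0" "fst ` E2 \<subseteq> R0" "snd ` E2 \<subseteq> R0"
  "fst ` E3 \<subseteq> R0" "snd ` E3 \<subseteq> R0" "fst ` E4 \<subseteq> R0" "snd ` E4 \<subseteq> R0"
  using mem_R0 code_W index_less sub_R0(1,2)
  by (auto simp: E1_def E2_def E3_def E4_def IC_def J_def RR_def)

text \<open>The finer support is recorded too, because it avoids the data registers: this lets
  \<open>load\<close> conjugate by this map while \<open>RX\<close> is being written.\<close>

lemma lin1: obtains P where "prog P (4 * D + 3) (4 * (b * K)) RR"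
    "prog P (4 * D + 3) (4 * (b * K)) (fst ` E1 \<union> snd ` E1 \<union> slot ` E1)"
    "\<And>s. (\<forall>e\<in>E1. \<not> s (slot e)) \<Longrightarrow>
      run P s = (\<lambda>q. if q \<in> snd ` E1 then s q \<noteq> odd (card {u. (u, q) \<in> E1 \<and> s u}) else s q)"
proof (rule linear_layer[of E1 slot D])
  \<comment> \<open>The edges at a fixed register form an image of the coordinate left free: the
    blocks for an index register, the strings for a block value. The other three maps are treated
    alike.\<close>
  show "card {e \<in> E1. fst e = u} \<le> 2 ^ D" for u
    by (rule card_le_image[of _ "\<lambda>c. (u, RY c (code (case u of RE i \<Rightarrow> i) c))" "{..<K}"])
      (use deg in \<open>auto simp: E1_def IC_def\<close>)
  show "card {e \<in> E1. snd e = u} \<le> 2 ^ D" for u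
    by (rule card_le_image[of _ "\<lambda>i. (RE i, u)" "{..<b}"]) (use deg in \<open>auto simp: E1_def IC_def\<close>)
  show "fst ` E1 \<inter> snd ` E1 = {}" "slot ` E1 \<inter> (fst ` E1 \<union> snd ` E1) = {}"
    by (auto simp: E1_def)
  fix P assume P: "prog P (4 * D + 3) (4 * card E1) (fst ` E1 \<union> snd ` E1 \<union> slot ` E1)"
    "\<And>s. (\<forall>e\<in>E1. \<not> s (slot e)) \<Longrightarrow>
      run P s = (\<lambda>q. if q \<in> snd ` E1 then s q \<noteq> odd (card {u. (u, q) \<in> E1 \<and> s u}) else s q)"
  have "fst ` E1 \<union> snd ` E1 \<union> slot ` E1 \<subseteq> RR"
    using ends sub_R0 by (meson Un_least order_trans)
  then show thesis
    using that[OF prog_mono[OF P(1)] prog_mono[OF P(1)] P(2)] card_bounds(5) by simp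
qed (simp_all add: fin inj_slot)

lemma lin2: obtains P where "prog P (4 * D + 3) (4 * (K * k * 2 ^ k)) RR"
    "\<And>s. (\<forall>e\<in>E2. \<not> s (slot e)) \<Longrightarrow>
      run P s = (\<lambda>q. if q \<in> snd ` E2 then s q \<noteq> odd (card {u. (u, q) \<in> E2 \<and> s u}) else s q)"
proof (rule linear_layer[of E2 slot D])
  show "card {e \<in> E2. fst e = u} \<le> 2 ^ D" for u
    by (rule card_le_image[of _ "\<lambda>j. (u, RX ((case u of RY c w \<Rightarrow> c) * k + j))" "{..<k}"])
      (use pow_deg in \<open>auto simp: E2_def J_def\<close>)
  show "card {e \<in> E2. snd e = u} \<le> 2 ^ D" for u
    by (rule card_le_image[of _ "\<lambda>w. (RY ((case u of RX p \<Rightarrow> p) div k) w, u)" W])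
      (use pow_deg card_bounds(1) fin in \<open>auto simp: E2_def J_def\<close>)
  show "fst ` E2 \<inter> snd ` E2 = {}" "slot ` E2 \<inter> (fst ` E2 \<union> snd ` E2) = {}"
    by (auto simp: E2_def)
  fix P assume P: "prog P (4 * D + 3) (4 * card E2) (fst ` E2 \<union> snd ` E2 \<union> slot ` E2)"
    "\<And>s. (\<forall>e\<in>E2. \<not> s (slot e)) \<Longrightarrow>
      run P s = (\<lambda>q. if q \<in> snd ` E2 then s q \<noteq> odd (card {u. (u, q) \<in> E2 \<and> s u}) else s q)"
  have "fst ` E2 \<union> snd ` E2 \<union> slot ` E2 \<subseteq> RR"
    using ends sub_R0 by (meson Un_least order_trans)
  then show thesis
    using that[OF prog_mono[OF P(1)] P(2)] card_bounds(6) by simp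
qed (simp_all add: fin inj_slot)

lemma lin3: obtains P where "prog P (4 * D + 3) (4 * (K * k * 2 ^ k)) R0"
    "\<And>s. (\<forall>e\<in>E3. \<not> s (slot e)) \<Longrightarrow>
      run P s = (\<lambda>q. if q \<in> snd ` E3 then s q \<noteq> odd (card {u. (u, q) \<in> E3 \<and> s u}) else s q)"
proof (rule linear_layer[of E3 slot D])
  show "card {e \<in> E3. fst e = u} \<le> 2 ^ D" for u
    by (rule card_le_image[of _ "\<lambda>w. (u, RL ((case u of RX p \<Rightarrow> p) div k) w ((case u of RX p \<Rightarrow> p) mod k))" W])
      (use pow_deg card_bounds(1) fin in \<open>auto simp: E3_def J_def\<close>)
  show "card {e \<in> E3. snd e = u} \<le> 2 ^ D" for u
    by (rule card_le_image[of _ "\<lambda>_. (RX (case u of RL c w j \<Rightarrow> c * k + j), u)" "{()}"])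
      (auto simp: E3_def J_def)
  show "fst ` E3 \<inter> snd ` E3 = {}" "slot ` E3 \<inter> (fst ` E3 \<union> snd ` E3) = {}"
    by (auto simp: E3_def)
  fix P assume P: "prog P (4 * D + 3) (4 * card E3) (fst ` E3 \<union> snd ` E3 \<union> slot ` E3)"
    "\<And>s. (\<forall>e\<in>E3. \<not> s (slot e)) \<Longrightarrow>
      run P s = (\<lambda>q. if q \<in> snd ` E3 then s q \<noteq> odd (card {u. (u, q) \<in> E3 \<and> s u}) else s q)"
  have "fst ` E3 \<union> snd ` E3 \<union> slot ` E3 \<subseteq> R0"
    using ends sub_R0 by (meson Un_least order_trans)
  then show thesis
    using that[OF prog_mono[OF P(1)] P(2)] card_bounds(7) by simp
qed (simp_all add: fin inj_slot)

lemma lin4: obtains P where "prog P (4 * D + 3) (4 * (b * K)) R0"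
    "\<And>s. (\<forall>e\<in>E4. \<not> s (slot e)) \<Longrightarrow>
      run P s = (\<lambda>q. if q \<in> snd ` E4 then s q \<noteq> odd (card {u. (u, q) \<in> E4 \<and> s u}) else s q)"
proof (rule linear_layer[of E4 slot D])
  show "card {e \<in> E4. fst e = u} \<le> 2 ^ D" for u
    by (rule card_le_image[of _ "\<lambda>i. (u, RT i (case u of RZ c w \<Rightarrow> c))" "{..<b}"])
      (use deg in \<open>auto simp: E4_def IC_def\<close>)
  show "card {e \<in> E4. snd e = u} \<le> 2 ^ D" for u
    by (rule card_le_image[of _ "\<lambda>_. (case u of RT i c \<Rightarrow> RZ c (code i c), u)" "{()}"])
      (auto simp: E4_def IC_def)
  show "fst ` E4 \<inter> snd ` E4 = {}" "slot ` E4 \<inter> (fst ` E4 \<union> snd ` E4) = {}"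
    by (auto simp: E4_def)
  fix P assume P: "prog P (4 * D + 3) (4 * card E4) (fst ` E4 \<union> snd ` E4 \<union> slot ` E4)"
    "\<And>s. (\<forall>e\<in>E4. \<not> s (slot e)) \<Longrightarrow>
      run P s = (\<lambda>q. if q \<in> snd ` E4 then s q \<noteq> odd (card {u. (u, q) \<in> E4 \<and> s u}) else s q)"
  have "fst ` E4 \<union> snd ` E4 \<union> slot ` E4 \<subseteq> R0"
    using ends sub_R0 by (meson Un_least order_trans)
  then show thesis
    using that[OF prog_mono[OF P(1)] P(2)] card_bounds(8) by simp
qed (simp_all add: fin inj_slot)


lemma E1_iff: "(u, q) \<in> E1 \<longleftrightarrow> (\<exists>i c. i < b \<and> c < K \<and> u = RE i \<and> q = RY c (code i c))"
  unfolding E1_def IC_def by auto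

lemma E2_iff: "(u, q) \<in> E2 \<longleftrightarrow>
    (\<exists>c w j. c < K \<and> w \<in> W \<and> j < k \<and> j \<in> w \<and> u = RY c w \<and> q = RX (c * k + j))"
  (is "_ \<longleftrightarrow> ?R")
proof
  show "(u, q) \<in> E2" if "?R"
    using that unfolding E2_def J_def
    by (elim exE conjE, intro image_eqI[of _ _ "(_, _, _)"]) auto
qed (auto simp: E2_def J_def)

lemma E3_iff: "(u, q) \<in> E3 \<longleftrightarrow>
    (\<exists>c w j. c < K \<and> w \<in> W \<and> j < k \<and> u = RX (c * k + j) \<and> q = RL c w j)"
  (is "_ \<longleftrightarrow> ?R")
proof
  show "(u, q) \<in> E3" if "?R"
    using that unfolding E3_def J_def
    by (elim exE conjE, intro image_eqI[of _ _ "(_, _, _)"]) auto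
qed (auto simp: E3_def J_def)

lemma E4_iff: "(u, q) \<in> E4 \<longleftrightarrow> (\<exists>i c. i < b \<and> c < K \<and> u = RZ c (code i c) \<and> q = RT i c)"
  unfolding E4_def IC_def by auto

text \<open>On a one-hot index exactly one value register per block is set, that of
  \<open>code i c\<close>, so adding up block values writes the string; conjugation then clears the
  value registers and leaves the index. On the zero index every sum is empty, whatever the
  data.\<close>

lemma load:
  obtains P where "prog P (12 * D + 9) (8 * (b * K) + 4 * (K * k * 2 ^ k)) RR"
    "\<And>i. i < b \<Longrightarrow> run P (st off (\<lambda>j. j = i)) = st (v i) (\<lambda>j. j = i)"
    "\<And>x. run P (st x off) = st x off"
proof -
  obtain P1 where P1: "prog P1 (4 * D + 3) (4 * (b * K)) RR"
    "prog P1 (4 * D + 3) (4 * (b * K)) (fst ` E1 \<union> snd ` E1 \<union> slot ` E1)"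
    "\<And>s. (\<forall>e\<in>E1. \<not> s (slot e)) \<Longrightarrow>
      run P1 s = (\<lambda>q. if q \<in> snd ` E1 then s q \<noteq> odd (card {u. (u, q) \<in> E1 \<and> s u}) else s q)"
    by (rule lin1) (rule that)
  obtain P2 where P2: "prog P2 (4 * D + 3) (4 * (K * k * 2 ^ k)) RR"
    "\<And>s. (\<forall>e\<in>E2. \<not> s (slot e)) \<Longrightarrow>
      run P2 s = (\<lambda>q. if q \<in> snd ` E2 then s q \<noteq> odd (card {u. (u, q) \<in> E2 \<and> s u}) else s q)"
    by (rule lin2) (rule that)
  let ?P = "P1 @ P2 @ rev P1"
  have "prog ?P (2 * (4 * D + 3) + (4 * D + 3)) (2 * (4 * (b * K)) + 4 * (K * k * 2 ^ k)) RR"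
    by (rule prog_conj[OF P1(1) P2(1)])
  then have 1: "prog ?P (12 * D + 9) (8 * (b * K) + 4 * (K * k * 2 ^ k)) RR"
    by (rule prog_mono) simp_all
  have s1: "run P1 (st x e) q = (if q \<in> snd ` E1 then odd (card {u. (u, q) \<in> E1 \<and> st x e u}) else st x e q)"
    for x e q
  proof -
    have "\<not> st x e q" if "q \<in> snd ` E1" using that by (auto simp: E1_def)
    then show ?thesis using P1(3)[of "st x e"] by (auto split: prod.splits)
  qed
  have s2: "run P2 (run P1 (st x e)) q = (if q \<in> snd ` E2
      then run P1 (st x e) q \<noteq> odd (card {u. (u, q) \<in> E2 \<and> run P1 (st x e) u}) else run P1 (st x e) q)"
    for x e q
  proof -
    have "\<not> run P1 (st x e) (slot p)" for p
    proof -
      have "slot p \<notin> snd ` E1" by (cases p) (auto simp: E1_def)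
      then show ?thesis unfolding s1 by (cases p) simp
    qed
    then show ?thesis using P2(2)[of "run P1 (st x e)"] by simp
  qed
  have R: "run ?P (st x e) = (\<lambda>q. if q \<in> range RX then run P2 (run P1 (st x e)) q else st x e q)" for x e
  proof (rule run_conj[OF P1(2)])
    show "run P2 (run P1 (st x e)) q = run P1 (st x e) q" if "q \<notin> range RX" for q
    proof -
      have "q \<notin> snd ` E2" using that by (auto simp: E2_def)
      then show ?thesis unfolding s2 by simp
    qed
    show "(fst ` E1 \<union> snd ` E1 \<union> slot ` E1) \<inter> range RX = {}" by (auto simp: E1_def)
  qed
  have 2: "run ?P (st off (\<lambda>j. j = i)) = st (v i) (\<lambda>j. j = i)" if i: "i < b" for i
  proof -
    let ?s = "st off (\<lambda>j. j = i)"
    have y: "run P1 ?s (RY c w) \<longleftrightarrow> c < K \<and> w = code i c" for c w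
    proof -
      have "{u. (u, RY c w) \<in> E1 \<and> ?s u} = (if c < K \<and> w = code i c then {RE i} else {})"
        using i by (auto simp: E1_iff)
      then show ?thesis unfolding s1 snd_iff by (auto simp: E1_iff)
    qed
    have x: "run P2 (run P1 ?s) (RX p) = v i p" for p
    proof -
      have "v i p" if "(u, RX p) \<in> E2" "run P1 ?s u" for u
        using that by (auto simp: E2_iff y code_def)
      moreover have "u = RY (p div k) (code i (p div k))" if "(u, RX p) \<in> E2" "run P1 ?s u" for u
        using that by (auto simp: E2_iff y)
      \<comment> \<open>Bit \<open>p\<close> can only come from the one set value of block
        \<open>p div k\<close>, at offset \<open>p mod k\<close>, so the parity has at most one
        term.\<close>
      moreover have "(RY (p div k) (code i (p div k)), RX p) \<in> E2 \<and> run P1 ?s (RY (p div k) (code i (p div k)))"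
        if vp: "v i p"
      proof -
        have "p < K * k" using supp[OF i vp] nK by simp
        then have "p div k < K" by (simp add: less_mult_imp_div_less)
        moreover have "p mod k < k" using k by simp
        moreover have "p mod k \<in> code i (p div k)" using vp k by (simp add: code_def)
        ultimately show ?thesis unfolding E2_iff y using code_W
          by (intro conjI exI[of _ "p div k"] exI[of _ "code i (p div k)"] exI[of _ "p mod k"]) auto
      qed
      ultimately have S: "{u. (u, RX p) \<in> E2 \<and> run P1 ?s u} =
          (if v i p then {RY (p div k) (code i (p div k))} else {})"
        by auto
      have "\<not> run P1 ?s (RX p)" unfolding s1 by (auto simp: E1_def)
      moreover have "RX p \<in> snd ` E2" if "v i p" using S that unfolding snd_iff by (auto split: if_splits)
      ultimately show ?thesis unfolding s2 S by auto
    qed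
    show ?thesis unfolding R
    proof
      fix q
      show "(if q \<in> range RX then run P2 (run P1 ?s) q else ?s q) = st (v i) (\<lambda>j. j = i) q"
        by (cases q) (simp_all add: x image_iff)
    qed
  qed
  have 3: "run ?P (st x off) = st x off" for x
  proof -
    let ?s = "st x off"
    have e: "{u. (u, q) \<in> E1 \<and> ?s u} = {}" for q by (auto simp: E1_iff)
    have "run P1 ?s q = ?s q" for q unfolding s1 e by (auto simp: E1_def)
    then have P1s: "run P1 ?s = ?s" by blast
    have e: "{u. (u, q) \<in> E2 \<and> ?s u} = {}" for q by (auto simp: E2_iff)
    have "run P2 ?s q = ?s q" for q using s2[of x "\<lambda>_. False" q] unfolding P1s e by simp
    then show ?thesis unfolding R P1s by auto
  qed
  show ?thesis by (rule that[OF 1 2 3])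
qed

text \<open>Each block is compared with each of its \<open>2 ^ k\<close> values once for all
  strings; string \<open>i\<close> then picks up \<open>RZ c (code i c)\<close> for every
  \<open>c\<close>. Only the last conjunction leaves a trace, in \<open>RE i\<close>; all that
  precedes it is uncomputed.\<close>

lemma unload:
  obtains P where "prog P (22 * D + 17) (10 * (b * K) + 14 * (K * k * 2 ^ k)) RR"
    "\<And>x e. run P (st x e) = st x (\<lambda>i. if i < b then e i \<noteq> (\<forall>p<K * k. x p = v i p) else e i)"
proof -
  have K: "K \<ge> 1" using nK by (cases K) auto
  obtain Q1 where Q1: "prog Q1 (4 * D + 3) (4 * (K * k * 2 ^ k)) R0"
    "\<And>s. (\<forall>e\<in>E3. \<not> s (slot e)) \<Longrightarrow>
      run Q1 s = (\<lambda>q. if q \<in> snd ` E3 then s q \<noteq> odd (card {u. (u, q) \<in> E3 \<and> s u}) else s q)"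
    by (rule lin3) (rule that)
  obtain Q4 where Q4: "prog Q4 (4 * D + 3) (4 * (b * K)) R0"
    "\<And>s. (\<forall>e\<in>E4. \<not> s (slot e)) \<Longrightarrow>
      run Q4 s = (\<lambda>q. if q \<in> snd ` E4 then s q \<noteq> odd (card {u. (u, q) \<in> E4 \<and> s u}) else s q)"
    by (rule lin4) (rule that)
  \<comment> \<open>A copied bit is negated where \<open>w\<close> has a 0, so that the register
    then holds the agreement of the bit with \<open>w\<close>.\<close>
  define N where "N = {q. \<exists>c w j. c < K \<and> w \<in> W \<and> j < k \<and> j \<notin> w \<and> q = RL c w j}"
  have NL: "N \<subseteq> LL" unfolding N_def using mem_R0(4) by auto
  have finN: "finite N" using NL fin(9) by (rule finite_subset)
  have cardN: "card N \<le> K * k * 2 ^ k" using card_mono[OF fin(9) NL] card_bounds(9) by simp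
  obtain Q2 where Q2: "prog Q2 1 (card N) N" "\<And>s. run Q2 s = (\<lambda>q. if q \<in> N then \<not> s q else s q)"
    by (rule not_layer[OF finN]) (rule that)
  have LLB: "LL = (\<Union>i\<in>{..<K} \<times> W. case i of (c, w) \<Rightarrow> RL c w ` {..<k})"
  proof
    show "LL \<subseteq> (\<Union>i\<in>{..<K} \<times> W. case i of (c, w) \<Rightarrow> RL c w ` {..<k})"
      unfolding LL_def J_def by auto
  qed (use mem_R0(4) in auto)
  obtain Q3 where Q3: "prog Q3 (2 * D + 1) (2 * card LL)
      ((\<lambda>(c, w). RZ c w) ` ({..<K} \<times> W) \<union> LL \<union> Anc ` LL)"
    "\<And>s i. (\<forall>a\<in>LL. \<not> s (Anc a)) \<Longrightarrow> i \<in> {..<K} \<times> W \<Longrightarrow>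
      run Q3 s ((\<lambda>(c, w). RZ c w) i) \<longleftrightarrow> s ((\<lambda>(c, w). RZ c w) i) \<noteq>
        (\<forall>a\<in>(case i of (c, w) \<Rightarrow> RL c w ` {..<k}). s a)"
    "\<And>s q. (\<forall>a\<in>LL. \<not> s (Anc a)) \<Longrightarrow> q \<notin> (\<lambda>(c, w). RZ c w) ` ({..<K} \<times> W) \<Longrightarrow> run Q3 s q = s q"
  proof (rule and_family[of "{..<K} \<times> W" "\<lambda>(c, w). RL c w ` {..<k}" D LL "\<lambda>(c, w). RZ c w" Anc])
    show "card (case i of (c, w) \<Rightarrow> RL c w ` {..<k}) \<le> 2 ^ D" for i
      using pow_deg(2) by (cases i) (auto intro: order_trans[OF card_image_le])
    show "(case i of (c, w) \<Rightarrow> RL c w ` {..<k}) \<noteq> {}" for i using k by (cases i) (auto simp: lessThan_empty_iff)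
    show "(case i of (c, w) \<Rightarrow> RL c w ` {..<k}) \<inter> (case j of (c, w) \<Rightarrow> RL c w ` {..<k}) = {}"
      if "i \<noteq> j" for i j using that by (cases i; cases j) auto
    show "LL = (\<Union>i\<in>{..<K} \<times> W. case i of (c, w) \<Rightarrow> RL c w ` {..<k})" by (rule LLB)
    show "(\<lambda>(c, w). RZ c w) ` ({..<K} \<times> W) \<inter> (LL \<union> Anc ` LL) = {}" "Anc ` LL \<inter> LL = {}"
      by (auto simp: LL_def)
  qed (use fin in \<open>auto simp: inj_on_def\<close>)
  have TTB: "TT = (\<Union>i\<in>{..<b}. RT i ` {..<K})" unfolding TT_def IC_def by auto
  obtain G where G: "prog G (2 * D + 1) (2 * card TT) (RE ` {..<b} \<union> TT \<union> Anc ` TT)"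
    "\<And>s i. (\<forall>a\<in>TT. \<not> s (Anc a)) \<Longrightarrow> i \<in> {..<b} \<Longrightarrow>
      run G s (RE i) \<longleftrightarrow> s (RE i) \<noteq> (\<forall>a\<in>RT i ` {..<K}. s a)"
    "\<And>s q. (\<forall>a\<in>TT. \<not> s (Anc a)) \<Longrightarrow> q \<notin> RE ` {..<b} \<Longrightarrow> run G s q = s q"
  proof (rule and_family[of "{..<b}" "\<lambda>i. RT i ` {..<K}" D TT RE Anc])
    show "card (RT i ` {..<K}) \<le> 2 ^ D" for i
      using deg(2) by (auto intro: order_trans[OF card_image_le])
    show "RT i ` {..<K} \<noteq> {}" for i using K by (auto simp: lessThan_empty_iff)
    show "RT i ` {..<K} \<inter> RT j ` {..<K} = {}" if "i \<noteq> j" for i j using that by auto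
    show "TT = (\<Union>i\<in>{..<b}. RT i ` {..<K})" by (rule TTB)
    show "RE ` {..<b} \<inter> (TT \<union> Anc ` TT) = {}" "Anc ` TT \<inter> TT = {}"
      by (auto simp: TT_def)
  qed (auto simp: inj_on_def)
  \<comment> \<open>Everything but the final conjunctions. \<open>F\<close> avoids
    \<open>RE\<close>, so it can be run backwards after \<open>G\<close> has toggled the
    index.\<close>
  define F where "F = Q1 @ Q2 @ Q3 @ Q4"
  have ZR: "(\<lambda>(c, w). RZ c w) ` ({..<K} \<times> W) \<subseteq> R0" using mem_R0(3) by auto
  have F: "prog F ((4 * D + 3) + (1 + ((2 * D + 1) + (4 * D + 3))))
      (4 * (K * k * 2 ^ k) + (K * k * 2 ^ k + (2 * (K * k * 2 ^ k) + 4 * (b * K)))) R0"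
    unfolding F_def
  proof (intro prog_seq Q1(1) Q4(1))
    show "prog Q2 1 (K * k * 2 ^ k) R0"
      using Q2(1) by (rule prog_mono) (use cardN NL sub_R0(1) in auto)
    have "(\<lambda>(c, w). RZ c w) ` ({..<K} \<times> W) \<union> LL \<union> Anc ` LL \<subseteq> R0" using ZR sub_R0 by simp
    then show "prog Q3 (2 * D + 1) (2 * (K * k * 2 ^ k)) R0"
      by (intro prog_mono[OF Q3(1)]) (use card_bounds(9) in simp_all)
  qed
  have "RE ` {..<b} \<union> TT \<union> Anc ` TT \<subseteq> RR" using sub_R0 unfolding RR_def by blast
  then have GR: "prog G (2 * D + 1) (2 * (b * K)) RR"
    by (intro prog_mono[OF G(1)]) (use card_bounds(10) in simp_all)
  have FR: "prog F (10 * D + 8) (7 * (K * k * 2 ^ k) + 4 * (b * K)) RR"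
    using F by (rule prog_mono) (use sub_R0(9) in simp_all)
  have 1: "prog (F @ G @ rev F) (22 * D + 17) (10 * (b * K) + 14 * (K * k * 2 ^ k)) RR"
    using prog_conj[OF FR GR] by (rule prog_mono) simp_all
  have 2: "run (F @ G @ rev F) (st x e) =
      st x (\<lambda>i. if i < b then e i \<noteq> (\<forall>p<K * k. x p = v i p) else e i)" for x e
  proof -
    define t1 where "t1 = run Q1 (st x e)"
    define t2 where "t2 = run Q2 t1"
    define t3 where "t3 = run Q3 t2"
    define t4 where "t4 = run Q4 t3"
    have Ft: "run F (st x e) = t4" by (simp add: F_def t1_def t2_def t3_def t4_def)
    have "\<forall>e'\<in>E3. \<not> st x e (slot e')" by auto
    note q1 = fun_cong[OF Q1(2)[OF this], folded t1_def]
    have t1L: "t1 (RL c w j) = x (c * k + j)" if "c < K" "w \<in> W" "j < k" for c w j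
    proof -
      have "{u. (u, RL c w j) \<in> E3 \<and> st x e u} = (if x (c * k + j) then {RX (c * k + j)} else {})"
        using that by (auto simp: E3_iff)
      moreover have "RL c w j \<in> snd ` E3" unfolding snd_iff E3_iff using that by auto
      ultimately show ?thesis unfolding q1 by simp
    qed
    have t1o: "t1 q = st x e q" if "q \<notin> LL" for q
    proof -
      have "q \<notin> snd ` E3" using that mem_R0(4) unfolding snd_iff E3_iff by auto
      then show ?thesis unfolding q1 by simp
    qed
    have t2L: "t2 (RL c w j) = (x (c * k + j) = (j \<in> w))" if "c < K" "w \<in> W" "j < k" for c w j
      using that by (auto simp: t2_def Q2(2) N_def t1L)
    have t2o: "t2 q = st x e q" if "q \<notin> LL" for q
      using that NL t1o[OF that] by (auto simp: t2_def Q2(2))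
    have LLn: "Anc q \<notin> LL" "Slot p q \<notin> LL" "RZ c w \<notin> LL" "RE i \<notin> LL" "RT i c \<notin> LL" for p q c w i
      by (auto simp: LL_def)
    have z2: "\<forall>a\<in>LL. \<not> t2 (Anc a)" using t2o LLn by simp
    have t3Z: "t3 (RZ c w) = (\<forall>j<k. x (c * k + j) = (j \<in> w))" if "c < K" "w \<in> W" for c w
      using Q3(2)[OF z2, of "(c, w)"] that t2L t2o LLn by (simp add: t3_def Ball_def)
    have t3o: "t3 q = t2 q" if "q \<notin> (\<lambda>(c, w). RZ c w) ` ({..<K} \<times> W)" for q
      using Q3(3)[OF z2 that] by (simp add: t3_def)
    have z3: "\<not> t3 (Slot p q)" for p q
    proof -
      have "Slot p q \<notin> (\<lambda>(c, w). RZ c w) ` ({..<K} \<times> W)" by auto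
      then show ?thesis using t3o t2o LLn by simp
    qed
    then have "\<forall>e'\<in>E4. \<not> t3 (slot e')" by auto
    note q4 = fun_cong[OF Q4(2)[OF this], folded t4_def]
    have t4T: "t4 (RT i c) = (\<forall>j<k. x (c * k + j) = v i (c * k + j))" if "i < b" "c < K" for i c
    proof -
      have "RT i c \<notin> (\<lambda>(c, w). RZ c w) ` ({..<K} \<times> W)" by auto
      then have "\<not> t3 (RT i c)" using t3o t2o LLn by simp
      moreover have "{u. (u, RT i c) \<in> E4 \<and> t3 u} = (if t3 (RZ c (code i c)) then {RZ c (code i c)} else {})"
        using that by (auto simp: E4_iff)
      moreover have "RT i c \<in> snd ` E4" unfolding snd_iff E4_iff using that by auto
      ultimately have "t4 (RT i c) = t3 (RZ c (code i c))" unfolding q4 by simp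
      then show ?thesis using t3Z[OF that(2) code_W] by (simp add: code_def)
    qed
    have t4o: "t4 q = st x e q" if "\<forall>i c. q \<noteq> RT i c" "q \<notin> LL" "\<forall>c w. q \<noteq> RZ c w" for q
    proof -
      have "q \<notin> snd ` E4" using that(1) unfolding snd_iff E4_iff by blast
      moreover have "q \<notin> (\<lambda>(c, w). RZ c w) ` ({..<K} \<times> W)" using that(3) by auto
      ultimately show ?thesis unfolding q4 using t3o t2o that(2) by simp
    qed
    have z4: "\<forall>a\<in>TT. \<not> t4 (Anc a)" using t4o LLn by simp
    have t4E: "t4 (RE i) = e i" for i using t4o[of "RE i"] LLn by simp
    have all: "(\<forall>c<K. \<forall>j<k. x (c * k + j) = v i (c * k + j)) \<longleftrightarrow> (\<forall>p<K * k. x p = v i p)" for i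
    proof
      assume L: "\<forall>c<K. \<forall>j<k. x (c * k + j) = v i (c * k + j)"
      show "\<forall>p<K * k. x p = v i p"
      proof (intro allI impI)
        fix p assume "p < K * k"
        then have "p div k < K" "p mod k < k" using k by (simp_all add: less_mult_imp_div_less)
        then have "x (p div k * k + p mod k) = v i (p div k * k + p mod k)" using L by blast
        then show "x p = v i p" by simp
      qed
    qed (use index_less in blast)
    have GE: "run G t4 (RE i) = (e i \<noteq> (\<forall>p<K * k. x p = v i p))" if "i < b" for i
      using G(2)[OF z4, of i] that t4T t4E unfolding all[symmetric] by (simp add: Ball_def Bex_def)
    have "run (F @ G @ rev F) (st x e) = (\<lambda>q. if q \<in> RE ` {..<b} then run G (run F (st x e)) q else st x e q)"
    proof (rule run_conj[OF F])
      show "run G (run F (st x e)) q = run F (st x e) q" if "q \<notin> RE ` {..<b}" for q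
        unfolding Ft by (rule G(3)[OF z4 that])
      show "R0 \<inter> RE ` {..<b} = {}" by (auto simp: R0_def LL_def TT_def)
    qed
    also have "\<dots> = st x (\<lambda>i. if i < b then e i \<noteq> (\<forall>p<K * k. x p = v i p) else e i)"
    proof
      fix q
      show "(if q \<in> RE ` {..<b} then run G (run F (st x e)) q else st x e q) =
          st x (\<lambda>i. if i < b then e i \<noteq> (\<forall>p<K * k. x p = v i p) else e i) q"
        unfolding Ft by (cases q) (auto simp: GE image_iff)
    qed
    finally show ?thesis .
  qed
  show ?thesis by (rule that[OF 1 2])
qed

text \<open>After branch \<open>i\<close> has loaded its string, test \<open>j\<close> succeeds iff
  \<open>v i = v j\<close>, that is iff \<open>i = j\<close>, so just the set index bit is toggled
  back. The last clause covers the branches of earlier batches and the flagged branch.\<close>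

lemma batch:
  obtains P where "prog P (34 * D + 26) (18 * (b * K) + 18 * (K * k * 2 ^ k)) RR"
    "\<And>i. i < b \<Longrightarrow> run P (st off (\<lambda>j. j = i)) = st (v i) off"
    "\<And>x. (\<forall>p. x p \<longrightarrow> p \<le> n) \<Longrightarrow> (\<forall>i<b. x \<noteq> v i) \<Longrightarrow> run P (st x off) = st x off"
proof -
  obtain P where P: "prog P (12 * D + 9) (8 * (b * K) + 4 * (K * k * 2 ^ k)) RR"
    "\<And>i. i < b \<Longrightarrow> run P (st off (\<lambda>j. j = i)) = st (v i) (\<lambda>j. j = i)"
    "\<And>x. run P (st x off) = st x off"
    by (rule load) (rule that)
  obtain Q where Q: "prog Q (22 * D + 17) (10 * (b * K) + 14 * (K * k * 2 ^ k)) RR"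
    "\<And>x e. run Q (st x e) = st x (\<lambda>i. if i < b then e i \<noteq> (\<forall>p<K * k. x p = v i p) else e i)"
    by (rule unload) (rule that)
  \<comment> \<open>Agreement on the blocks is equality because both sides vanish beyond
    \<open>n\<close>, which lies below \<open>K * k\<close>.\<close>
  have eq: "(\<forall>p<K * k. x p = v i p) \<longleftrightarrow> x = v i" if "\<forall>p. x p \<longrightarrow> p \<le> n" "i < b" for x i
  proof
    assume L: "\<forall>p<K * k. x p = v i p"
    show "x = v i"
    proof
      fix p
      show "x p = v i p"
        using L that(1) supp[OF that(2), of p] nK by (cases "p < K * k") auto
    qed
  qed simp
  have 1: "prog (P @ Q) (34 * D + 26) (18 * (b * K) + 18 * (K * k * 2 ^ k)) RR"
    using prog_seq[OF P(1) Q(1)] by (rule prog_mono) simp_all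
  have 2: "run (P @ Q) (st off (\<lambda>j. j = i)) = st (v i) off" if i: "i < b" for i
  proof -
    have "v i = v j \<longleftrightarrow> i = j" if "j < b" for j using inj[OF i that] by blast
    moreover have "\<forall>p. v i p \<longrightarrow> p \<le> n" using supp[OF i] by blast
    ultimately have "(\<lambda>j. if j < b then (j = i) \<noteq> (\<forall>p<K * k. v i p = v j p) else j = i) = off"
      using eq[of "v i"] i by (intro ext) auto
    then show ?thesis using P(2)[OF i] Q(2)[of "v i" "\<lambda>j. j = i"] by simp
  qed
  have 3: "run (P @ Q) (st x off) = st x off"
    if x: "\<forall>p. x p \<longrightarrow> p \<le> n" "\<forall>i<b. x \<noteq> v i" for x
  proof -
    have "(\<lambda>i. if i < b then False \<noteq> (\<forall>p<K * k. x p = v i p) else False) = off"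
      using eq[OF x(1)] x(2) by auto
    then show ?thesis using P(3)[of x] Q(2)[of x "\<lambda>_. False"] by simp
  qed
  show ?thesis by (rule that[OF 1 2 3])
qed

lemma RX_RE_mem: "RX ` {..n} \<subseteq> RR" "RE ` {..<b} \<subseteq> RR"
  using nK unfolding RR_def R0_def by auto

end

section \<open>Loading a single string; splitting an excitation\<close>

text \<open>A batch of one string without blocks, cheap enough in ancillas for
  \<open>m >= 6 * n\<close>: \<open>n + 1\<close> registers for data and flag, one for the index, at
  most \<open>n\<close> slots and \<open>n + 1\<close> ancillas for a single conjunction over all
  positions including the flag.\<close>

lemma small_batch:
  fixes n D :: nat and v :: "nat \<Rightarrow> bool"
  assumes deg: "n + 1 \<le> 2 ^ D" and supp: "\<And>p. v p \<Longrightarrow> p < n"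
  obtains P R where "prog P (6 * D + 6) (8 * n + 4) R" "finite R" "RX ` {..n} \<subseteq> R" "RE 0 \<in> R"
    "card R \<le> 3 * n + 3"
    "run P (st off (\<lambda>j. j = 0)) = st v off"
    "\<And>x. (\<forall>p. x p \<longrightarrow> p \<le> n) \<Longrightarrow> x \<noteq> v \<Longrightarrow> run P (st x off) = st x off"
proof -
  define S where "S = {p. v p}"
  have S: "S \<subseteq> {..<n}" using supp by (auto simp: S_def)
  then have finS: "finite S" and cardS: "card S \<le> n"
    using finite_subset card_mono[of "{..<n}" S] by auto
  define E where "E = (\<lambda>p. (RE 0, RX p)) ` S"
  have finE: "finite E" and cardE: "card E \<le> n"
    using finS cardS card_image_le[OF finS, of "\<lambda>p. (RE 0, RX p)"] by (auto simp: E_def)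
  define A where "A = RX ` {..n}"
  define N where "N = RX ` ({..n} - S)"
  define R where "R = A \<union> ({RE 0} \<union> (slot ` E \<union> Anc ` A))"
  have fin: "finite A" "finite N" "finite R" using finE by (simp_all add: A_def N_def R_def)
  have cardA: "card A = n + 1" by (simp add: A_def card_image inj_on_def)
  have cardN: "card N \<le> n + 1"
    using card_mono[of A N] fin cardA by (auto simp: A_def N_def)
  have cardR: "card R \<le> 3 * n + 3"
  proof -
    have "card (slot ` E) \<le> n" "card (Anc ` A) \<le> n + 1"
      using card_image_le[OF finE, of slot] cardE card_image_le[OF fin(1), of Anc] cardA by simp_all
    then have "card R \<le> (n + 1) + (1 + (n + (n + 1)))"
      unfolding R_def by (intro card_Un_le_add) (simp_all add: cardA)
    then show ?thesis by simp
  qed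
  have E_iff: "(u, q) \<in> E \<longleftrightarrow> u = RE 0 \<and> (\<exists>p. v p \<and> q = RX p)" for u q
    by (auto simp: E_def S_def)
  obtain P1 where P1: "prog P1 (4 * D + 3) (4 * card E) (fst ` E \<union> snd ` E \<union> slot ` E)"
    "\<And>s. (\<forall>e\<in>E. \<not> s (slot e)) \<Longrightarrow>
      run P1 s = (\<lambda>q. if q \<in> snd ` E then s q \<noteq> odd (card {u. (u, q) \<in> E \<and> s u}) else s q)"
  proof (rule linear_layer[of E slot D])
    show "card {e \<in> E. fst e = u} \<le> 2 ^ D" for u
      by (rule card_le_image[of _ "\<lambda>e. e" E]) (use finE cardE deg in auto)
    show "card {e \<in> E. snd e = u} \<le> 2 ^ D" for u
      by (rule card_le_image[of _ "\<lambda>_. (RE 0, u)" "{()}"]) (auto simp: E_def)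
    show "fst ` E \<inter> snd ` E = {}" "slot ` E \<inter> (fst ` E \<union> snd ` E) = {}"
      by (auto simp: E_def)
  qed (simp_all add: finE inj_slot)
  obtain Q where Q: "prog Q 1 (card N) N" "\<And>s. run Q s = (\<lambda>q. if q \<in> N then \<not> s q else s q)"
    by (rule not_layer[OF fin(2)]) (rule that)
  obtain G where G: "prog G (2 * D + 1) (2 * card A) (insert (RE 0) (A \<union> Anc ` A))"
    "\<And>s. (\<forall>a\<in>A. \<not> s (Anc a)) \<Longrightarrow> run G s = s(RE 0 := (s (RE 0) \<noteq> (\<forall>a\<in>A. s a)))"
    by (rule and_gate[of A D "RE 0" Anc]) (use fin cardA deg in \<open>auto simp: A_def inj_on_def\<close>)
  have NA: "N \<subseteq> A" by (auto simp: N_def A_def)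
  have "fst ` E \<union> snd ` E \<union> slot ` E \<subseteq> R" using S by (auto simp: R_def E_def A_def)
  then have P1R: "prog P1 (4 * D + 3) (4 * n) R"
    by (intro prog_mono[OF P1(1)]) (use cardE in simp_all)
  have QR: "prog Q 1 (n + 1) R" using Q(1) by (rule prog_mono) (use cardN NA in \<open>auto simp: R_def\<close>)
  have GR: "prog G (2 * D + 1) (2 * (n + 1)) R"
    using G(1) by (rule prog_mono) (use cardA in \<open>auto simp: R_def\<close>)
  have 1: "prog (P1 @ (Q @ G @ rev Q)) (6 * D + 6) (8 * n + 4) R"
    using prog_seq[OF P1R prog_conj[OF QR GR]] by (rule prog_mono) simp_all
  have load: "run P1 (st x e) = st (\<lambda>p. x p \<noteq> (v p \<and> e 0)) e" for x e
  proof -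
    have z: "\<forall>e'\<in>E. \<not> st x e (slot e')" by auto
    have "run P1 (st x e) q = st (\<lambda>p. x p \<noteq> (v p \<and> e 0)) e q" for q
    proof (cases "q \<in> snd ` E")
      case True
      then obtain p where p: "q = RX p" "v p" by (auto simp: E_def S_def)
      then have "{u. (u, q) \<in> E \<and> st x e u} = (if e 0 then {RE 0} else {})" by (auto simp: E_iff)
      then show ?thesis using True p P1(2)[OF z] by simp
    next
      case False
      then have "\<not> v p" if "q = RX p" for p using that unfolding snd_iff E_iff by auto
      then show ?thesis using False P1(2)[OF z] by (cases q) simp_all
    qed
    then show ?thesis by blast
  qed
  have unload: "run (Q @ G @ rev Q) (st x e) =
      st x (\<lambda>i. if i = 0 then e 0 \<noteq> (\<forall>p\<le>n. x p = v p) else e i)" for x e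
  proof -
    have q: "run Q (st x e) (RX p) = (x p = v p)" if "p \<le> n" for p
      using that by (auto simp: Q(2) N_def S_def)
    have qo: "run Q (st x e) r = st x e r" if "r \<notin> A" for r
      using that NA by (auto simp: Q(2))
    have z: "\<forall>a\<in>A. \<not> run Q (st x e) (Anc a)"
      using qo by (auto simp: A_def image_iff)
    have "run Q (st x e) (RE 0) = e 0" using qo by (auto simp: A_def image_iff)
    then have g: "run G (run Q (st x e)) = (run Q (st x e))(RE 0 := (e 0 \<noteq> (\<forall>p\<le>n. x p = v p)))"
      unfolding G(2)[OF z] using q by (auto simp: A_def Ball_def Bex_def)
    have "run (Q @ G @ rev Q) (st x e) =
        (\<lambda>r. if r \<in> {RE 0} then run G (run Q (st x e)) r else st x e r)"
      by (rule run_conj[OF Q(1)]) (auto simp: g N_def)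
    also have "\<dots> = st x (\<lambda>i. if i = 0 then e 0 \<noteq> (\<forall>p\<le>n. x p = v p) else e i)"
    proof
      fix r
      show "(if r \<in> {RE 0} then run G (run Q (st x e)) r else st x e r) =
          st x (\<lambda>i. if i = 0 then e 0 \<noteq> (\<forall>p\<le>n. x p = v p) else e i) r"
        by (cases r) (auto simp: g)
    qed
    finally show ?thesis .
  qed
  have 2: "run (P1 @ (Q @ G @ rev Q)) (st off (\<lambda>j. j = 0)) = st v off"
  proof -
    have "run (P1 @ (Q @ G @ rev Q)) (st off (\<lambda>j. j = 0)) = run (Q @ G @ rev Q) (st v (\<lambda>j. j = 0))"
      using load[of "\<lambda>_. False" "\<lambda>j. j = 0"] by simp
    also have "\<dots> = st v off"
      unfolding unload by (rule arg_cong[of _ _ "st v"]) auto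
    finally show ?thesis .
  qed
  have 3: "run (P1 @ (Q @ G @ rev Q)) (st x off) = st x off"
    if x: "\<forall>p. x p \<longrightarrow> p \<le> n" "x \<noteq> v" for x
  proof -
    have ne: "\<not> (\<forall>p\<le>n. x p = v p)"
    proof
      assume L: "\<forall>p\<le>n. x p = v p"
      have "x p = v p" for p
        using L x(1) supp[of p] by (cases "p \<le> n") auto
      then show False using x(2) by blast
    qed
    have "run (P1 @ (Q @ G @ rev Q)) (st x off) = run (Q @ G @ rev Q) (st x off)"
      using load[of x "\<lambda>_. False"] by simp
    also have "\<dots> = st x off"
      unfolding unload by (rule arg_cong[of _ _ "st x"]) (use ne in auto)
    finally show ?thesis .
  qed
  show ?thesis
    by (rule that[OF 1 fin(3) _ _ cardR 2 3]) (auto simp: R_def A_def)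
qed

section \<open>Splitting an excitation by real rotations\<close>

definition rot :: "real \<Rightarrow> real \<Rightarrow> mat2" where
  "rot c s a b = complex_of_real (if a = b then c else if a then s else - s)"

lemma unitary_rot: "c\<^sup>2 + s\<^sup>2 = 1 \<Longrightarrow> unitary2 (rot c s)"
proof -
  assume "c\<^sup>2 + s\<^sup>2 = 1"
  then have "complex_of_real (c * c + s * s) = 1" by (simp add: power2_eq_square)
  then have "of_real c * of_real c + of_real s * of_real s = (1 :: complex)" by simp
  then show ?thesis unfolding unitary2_def
    by (simp add: rot_def UNIV_bool all_bool_eq add.commute)
qed

lemma apply_rot_ket:
  "j < N \<Longrightarrow> apply_gate (G1 (rot c s) j) (ket N z) =
    (\<lambda>x. of_real (if z j then - s else c) * ket N (z(j := False)) x
       + of_real (if z j then c else s) * ket N (z(j := True)) x)"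
  by (cases "z j") (auto simp: apply_G1_ket rot_def UNIV_bool add.commute simp del: apply_gate.simps)

text \<open>\<open>- u\<close> and \<open>w\<close> are the sine and cosine of some angle, and
  \<open>c\<close>, \<open>s\<close> belong to half of it: conjugating a flip by a rotation doubles
  the angle of the rotation.\<close>

lemma half_angle:
  fixes u w :: real
  assumes "u\<^sup>2 + w\<^sup>2 = 1"
  obtains c s where "c\<^sup>2 + s\<^sup>2 = 1" "u = - 2 * c * s" "w = c\<^sup>2 - s\<^sup>2"
proof -
  have "w\<^sup>2 + (- u)\<^sup>2 = 1" using assms by simp
  then obtain t where t: "w = cos t" "- u = sin t" by (rule sincos_total_2pi)
  have 1: "(cos (t / 2))\<^sup>2 + (sin (t / 2))\<^sup>2 = 1" by simp
  have "- u = 2 * sin (t / 2) * cos (t / 2)" using t(2) sin_double[of "t / 2"] by simp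
  then have 2: "u = - 2 * cos (t / 2) * sin (t / 2)" by algebra
  have 3: "w = (cos (t / 2))\<^sup>2 - (sin (t / 2))\<^sup>2" using t cos_double[of "t / 2"] by simp
  show ?thesis by (rule that[OF 1 2 3])
qed

text \<open>Conjugating the controlled negation of \<open>b\<close> by a rotation turns it into a controlled
  reflection; the final CNOT moves the excitation from \<open>a\<close> to \<open>b\<close>.\<close>

lemma split_gates:
  fixes u w :: real
  assumes ab: "a < N" "b < N" "a \<noteq> b" and uw: "u\<^sup>2 + w\<^sup>2 = 1"
  obtains gs where "length gs = 4" "\<forall>g\<in>set gs. valid_gate N g \<and> gate_qubits g \<subseteq> {a, b}"
    "\<And>z. \<not> z a \<Longrightarrow> \<not> z b \<Longrightarrow> run_gates gs (ket N z) = ket N z"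
    "\<And>z. \<not> z a \<Longrightarrow> \<not> z b \<Longrightarrow> run_gates gs (ket N (z(a := True))) =
      (\<lambda>x. of_real u * ket N (z(a := True)) x + of_real w * ket N (z(b := True)) x)"
proof -
  obtain c s where cs: "c\<^sup>2 + s\<^sup>2 = 1" "u = - 2 * c * s" "w = c\<^sup>2 - s\<^sup>2"
    by (rule half_angle[OF uw])
  \<comment> \<open>With \<open>a\<close> off the two rotations cancel. With \<open>a\<close> on,
    \<open>b\<close> becomes \<open>c|0> - s|1>\<close>, is flipped and rotated back, which gives
    \<open>- 2 c s |0> + (c^2 - s^2) |1>\<close>.\<close>
  define gs where "gs = [G1 (rot c (- s)) b, CNOT a b, G1 (rot c s) b, CNOT b a]"
  define M where "M z p q = ket N (z(a := p, b := q))" for z p q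
  have R: "apply_gate (G1 (rot c' s') b) (M z p q) =
      (\<lambda>x. of_real (if q then - s' else c') * M z p False x + of_real (if q then c' else s') * M z p True x)"
    for c' s' z p q
    unfolding M_def using ab by (simp add: apply_rot_ket del: apply_gate.simps)
  have C: "apply_gate (CNOT a b) (M z p q) = M z p (q \<noteq> p)"
    "apply_gate (CNOT b a) (M z p q) = M z (p \<noteq> q) q" for z p q
    unfolding M_def using ab by (simp_all add: apply_CNOT_ket fun_upd_twist del: apply_gate.simps)
  have lin: "apply_gate g (\<lambda>x. k1 * f x + k2 * h x) =
      (\<lambda>x. k1 * apply_gate g f x + k2 * apply_gate g h x)" for g k1 k2 f h
    using apply_gates_add[of "[g]" "\<lambda>x. k1 * f x" "\<lambda>x. k2 * h x"]
      apply_gates_scale[of "[g]" k1 f] apply_gates_scale[of "[g]" k2 h] by simp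
  have F: "run_gates gs (M z p False) =
      (\<lambda>x. of_real c * (of_real (if p then - s else c) * M z (p \<noteq> False) False x
          + of_real (if p then c else s) * M z (p \<noteq> True) True x)
        + of_real (- s) * (of_real (if \<not> p then - s else c) * M z (p \<noteq> False) False x
          + of_real (if \<not> p then c else s) * M z (p \<noteq> True) True x))" for z p
    unfolding gs_def by (cases p) (simp_all add: R C lin del: apply_gate.simps of_real_minus)
  have MF: "M z False False = ket N z" "M z True False = ket N (z(a := True))"
    "M z False True = ket N (z(b := True))" if "\<not> z a" "\<not> z b" for z
    using that ab by (simp_all add: M_def fun_upd_idem fun_upd_twist)
  have 1: "length gs = 4" by (simp add: gs_def)
  have 2: "\<forall>g\<in>set gs. valid_gate N g \<and> gate_qubits g \<subseteq> {a, b}"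
    using ab cs(1) by (auto simp: gs_def intro!: unitary_rot)
  have 3: "run_gates gs (ket N z) = ket N z" if "\<not> z a" "\<not> z b" for z
  proof -
    have "run_gates gs (ket N z) = (\<lambda>x. of_real (c\<^sup>2 + s\<^sup>2) * ket N z x)"
      using F[of z False] by (simp add: MF[OF that] fun_eq_iff algebra_simps power2_eq_square)
    then show ?thesis unfolding cs(1) by simp
  qed
  have 4: "run_gates gs (ket N (z(a := True))) =
      (\<lambda>x. of_real u * ket N (z(a := True)) x + of_real w * ket N (z(b := True)) x)"
    if "\<not> z a" "\<not> z b" for z
    using F[of z True] unfolding cs(2,3)
    by (simp add: fun_eq_iff algebra_simps power2_eq_square MF[OF that])
  show ?thesis by (rule that[OF 1 2 3 4])
qed

text \<open>Both halves of a splitting tree need unit vectors. A half of norm 0 cannot be rescaled;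
  there the unit vector at \<open>h\<close> serves, since it gets multiplied by 0.\<close>

lemma normalize_amplitudes:
  fixes a :: "'q \<Rightarrow> complex"
  assumes "finite A" "h \<in> A"
  obtains a' where "(\<Sum>q\<in>A. (cmod (a' q))\<^sup>2) = 1"
    "\<And>q. q \<in> A \<Longrightarrow> a q = of_real (sqrt (\<Sum>q\<in>A. (cmod (a q))\<^sup>2)) * a' q"
proof (cases "(\<Sum>q\<in>A. (cmod (a q))\<^sup>2) = 0")
  case True
  define a' where "a' q = (if q = h then 1 else 0 :: complex)" for q
  have "(\<Sum>q\<in>A. (cmod (a' q))\<^sup>2) = (\<Sum>q\<in>A. if q = h then 1 else 0)"
    by (rule sum.cong) (auto simp: a'_def)
  then have 1: "(\<Sum>q\<in>A. (cmod (a' q))\<^sup>2) = 1" using assms by simp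
  have "\<forall>q\<in>A. (cmod (a q))\<^sup>2 = 0" using True assms(1) by (subst (asm) sum_nonneg_eq_0_iff) auto
  then show ?thesis using that[OF 1] True by simp
next
  case False
  define r where "r = (\<Sum>q\<in>A. (cmod (a q))\<^sup>2)"
  have r: "r > 0" using False sum_nonneg[of A "\<lambda>q. (cmod (a q))\<^sup>2"] by (simp add: r_def)
  define a' where "a' q = a q / of_real (sqrt r)" for q
  have "(\<Sum>q\<in>A. (cmod (a' q))\<^sup>2) = (\<Sum>q\<in>A. (cmod (a q))\<^sup>2 / r)"
    using r by (intro sum.cong) (simp_all add: a'_def norm_divide power_divide)
  also have "\<dots> = 1" using r by (simp add: r_def sum_divide_distrib[symmetric])
  finally have 1: "(\<Sum>q\<in>A. (cmod (a' q))\<^sup>2) = 1" .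
  show ?thesis using that[OF 1] r by (simp add: a'_def r_def)
qed

text \<open>The excitation at the head is divided between the heads of the two halves, with the
  norms \<open>r1\<close>, \<open>r2\<close> of the halves as real amplitudes; all complex phases
  wait for the leaves. One gate per leaf and four per inner node make
  \<open>5 * length L - 4\<close>. The action on the unexcited state is carried along because a
  branch excited in one half must pass the other half unchanged.\<close>

lemma split_tree:
  assumes "L \<noteq> []" "length L \<le> 2 ^ D" "distinct L" "set L \<subseteq> {..<N}" "(\<Sum>q\<in>set L. (cmod (a q))\<^sup>2) = 1"
  shows "\<exists>gs. dep gate_qubits gs (4 * D + 1) \<and> length gs + 4 \<le> 5 * length L \<and>
    (\<forall>g\<in>set gs. valid_gate N g \<and> gate_qubits g \<subseteq> set L) \<and>
    (\<forall>z. (\<forall>q\<in>set L. \<not> z q) \<longrightarrow> run_gates gs (ket N z) = ket N z \<and>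
      run_gates gs (ket N (z(hd L := True))) = (\<lambda>x. \<Sum>q\<in>set L. a q * ket N (z(q := True)) x))"
  using assms
proof (induction arbitrary: a rule: halving_induct)
  case (single y D)
  have "(cmod (a y))\<^sup>2 = 1\<^sup>2" using single.prems(3) by simp
  then have "cmod (a y) = 1" by (rule power2_eq_imp_eq) simp_all
  then have y: "y < N" "cmod (a y) = 1" using single.prems(2) by simp_all
  have "dep gate_qubits [G1 (phase (a y)) y] (4 * D + 1)"
    by (simp add: dep_single)
  then show ?case
    using y by (intro exI[of _ "[G1 (phase (a y)) y]"])
      (simp add: apply_phase_ket unitary_phase del: apply_gate.simps)
next
  case (split D L1 L2)
  have dis: "distinct L1" "distinct L2" "set L1 \<inter> set L2 = {}"
    and N: "set L1 \<subseteq> {..<N}" "set L2 \<subseteq> {..<N}" using split.prems by auto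
  define h1 h2 where "h1 = hd L1" and "h2 = hd L2"
  have h: "h1 \<in> set L1" "h2 \<in> set L2" using split.hyps by (simp_all add: h1_def h2_def)
  then have h12: "h1 \<noteq> h2" "h1 \<notin> set L2" "h2 \<notin> set L1" using dis(3) by (auto simp: disjoint_iff)
  have hN: "h1 < N" "h2 < N" using h N by auto
  define r1 r2 where "r1 = sqrt (\<Sum>q\<in>set L1. (cmod (a q))\<^sup>2)" and "r2 = sqrt (\<Sum>q\<in>set L2. (cmod (a q))\<^sup>2)"
  obtain a1 where a1: "(\<Sum>q\<in>set L1. (cmod (a1 q))\<^sup>2) = 1" "\<And>q. q \<in> set L1 \<Longrightarrow> a q = of_real r1 * a1 q"
    by (rule normalize_amplitudes[OF finite_set h(1), of a, folded r1_def]) (rule that)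
  obtain a2 where a2: "(\<Sum>q\<in>set L2. (cmod (a2 q))\<^sup>2) = 1" "\<And>q. q \<in> set L2 \<Longrightarrow> a q = of_real r2 * a2 q"
    by (rule normalize_amplitudes[OF finite_set h(2), of a, folded r2_def]) (rule that)
  have "r1\<^sup>2 + r2\<^sup>2 = (\<Sum>q\<in>set L1. (cmod (a q))\<^sup>2) + (\<Sum>q\<in>set L2. (cmod (a q))\<^sup>2)"
    by (simp add: r1_def r2_def sum_nonneg)
  also have "\<dots> = 1" using split.prems(3) dis(3) by (simp add: sum.union_disjoint)
  finally have r: "r1\<^sup>2 + r2\<^sup>2 = 1" .
  from split.IH(1)[OF dis(1) N(1) a1(1)] obtain g1 where g1: "dep gate_qubits g1 (4 * D + 1)"
    "length g1 + 4 \<le> 5 * length L1" "\<forall>g\<in>set g1. valid_gate N g \<and> gate_qubits g \<subseteq> set L1"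
    "\<forall>z. (\<forall>q\<in>set L1. \<not> z q) \<longrightarrow> run_gates g1 (ket N z) = ket N z \<and>
      run_gates g1 (ket N (z(hd L1 := True))) = (\<lambda>x. \<Sum>q\<in>set L1. a1 q * ket N (z(q := True)) x)"
    by (elim exE conjE)
  from split.IH(2)[OF dis(2) N(2) a2(1)] obtain g2 where g2: "dep gate_qubits g2 (4 * D + 1)"
    "length g2 + 4 \<le> 5 * length L2" "\<forall>g\<in>set g2. valid_gate N g \<and> gate_qubits g \<subseteq> set L2"
    "\<forall>z. (\<forall>q\<in>set L2. \<not> z q) \<longrightarrow> run_gates g2 (ket N z) = ket N z \<and>
      run_gates g2 (ket N (z(hd L2 := True))) = (\<lambda>x. \<Sum>q\<in>set L2. a2 q * ket N (z(q := True)) x)"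
    by (elim exE conjE)
  note g1z = conjunct1[OF mp[OF spec[OF g1(4)]]] and g1h = conjunct2[OF mp[OF spec[OF g1(4)]], folded h1_def]
  note g2z = conjunct1[OF mp[OF spec[OF g2(4)]]] and g2h = conjunct2[OF mp[OF spec[OF g2(4)]], folded h2_def]
  obtain g0 where g0: "length g0 = 4" "\<forall>g\<in>set g0. valid_gate N g \<and> gate_qubits g \<subseteq> {h1, h2}"
    "\<And>z. \<not> z h1 \<Longrightarrow> \<not> z h2 \<Longrightarrow> run_gates g0 (ket N z) = ket N z"
    "\<And>z. \<not> z h1 \<Longrightarrow> \<not> z h2 \<Longrightarrow> run_gates g0 (ket N (z(h1 := True))) =
      (\<lambda>x. of_real r1 * ket N (z(h1 := True)) x + of_real r2 * ket N (z(h2 := True)) x)"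
    by (rule split_gates[OF hN h12(1) r]) (rule that)
  have sub: "\<Union>(gate_qubits ` set g1) \<subseteq> set L1" "\<Union>(gate_qubits ` set g2) \<subseteq> set L2"
    using g1(3) g2(3) by auto
  then have "\<Union>(gate_qubits ` set g1) \<inter> \<Union>(gate_qubits ` set g2) = {}"
    using dis(3) by (metis Int_mono subset_empty)
  then have "dep gate_qubits (g1 @ g2) (4 * D + 1)" by (rule dep_par[OF g1(1) g2(1)])
  from dep_seq[OF dep_length[of gate_qubits g0] this]
  have dep: "dep gate_qubits (g0 @ (g1 @ g2)) (4 * Suc D + 1)" by (simp add: g0(1))
  have len: "length (g0 @ (g1 @ g2)) + 4 \<le> 5 * length (L1 @ L2)" using g0(1) g1(2) g2(2) by simp
  have val: "\<forall>g\<in>set (g0 @ (g1 @ g2)). valid_gate N g \<and> gate_qubits g \<subseteq> set (L1 @ L2)"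
  proof
    fix g assume "g \<in> set (g0 @ (g1 @ g2))"
    then consider "g \<in> set g0" | "g \<in> set g1" | "g \<in> set g2" by auto
    then show "valid_gate N g \<and> gate_qubits g \<subseteq> set (L1 @ L2)"
    proof cases
      case 1
      then have "gate_qubits g \<subseteq> {h1, h2}" using g0(2) by blast
      then show ?thesis using 1 g0(2) h by auto
    qed (use g1(3) g2(3) in auto)
  qed
  have sem: "run_gates (g0 @ (g1 @ g2)) (ket N z) = ket N z \<and>
      run_gates (g0 @ (g1 @ g2)) (ket N (z(hd (L1 @ L2) := True))) =
        (\<lambda>x. \<Sum>q\<in>set (L1 @ L2). a q * ket N (z(q := True)) x)"
    if z: "\<forall>q\<in>set (L1 @ L2). \<not> z q" for z
  proof
    have z1: "\<forall>q\<in>set L1. \<not> z q" and z2: "\<forall>q\<in>set L2. \<not> z q" using z by auto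
    have zh: "\<not> z h1" "\<not> z h2" using z1 z2 h by auto
    show "run_gates (g0 @ (g1 @ g2)) (ket N z) = ket N z"
      by (simp add: g0(3)[of z] zh g1z[OF z1] g2z[OF z2])
    have u1: "\<forall>q\<in>set L1. \<not> (z(h2 := True)) q" using z1 h12 by auto
    have u2: "\<forall>q\<in>set L2. \<not> (z(p := True)) q" if "p \<in> set L1" for p
      using z2 that dis(3) by (auto simp: disjoint_iff)
    have "hd (L1 @ L2) = h1" using split.hyps by (simp add: h1_def)
    then have "run_gates (g0 @ (g1 @ g2)) (ket N (z(hd (L1 @ L2) := True))) =
        run_gates g2 (run_gates g1
          (\<lambda>x. of_real r1 * ket N (z(h1 := True)) x + of_real r2 * ket N (z(h2 := True)) x))"
      by (simp add: g0(4)[of z] zh)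
    also have "\<dots> = run_gates g2
          (\<lambda>x. of_real r1 * (\<Sum>q\<in>set L1. a1 q * ket N (z(q := True)) x) + of_real r2 * ket N (z(h2 := True)) x)"
      unfolding apply_gates_add apply_gates_scale g1h[OF z1] g1z[OF u1] ..
    also have "\<dots> = (\<lambda>x. of_real r1 * (\<Sum>q\<in>set L1. a1 q * run_gates g2 (ket N (z(q := True))) x)
         + of_real r2 * (\<Sum>q\<in>set L2. a2 q * ket N (z(q := True)) x))"
      unfolding apply_gates_add apply_gates_scale apply_gates_sum g2h[OF z2] ..
    also have "\<dots> = (\<lambda>x. (\<Sum>q\<in>set L1. a q * ket N (z(q := True)) x) + (\<Sum>q\<in>set L2. a q * ket N (z(q := True)) x))"
    proof
      fix x
      have "run_gates g2 (ket N (z(p := True))) = ket N (z(p := True))" if "p \<in> set L1" for p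
        by (rule g2z[OF u2[OF that]])
      then have "(\<Sum>q\<in>set L1. a1 q * run_gates g2 (ket N (z(q := True))) x) =
          (\<Sum>q\<in>set L1. a1 q * ket N (z(q := True)) x)"
        by (intro sum.cong refl) metis
      then show "of_real r1 * (\<Sum>q\<in>set L1. a1 q * run_gates g2 (ket N (z(q := True))) x)
          + of_real r2 * (\<Sum>q\<in>set L2. a2 q * ket N (z(q := True)) x) =
        (\<Sum>q\<in>set L1. a q * ket N (z(q := True)) x) + (\<Sum>q\<in>set L2. a q * ket N (z(q := True)) x)"
        by (simp add: sum_distrib_left a1(2) a2(2) mult.assoc)
    qed
    also have "\<dots> = (\<lambda>x. \<Sum>q\<in>set (L1 @ L2). a q * ket N (z(q := True)) x)"
      using dis(3) by (simp add: sum.union_disjoint)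
    finally show "run_gates (g0 @ (g1 @ g2)) (ket N (z(hd (L1 @ L2) := True))) =
        (\<lambda>x. \<Sum>q\<in>set (L1 @ L2). a q * ket N (z(q := True)) x)" .
  qed
  show ?case using dep len val sem by blast
qed

section \<open>Preparing the state batch by batch\<close>

text \<open>The contract met by both \<open>small_batch\<close> and \<open>chunks.batch\<close>, so
  that the iteration need not know which of them it runs.\<close>

definition batch_prog ::
  "nat \<Rightarrow> nat \<Rightarrow> nat \<Rightarrow> nat \<Rightarrow> reg set \<Rightarrow> (nat \<Rightarrow> nat \<Rightarrow> bool) \<Rightarrow> reg op list \<Rightarrow> bool" where
  "batch_prog n b D S R v P \<longleftrightarrow> prog P D S R \<and>
    (\<forall>i<b. run P (st off (\<lambda>j. j = i)) = st (v i) off) \<and>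
    (\<forall>x. (\<forall>p. x p \<longrightarrow> p \<le> n) \<longrightarrow> (\<forall>i<b. x \<noteq> v i) \<longrightarrow>
      run P (st x off) = st x off)"

text \<open>Data and flag sit on the qubits \<open>0..n\<close> in every layout, all else above:
  batches with different register sets then communicate through these qubits alone.\<close>

lemma register_layout:
  assumes "finite R" "RX ` {..n} \<subseteq> R" "card R \<le> N" "n < N"
  obtains loc where "inj_on loc R" "loc ` R \<subseteq> {..<N}" "\<And>p. p \<le> n \<Longrightarrow> loc (RX p) = p"
    "\<And>r. r \<in> R \<Longrightarrow> (\<forall>p\<le>n. r \<noteq> RX p) \<Longrightarrow> n < loc r"
proof -
  let ?A = "R - RX ` {..n}"
  have "card (RX ` {..n}) = n + 1" by (simp add: card_image inj_on_def)
  then have "card ?A = card R - (n + 1)" using assms(2) by (simp add: card_Diff_subset)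
  then have "card ?A \<le> card {n<..<N}" using assms(3,4) by simp
  then obtain f where f: "inj_on f ?A" "f ` ?A \<subseteq> {n<..<N}"
    using card_le_inj[of ?A "{n<..<N}"] assms(1) by auto
  define loc where "loc r = (if r \<in> RX ` {..n} then (case r of RX p \<Rightarrow> p) else f r)" for r
  have l1: "loc (RX p) = p" if "p \<le> n" for p using that by (simp add: loc_def)
  have l2: "loc r = f r" "n < f r" "f r < N" if "r \<in> ?A" for r
    using that f(2) by (auto simp: loc_def)
  have "inj_on loc R"
  proof (rule inj_onI)
    fix r r' assume r: "r \<in> R" "r' \<in> R" "loc r = loc r'"
    show "r = r'"
    proof (cases "r \<in> RX ` {..n}"; cases "r' \<in> RX ` {..n}")
      assume "r \<in> RX ` {..n}" "r' \<in> RX ` {..n}"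
      then show ?thesis using r(3) l1 by auto
    next
      assume "r \<in> RX ` {..n}" "r' \<notin> RX ` {..n}"
      then have "loc r \<le> n" "n < loc r'" using l1 l2[of r'] r(2) by auto
      then show ?thesis using r(3) by simp
    next
      assume "r \<notin> RX ` {..n}" "r' \<in> RX ` {..n}"
      then have "loc r' \<le> n" "n < loc r" using l1 l2[of r] r(1) by auto
      then show ?thesis using r(3) by simp
    next
      assume "r \<notin> RX ` {..n}" "r' \<notin> RX ` {..n}"
      then have "r \<in> ?A" "r' \<in> ?A" using r by auto
      then show ?thesis using r(3) f(1) l2(1) by (auto dest: inj_onD)
    qed
  qed
  moreover have "loc ` R \<subseteq> {..<N}"
  proof
    fix y assume "y \<in> loc ` R"
    then obtain r where r: "r \<in> R" "y = loc r" by blast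
    show "y \<in> {..<N}"
    proof (cases "r \<in> RX ` {..n}")
      case True
      then show ?thesis using r l1 assms(4) by auto
    next
      case False
      then show ?thesis using r l2(1)[of r] l2(3)[of r] by auto
    qed
  qed
  moreover have "n < loc r" if "r \<in> R" "\<forall>p\<le>n. r \<noteq> RX p" for r
  proof -
    have "r \<notin> RX ` {..n}" using that(2) by blast
    then show ?thesis using l2(1)[of r] l2(2)[of r] that(1) by simp
  qed
  ultimately show ?thesis using that l1 by blast
qed

context
  fixes loc :: "reg \<Rightarrow> nat" and R n
  assumes inj: "inj_on loc R" and RX: "RX ` {..n} \<subseteq> R" and loc: "\<And>p. p \<le> n \<Longrightarrow> loc (RX p) = p"
begin

lemma place_st:
  assumes "\<And>p. x p \<Longrightarrow> p \<le> n"
  shows "place loc R (st x off) = x"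
proof
  fix q
  show "place loc R (st x off) q = x q"
  proof (cases "q \<le> n")
    case True
    then have "place loc R (st x off) (loc (RX q)) = x q"
      using place_loc[OF inj, of "RX q"] RX by auto
    then show ?thesis using loc[OF True] by simp
  next
    case False
    then have "\<not> x q" using assms by blast
    moreover have "\<not> place loc R (st x off) q"
    proof
      assume a: "place loc R (st x off) q"
      then obtain r where r: "r \<in> R" "q = loc r" by (auto simp: place_def)
      then have "st x off r" using a place_loc[OF inj r(1)] by simp
      then obtain p where "r = RX p" "x p" by (cases r) auto
      then show False using r(2) loc assms False by auto
    qed
    ultimately show ?thesis by simp
  qed
qed

lemma place_st_unit:
  assumes "RE i \<in> R"
  shows "place loc R (st off (\<lambda>j. j = i)) = off(loc (RE i) := True)"
proof -
  have "st off (\<lambda>j. j = i) = (st off off)(RE i := True)"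
    by (rule ext, rename_tac r, case_tac r) auto
  then show ?thesis using place_upd[OF inj assms] place_st[of "\<lambda>_. False"] by simp
qed

end

text \<open>In use, \<open>\<beta>\<close> is the norm of the amplitudes still to be placed. It is
  real because the splitting trees apply all phases at their leaves.\<close>

definition partial_state ::
  "nat \<Rightarrow> nat \<Rightarrow> (nat \<Rightarrow> nat \<Rightarrow> bool) \<Rightarrow> (nat \<Rightarrow> complex) \<Rightarrow> nat \<Rightarrow> real \<Rightarrow> qstate" where
  "partial_state N n v \<alpha> j \<beta> =
    (\<lambda>x. (\<Sum>i<j. \<alpha> i * ket N (v i) x) + of_real \<beta> * ket N (\<lambda>p. p = n) x)"

text \<open>\<open>None\<close> stands for the share that stays on the flag. If
  \<open>\<beta> = 0\<close>, all these amplitudes vanish and the whole excitation may stay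
  there.\<close>

lemma batch_amplitudes:
  fixes \<alpha> :: "nat \<Rightarrow> complex"
  assumes "\<beta>\<^sup>2 = (\<Sum>i<b. (cmod (\<alpha> i))\<^sup>2) + \<beta>'\<^sup>2"
  obtains a :: "nat option \<Rightarrow> complex" where "(\<Sum>i<b. (cmod (a (Some i)))\<^sup>2) + (cmod (a None))\<^sup>2 = 1"
    "of_real \<beta>' = of_real \<beta> * a None" "\<And>i. i < b \<Longrightarrow> \<alpha> i = of_real \<beta> * a (Some i)"
proof (cases "\<beta> = 0")
  case True
  then have "(\<Sum>i<b. (cmod (\<alpha> i))\<^sup>2) + \<beta>'\<^sup>2 = 0" using assms by simp
  moreover have "(\<Sum>i<b. (cmod (\<alpha> i))\<^sup>2) \<ge> 0" by (simp add: sum_nonneg)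
  ultimately have z: "(\<Sum>i<b. (cmod (\<alpha> i))\<^sup>2) = 0" "\<beta>'\<^sup>2 = 0"
    using zero_le_power2[of \<beta>'] by linarith+
  then have "\<forall>i\<in>{..<b}. (cmod (\<alpha> i))\<^sup>2 = 0" by (subst (asm) sum_nonneg_eq_0_iff) auto
  then show ?thesis
    using that[of "\<lambda>i. if i = None then 1 else 0"] True z(2) by simp
next
  case False
  let ?a = "\<lambda>i. case i of None \<Rightarrow> of_real \<beta>' / of_real \<beta> | Some i \<Rightarrow> \<alpha> i / complex_of_real \<beta>"
  have "(\<Sum>i<b. (cmod (?a (Some i)))\<^sup>2) + (cmod (?a None))\<^sup>2 = (\<Sum>i<b. (cmod (\<alpha> i))\<^sup>2 / \<beta>\<^sup>2) + \<beta>'\<^sup>2 / \<beta>\<^sup>2"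
    by (simp add: norm_divide power_divide)
  also have "\<dots> = ((\<Sum>i<b. (cmod (\<alpha> i))\<^sup>2) + \<beta>'\<^sup>2) / \<beta>\<^sup>2"
    by (simp add: sum_divide_distrib add_divide_distrib)
  also have "\<dots> = 1" using False assms[symmetric] by simp
  finally have 1: "(\<Sum>i<b. (cmod (?a (Some i)))\<^sup>2) + (cmod (?a None))\<^sup>2 = 1" .
  show ?thesis by (rule that[OF 1]) (use False in simp_all)
qed

text \<open>By linearity each branch is followed separately. The tree rooted at the flag spreads the
  flagged branch over the index qubits, and the compiled batch turns index \<open>i\<close> into
  string \<open>j + i\<close>. Finished branches have flag and index off, so the tree fixes them,
  and the batch fixes them by distinctness.\<close>

lemma batch_step:
  assumes P: "batch_prog n b D S R (\<lambda>i. v (j + i)) P"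
    and R: "finite R" "RX ` {..n} \<subseteq> R" "RE ` {..<b} \<subseteq> R" "card R \<le> N" "n < N"
    and deg: "b + 1 \<le> 2 ^ D'"
    and supp: "\<And>i p. i < j + b \<Longrightarrow> v i p \<Longrightarrow> p < n"
    and inj: "\<And>i i'. i < j + b \<Longrightarrow> i' < j + b \<Longrightarrow> i \<noteq> i' \<Longrightarrow> v i \<noteq> v i'"
    and \<beta>: "\<beta>\<^sup>2 = (\<Sum>i<b. (cmod (\<alpha> (j + i)))\<^sup>2) + \<beta>'\<^sup>2"
  obtains gs where "dep gate_qubits gs (15 * D + 4 * D' + 1)" "length gs \<le> 15 * S + 5 * b + 1"
    "\<forall>g\<in>set gs. valid_gate N g"
    "run_gates gs (partial_state N n v \<alpha> j \<beta>) = partial_state N n v \<alpha> (j + b) \<beta>'"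
proof -
  obtain loc where loc: "inj_on loc R" "loc ` R \<subseteq> {..<N}" "\<And>p. p \<le> n \<Longrightarrow> loc (RX p) = p"
    "\<And>r. r \<in> R \<Longrightarrow> (\<forall>p\<le>n. r \<noteq> RX p) \<Longrightarrow> n < loc r"
    by (rule register_layout[OF R(1,2,4,5)]) (rule that)
  obtain a :: "nat option \<Rightarrow> complex" where a:
    "(\<Sum>i<b. (cmod (a (Some i)))\<^sup>2) + (cmod (a None))\<^sup>2 = 1"
    "of_real \<beta>' = of_real \<beta> * a None" "\<And>i. i < b \<Longrightarrow> \<alpha> (j + i) = of_real \<beta> * a (Some i)"
    by (rule batch_amplitudes[OF \<beta>]) (rule that)
  have pr: "prog P D S R" "\<And>i. i < b \<Longrightarrow> run P (st off (\<lambda>j. j = i)) = st (v (j + i)) off"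
    "\<And>x. (\<forall>p. x p \<longrightarrow> p \<le> n) \<Longrightarrow> (\<forall>i<b. x \<noteq> v (j + i)) \<Longrightarrow> run P (st x off) = st x off"
    using P unfolding batch_prog_def by simp_all
  have pr': "supps P \<subseteq> R" "\<And>g. g \<in> set P \<Longrightarrow> owf g" "dep osupp P D" "length P \<le> S"
    using pr(1) unfolding prog_def by simp_all
  have "\<exists>gs. dep gate_qubits gs (15 * D) \<and> length gs \<le> 15 * length P \<and>
    (\<forall>g\<in>set gs. valid_gate N g) \<and>
    (\<forall>s. run_gates gs (ket N (place loc R s)) = ket N (place loc R (run P s)))"
    by (rule compile_prog[OF loc(1,2) pr'(1) _ pr'(3)]) (rule pr'(2))
  then obtain g2 where g2: "dep gate_qubits g2 (15 * D)"
    "length g2 \<le> 15 * length P" "\<forall>g\<in>set g2. valid_gate N g"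
    "\<forall>s. run_gates g2 (ket N (place loc R s)) = ket N (place loc R (run P s))"
    by (elim exE conjE)
  define e where "e i = loc (RE i)" for i
  have RE: "RE i \<in> R" if "i < b" for i using R(3) that by auto
  have e: "n < e i" "e i < N" if "i < b" for i
    using loc(4)[OF RE[OF that]] loc(2) RE[OF that] by (auto simp: e_def)
  have e_inj: "inj_on e {..<b}"
    using loc(1) RE by (auto simp: inj_on_def e_def)
  \<comment> \<open>The head \<open>n\<close> is the flag: it is the excitation to be split, and the
    share \<open>f n\<close> remains on it.\<close>
  define L where "L = n # map e [0..<b]"
  have L: "L \<noteq> []" "length L \<le> 2 ^ D'" "distinct L" "set L \<subseteq> {..<N}" "hd L = n"
    using deg e e_inj R(5) by (auto simp: L_def distinct_map atLeast0LessThan)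
  define f where "f q = a (if q = n then None else Some (the_inv_into {..<b} e q))" for q
  have f: "f n = a None" "f (e i) = a (Some i)" if "i < b" for i
    using e[OF that] that by (simp_all add: f_def the_inv_into_f_f[OF e_inj])
  have fn: "f n = a None" by (simp add: f_def)
  have setL: "set L = insert n (e ` {..<b})" by (auto simp: L_def)
  have nL: "n \<notin> e ` {..<b}" using e by force
  have sumL: "(\<Sum>q\<in>set L. h q) = h n + (\<Sum>i<b. h (e i))" for h :: "nat \<Rightarrow> 'x::comm_monoid_add"
    unfolding setL using nL by (simp add: sum.reindex[OF e_inj])
  have "(\<Sum>q\<in>set L. (cmod (f q))\<^sup>2) = 1"
    unfolding sumL using a(1) f(2) fn by (simp add: add.commute)
  from split_tree[OF L(1-4) this] obtain g1 where g1: "dep gate_qubits g1 (4 * D' + 1)"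
    "length g1 + 4 \<le> 5 * length L" "\<forall>g\<in>set g1. valid_gate N g \<and> gate_qubits g \<subseteq> set L"
    "\<forall>z. (\<forall>q\<in>set L. \<not> z q) \<longrightarrow> run_gates g1 (ket N z) = ket N z \<and>
      run_gates g1 (ket N (z(hd L := True))) = (\<lambda>x. \<Sum>q\<in>set L. f q * ket N (z(q := True)) x)"
    by (elim exE conjE)
  let ?F = "run_gates (g1 @ g2)"
  let ?flag = "\<lambda>p. p = n"
  have emb: "place loc R (st x off) = x" if "\<And>p. x p \<Longrightarrow> p \<le> n" for x
    using place_st[OF loc(1) R(2) loc(3)] that by blast
  have g2k: "run_gates g2 (ket N x) = ket N x" if "\<And>p. x p \<Longrightarrow> p \<le> n" "\<forall>i<b. x \<noteq> v (j + i)" for x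
    using spec[OF g2(4), of "st x off"] pr(3)[of x] that emb[of x] by simp
  have g2e: "run_gates g2 (ket N (off(e i := True))) = ket N (v (j + i))" if i: "i < b" for i
  proof -
    have "p \<le> n" if "v (j + i) p" for p using supp[OF _ that] i by simp
    then show ?thesis
      using spec[OF g2(4), of "st off (\<lambda>j. j = i)"] pr(2)[OF i]
        place_st_unit[OF loc(1) R(2) loc(3) RE[OF i]] emb[of "v (j + i)"] by (simp add: e_def)
  qed
  have old: "?F (ket N (v i)) = ket N (v i)" if i: "i < j" for i
  proof -
    have lt: "p < n" if "v i p" for p using supp[OF _ that] i by simp
    have "\<forall>q\<in>set L. \<not> v i q" using lt e unfolding setL by fastforce
    then have "run_gates g1 (ket N (v i)) = ket N (v i)" using g1(4) by blast
    moreover have "\<forall>i'<b. v i \<noteq> v (j + i')" using inj[of i] i by simp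
    ultimately show ?thesis using g2k[of "v i"] lt by (simp add: less_imp_le)
  qed
  have flag: "?F (ket N ?flag) = (\<lambda>x. (\<Sum>i<b. a (Some i) * ket N (v (j + i)) x) + a None * ket N ?flag x)"
  proof -
    have fl: "off(n := True) = ?flag" by (simp add: fun_eq_iff)
    have "run_gates g1 (ket N (off(hd L := True))) =
        (\<lambda>x. \<Sum>q\<in>set L. f q * ket N (off(q := True)) x)"
      by (rule conjunct2[OF mp[OF spec[OF g1(4)]]]) simp
    then have "?F (ket N ?flag) = (\<lambda>x. \<Sum>q\<in>set L. f q * run_gates g2 (ket N (off(q := True))) x)"
      unfolding L(5) fl by (simp add: apply_gates_sum)
    also have "\<dots> = (\<lambda>x. f n * run_gates g2 (ket N ?flag) x +
        (\<Sum>i<b. f (e i) * run_gates g2 (ket N (off(e i := True))) x))"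
      unfolding sumL fl ..
    also have g2f: "run_gates g2 (ket N ?flag) = ket N ?flag"
    proof (rule g2k)
      show "\<forall>i<b. ?flag \<noteq> v (j + i)"
      proof (intro allI impI notI)
        fix i assume i: "i < b" and eq: "?flag = v (j + i)"
        have "v (j + i) n" using fun_cong[OF eq, of n] by simp
        then show False using supp[of "j + i" n] i by simp
      qed
    qed simp
    also have "(\<lambda>x. f n * ket N ?flag x +
        (\<Sum>i<b. f (e i) * run_gates g2 (ket N (off(e i := True))) x)) =
      (\<lambda>x. (\<Sum>i<b. a (Some i) * ket N (v (j + i)) x) + a None * ket N ?flag x)"
    proof
      fix x
      have "(\<Sum>i<b. f (e i) * run_gates g2 (ket N (off(e i := True))) x) =
          (\<Sum>i<b. a (Some i) * ket N (v (j + i)) x)"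
        by (rule sum.cong[OF refl]) (simp only: f(2) g2e lessThan_iff)
      then show "f n * ket N ?flag x +
          (\<Sum>i<b. f (e i) * run_gates g2 (ket N (off(e i := True))) x) =
        (\<Sum>i<b. a (Some i) * ket N (v (j + i)) x) + a None * ket N ?flag x"
        by (simp only: fn add.commute)
    qed
    finally show ?thesis .
  qed
  have "?F (partial_state N n v \<alpha> j \<beta>) =
      (\<lambda>x. (\<Sum>i<j. \<alpha> i * ?F (ket N (v i)) x) + of_real \<beta> * ?F (ket N ?flag) x)"
    unfolding partial_state_def apply_gates_add apply_gates_sum apply_gates_scale ..
  also have "\<dots> = partial_state N n v \<alpha> (j + b) \<beta>'"
  proof
    fix x
    have "(\<Sum>i<j + b. \<alpha> i * ket N (v i) x) =
        (\<Sum>i<j. \<alpha> i * ket N (v i) x) + (\<Sum>i<b. \<alpha> (j + i) * ket N (v (j + i)) x)"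
      using sum.atLeastLessThan_concat[of 0 j "j + b" "\<lambda>i. \<alpha> i * ket N (v i) x"]
        sum.shift_bounds_nat_ivl[of "\<lambda>i. \<alpha> i * ket N (v i) x" 0 j b]
      by (simp add: atLeast0LessThan add.commute)
    then show "(\<Sum>i<j. \<alpha> i * ?F (ket N (v i)) x) + of_real \<beta> * ?F (ket N ?flag) x =
        partial_state N n v \<alpha> (j + b) \<beta>' x"
      by (simp add: partial_state_def old flag a(2,3) sum_distrib_left distrib_left mult.assoc
          del: fold_append)
  qed
  finally have 4: "?F (partial_state N n v \<alpha> j \<beta>) = partial_state N n v \<alpha> (j + b) \<beta>'" .
  have 1: "dep gate_qubits (g1 @ g2) (15 * D + 4 * D' + 1)"
    using dep_seq[OF g1(1) g2(1)] by (simp add: add.commute add.left_commute)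
  have 2: "length (g1 @ g2) \<le> 15 * S + 5 * b + 1" using g1(2) g2(2) pr'(4) by (simp add: L_def)
  have 3: "\<forall>g\<in>set (g1 @ g2). valid_gate N g" using g1(3) g2(3) by auto
  show ?thesis by (rule that[OF 1 2 3 4])
qed

text \<open>One gate raises the flag, then \<open>T\<close> rounds follow. The last rounds may be
  short or empty, which is why \<open>batch\<close> is demanded for every \<open>b\<close> up to
  \<open>B\<close>, including 0.\<close>

lemma iterate_batches:
  fixes \<alpha> :: "nat \<Rightarrow> complex" and q :: "nat \<Rightarrow> bool list"
  assumes n: "n < N" and B: "B \<ge> 1" and deg: "B + 1 \<le> 2 ^ D'"
    and q: "\<forall>i<d. length (q i) = n" "\<forall>i<d. \<forall>j<d. i \<noteq> j \<longrightarrow> q i \<noteq> q j"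
    and \<alpha>: "(\<Sum>i<d. (cmod (\<alpha> i))\<^sup>2) = 1"
    and batch: "\<And>v b. b \<le> B \<Longrightarrow> (\<And>i p. i < b \<Longrightarrow> v i p \<Longrightarrow> p < n) \<Longrightarrow>
        (\<And>i j. i < b \<Longrightarrow> j < b \<Longrightarrow> i \<noteq> j \<Longrightarrow> v i \<noteq> v j) \<Longrightarrow>
        \<exists>P R. batch_prog n b D S R v P \<and> finite R \<and> RX ` {..n} \<subseteq> R \<and> RE ` {..<b} \<subseteq> R \<and> card R \<le> N"
    and T: "d \<le> T * B"
  shows "\<exists>C. valid_circuit N C \<and>
    run_circuit C (basis_state (replicate N False)) =
      (\<lambda>x. \<Sum>i<d. \<alpha> i * basis_state (q i @ replicate (N - n) False) x) \<and>
    circuit_depth C \<le> 1 + T * (15 * D + 4 * D' + 1) \<and>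
    circuit_size C \<le> 1 + T * (15 * S + 5 * B + 1)"
proof -
  define v where "v i p = (p < n \<and> q i ! p)" for i p
  have supp: "p < n" if "v i p" for i p using that by (simp add: v_def)
  have inj: "v i \<noteq> v i'" if ii: "i < d" "i' < d" "i \<noteq> i'" for i i'
  proof
    assume eq: "v i = v i'"
    have "q i ! p = q i' ! p" if "p < n" for p
      using fun_cong[OF eq, of p] that by (simp add: v_def)
    then have "q i = q i'" using q(1) ii by (simp add: list_eq_iff_nth_eq)
    then show False using q(2) ii by blast
  qed
  define \<beta> where "\<beta> j = sqrt (\<Sum>i=j..<d. (cmod (\<alpha> i))\<^sup>2)" for j
  have \<beta>2: "(\<beta> j)\<^sup>2 = (\<Sum>i=j..<d. (cmod (\<alpha> i))\<^sup>2)" for j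
    by (simp add: \<beta>_def sum_nonneg)
  have step: "\<exists>gs. dep gate_qubits gs (15 * D + 4 * D' + 1) \<and> length gs \<le> 15 * S + 5 * B + 1 \<and>
      (\<forall>g\<in>set gs. valid_gate N g) \<and> run_gates gs (partial_state N n v \<alpha> j (\<beta> j)) =
        partial_state N n v \<alpha> (min d (j + B)) (\<beta> (min d (j + B)))" if j: "j \<le> d" for j
  proof -
    define b where "b = min d (j + B) - j"
    have b: "b \<le> B" "j + b = min d (j + B)" "j + b \<le> d" using j by (auto simp: b_def)
    have "\<exists>P R. batch_prog n b D S R (\<lambda>i. v (j + i)) P \<and> finite R \<and> RX ` {..n} \<subseteq> R \<and>
        RE ` {..<b} \<subseteq> R \<and> card R \<le> N"
      using b(3) by (intro batch[OF b(1)] supp inj) auto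
    then obtain P R where PR: "batch_prog n b D S R (\<lambda>i. v (j + i)) P" "finite R" "RX ` {..n} \<subseteq> R"
        "RE ` {..<b} \<subseteq> R" "card R \<le> N" by (elim exE conjE)
    have "(\<Sum>i=j..<d. (cmod (\<alpha> i))\<^sup>2) = (\<Sum>i=j..<j + b. (cmod (\<alpha> i))\<^sup>2) + (\<Sum>i=j + b..<d. (cmod (\<alpha> i))\<^sup>2)"
      using b(3) by (simp add: sum.atLeastLessThan_concat)
    also have "(\<Sum>i=j..<j + b. (cmod (\<alpha> i))\<^sup>2) = (\<Sum>i<b. (cmod (\<alpha> (j + i)))\<^sup>2)"
      using sum.shift_bounds_nat_ivl[of "\<lambda>i. (cmod (\<alpha> i))\<^sup>2" 0 j b]
      by (simp add: atLeast0LessThan add.commute)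
    finally have bb: "(\<beta> j)\<^sup>2 = (\<Sum>i<b. (cmod (\<alpha> (j + i)))\<^sup>2) + (\<beta> (j + b))\<^sup>2" by (simp add: \<beta>2)
    have deg': "b + 1 \<le> 2 ^ D'" using deg b(1) by simp
    show ?thesis
    proof (rule batch_step[OF PR n deg' _ _ bb])
      fix gs assume gs: "dep gate_qubits gs (15 * D + 4 * D' + 1)" "length gs \<le> 15 * S + 5 * b + 1"
        "\<forall>g\<in>set gs. valid_gate N g"
        "run_gates gs (partial_state N n v \<alpha> j (\<beta> j)) = partial_state N n v \<alpha> (j + b) (\<beta> (j + b))"
      have "length gs \<le> 15 * S + 5 * B + 1" using gs(2) b(1) by simp
      then show ?thesis using gs(1,3,4) unfolding b(2) by blast
    qed (use supp inj b(3) in auto)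
  qed
  have iter: "\<exists>gs. dep gate_qubits gs (1 + t * (15 * D + 4 * D' + 1)) \<and>
      length gs \<le> 1 + t * (15 * S + 5 * B + 1) \<and> (\<forall>g\<in>set gs. valid_gate N g) \<and>
      run_gates gs (ket N off) = partial_state N n v \<alpha> (min d (t * B)) (\<beta> (min d (t * B)))"
    for t
  proof (induction t)
    case 0
    have "\<beta> 0 = 1" using \<alpha> by (simp add: \<beta>_def atLeast0LessThan)
    moreover have "off(n := True) = (\<lambda>p. p = n)" by (simp add: fun_eq_iff)
    ultimately show ?case using n
      by (intro exI[of _ "[G1 pauliX n]"])
        (simp add: dep_single unitary_pauliX apply_pauliX_ket partial_state_def del: apply_gate.simps)
  next
    case (Suc t)
    then obtain g1 where g1: "dep gate_qubits g1 (1 + t * (15 * D + 4 * D' + 1))"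
      "length g1 \<le> 1 + t * (15 * S + 5 * B + 1)" "\<forall>g\<in>set g1. valid_gate N g"
      "run_gates g1 (ket N off) = partial_state N n v \<alpha> (min d (t * B)) (\<beta> (min d (t * B)))"
      by (elim exE conjE)
    from step[of "min d (t * B)", OF min.cobounded1] obtain g2 where g2: "dep gate_qubits g2 (15 * D + 4 * D' + 1)"
      "length g2 \<le> 15 * S + 5 * B + 1" "\<forall>g\<in>set g2. valid_gate N g"
      "run_gates g2 (partial_state N n v \<alpha> (min d (t * B)) (\<beta> (min d (t * B)))) =
        partial_state N n v \<alpha> (min d (min d (t * B) + B)) (\<beta> (min d (min d (t * B) + B)))"
      by (elim exE conjE)
    have m: "min d (min d (t * B) + B) = min d (Suc t * B)" by auto
    have "dep gate_qubits (g1 @ g2) (1 + Suc t * (15 * D + 4 * D' + 1))"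
      using dep_seq[OF g1(1) g2(1)] by (simp add: algebra_simps)
    moreover have "length (g1 @ g2) \<le> 1 + Suc t * (15 * S + 5 * B + 1)" using g1(2) g2(2) by simp
    ultimately show ?case using g1(3,4) g2(3,4) unfolding m by (intro exI[of _ "g1 @ g2"]) auto
  qed
  have "min d (T * B) = d" using T by simp
  \<comment> \<open>No amplitude is left on the flagged state, so the flag qubit ends in 0 and
    counts as one of the ancillas.\<close>
  moreover have "\<beta> d = 0" by (simp add: \<beta>_def)
  ultimately obtain gs where gs: "dep gate_qubits gs (1 + T * (15 * D + 4 * D' + 1))"
      "length gs \<le> 1 + T * (15 * S + 5 * B + 1)" "\<forall>g\<in>set gs. valid_gate N g"
      "run_gates gs (ket N off) = partial_state N n v \<alpha> d 0"
    using iter[of T] by auto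
  from layering[OF gs(1), of N] gs(3) obtain C where C: "valid_circuit N C"
    "circuit_depth C \<le> 1 + T * (15 * D + 4 * D' + 1)" "circuit_size C = length gs"
    "\<forall>psi. run_circuit C psi = run_gates gs psi"
    by auto
  have z: "ket N off = basis_state (replicate N False)"
    by (simp add: ket_def map_replicate_const)
  have k: "ket N (v i) = basis_state (q i @ replicate (N - n) False)" if "i < d" for i
  proof -
    have "map (v i) [0..<N] = q i @ replicate (N - n) False"
      using q(1) that n by (intro nth_equalityI) (auto simp: v_def nth_append)
    then show ?thesis by (simp add: ket_def)
  qed
  have "run_circuit C (basis_state (replicate N False)) =
      (\<lambda>x. \<Sum>i<d. \<alpha> i * basis_state (q i @ replicate (N - n) False) x)"
    using C(4) gs(4) k unfolding z by (simp add: partial_state_def)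
  then show ?thesis using C(1-3) gs(2) by auto
qed

section \<open>Choice of the parameters\<close>

text \<open>The iteration with \<open>B = 1\<close> and \<open>T = d\<close>; the tree on flag and
  one index qubit needs only \<open>D' = 1\<close>. The gate raising the flag is absorbed by
  \<open>d >= 1\<close>.\<close>

lemma prepare_singly:
  fixes \<alpha> :: "nat \<Rightarrow> complex" and q :: "nat \<Rightarrow> bool list"
  assumes n: "n \<ge> 1" and d: "d \<ge> 1" and m: "m \<ge> 6 * n" and D: "n + 1 \<le> 2 ^ D"
    and q: "\<forall>i<d. length (q i) = n" "\<forall>i<d. \<forall>j<d. i \<noteq> j \<longrightarrow> q i \<noteq> q j"
    and \<alpha>: "(\<Sum>i<d. (cmod (\<alpha> i))\<^sup>2) = 1"
  shows "\<exists>C. valid_circuit (n + m) C \<and>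
    run_circuit C (basis_state (replicate (n + m) False)) =
      (\<lambda>x. \<Sum>i<d. \<alpha> i * basis_state (q i @ replicate m False) x) \<and>
    circuit_depth C \<le> d * (90 * D + 96) \<and> circuit_size C \<le> 187 * n * d"
proof -
  have "\<exists>C. valid_circuit (n + m) C \<and>
    run_circuit C (basis_state (replicate (n + m) False)) =
      (\<lambda>x. \<Sum>i<d. \<alpha> i * basis_state (q i @ replicate (n + m - n) False) x) \<and>
    circuit_depth C \<le> 1 + d * (15 * (6 * D + 6) + 4 * 1 + 1) \<and>
    circuit_size C \<le> 1 + d * (15 * (8 * n + 4) + 5 * 1 + 1)"
  proof (rule iterate_batches[OF _ _ _ q \<alpha>])
    fix v :: "nat \<Rightarrow> nat \<Rightarrow> bool" and b
    assume b: "b \<le> 1" and v: "\<And>i p. i < b \<Longrightarrow> v i p \<Longrightarrow> p < n"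
    show "\<exists>P R. batch_prog n b (6 * D + 6) (8 * n + 4) R v P \<and> finite R \<and> RX ` {..n} \<subseteq> R \<and>
        RE ` {..<b} \<subseteq> R \<and> card R \<le> n + m"
    proof (cases "b = 0")
      case True
      have "batch_prog n b (6 * D + 6) (8 * n + 4) (RX ` {..n}) v []"
        using True by (simp add: batch_prog_def prog_Nil)
      moreover have "card (RX ` {..n}) \<le> n + m"
        using card_image_le[of "{..n}" RX] n m by simp
      ultimately show ?thesis using True
        by (intro exI[of _ "[]"] exI[of _ "RX ` {..n}"]) simp
    next
      case False
      then have b1: "b = 1" using b by simp
      then have v0: "p < n" if "v 0 p" for p using v[OF _ that] by simp
      show ?thesis
      proof (rule small_batch[OF D v0])
        fix P R assume P: "prog P (6 * D + 6) (8 * n + 4) R" "finite R" "RX ` {..n} \<subseteq> R" "RE 0 \<in> R"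
          "card R \<le> 3 * n + 3"
          "run P (st off (\<lambda>j. j = 0)) = st (v 0) off"
          "\<And>x. (\<forall>p. x p \<longrightarrow> p \<le> n) \<Longrightarrow> x \<noteq> v 0 \<Longrightarrow> run P (st x off) = st x off"
        have "batch_prog n b (6 * D + 6) (8 * n + 4) R v P"
          using P(1,6,7) b1 by (simp add: batch_prog_def)
        moreover have "RE ` {..<b} \<subseteq> R" using P(4) b1 by auto
        moreover have "card R \<le> n + m" using P(5) n m by simp
        ultimately show ?thesis using P(2,3) by (intro exI[of _ P] exI[of _ R]) simp
      qed
    qed
  qed (use n m in simp_all)
  then obtain C where C: "valid_circuit (n + m) C"
    "run_circuit C (basis_state (replicate (n + m) False)) =
      (\<lambda>x. \<Sum>i<d. \<alpha> i * basis_state (q i @ replicate (n + m - n) False) x)"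
    "circuit_depth C \<le> 1 + d * (15 * (6 * D + 6) + 4 * 1 + 1)"
    "circuit_size C \<le> 1 + d * (15 * (8 * n + 4) + 5 * 1 + 1)"
    by (elim exE conjE)
  have "1 + d * (15 * (6 * D + 6) + 4 * 1 + 1) \<le> d * (90 * D + 96)"
    using d by (simp add: algebra_simps)
  moreover have "1 + d * (15 * (8 * n + 4) + 5 * 1 + 1) \<le> 187 * n * d"
  proof -
    have "d \<le> n * d" using n by simp
    moreover have "1 + d * (15 * (8 * n + 4) + 5 * 1 + 1) = 1 + 120 * (n * d) + 66 * d"
      "187 * n * d = 187 * (n * d)" by (simp_all add: algebra_simps)
    ultimately show ?thesis using d by linarith
  qed
  ultimately show ?thesis using C by (intro exI[of _ C]) simp
qed

lemma prepare_batched: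
  fixes \<alpha> :: "nat \<Rightarrow> complex" and q :: "nat \<Rightarrow> bool list"
  assumes m: "m \<ge> 1" and k: "k \<ge> 1" "n < K * k" "k \<le> D" "K \<le> 2 ^ D"
    and B: "B \<ge> 1" "B + 1 \<le> 2 ^ D" "d \<le> T * B"
    and anc: "K * k + B + 4 * (B * K) + 6 * (K * k * 2 ^ k) \<le> n + m"
    and q: "\<forall>i<d. length (q i) = n" "\<forall>i<d. \<forall>j<d. i \<noteq> j \<longrightarrow> q i \<noteq> q j"
    and \<alpha>: "(\<Sum>i<d. (cmod (\<alpha> i))\<^sup>2) = 1"
  shows "\<exists>C. valid_circuit (n + m) C \<and>
    run_circuit C (basis_state (replicate (n + m) False)) =
      (\<lambda>x. \<Sum>i<d. \<alpha> i * basis_state (q i @ replicate m False) x) \<and>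
    circuit_depth C \<le> 1 + T * (514 * D + 391) \<and>
    circuit_size C \<le> 1 + T * (15 * (18 * (B * K) + 18 * (K * k * 2 ^ k)) + 5 * B + 1)"
proof -
  let ?S = "18 * (B * K) + 18 * (K * k * 2 ^ k)"
  have "\<exists>C. valid_circuit (n + m) C \<and>
    run_circuit C (basis_state (replicate (n + m) False)) =
      (\<lambda>x. \<Sum>i<d. \<alpha> i * basis_state (q i @ replicate (n + m - n) False) x) \<and>
    circuit_depth C \<le> 1 + T * (15 * (34 * D + 26) + 4 * D + 1) \<and>
    circuit_size C \<le> 1 + T * (15 * ?S + 5 * B + 1)"
  proof (rule iterate_batches[OF _ B(1,2) q \<alpha> _ B(3)])
    show "n < n + m" using m by simp
    fix v :: "nat \<Rightarrow> nat \<Rightarrow> bool" and b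
    assume b: "b \<le> B" and v: "\<And>i p. i < b \<Longrightarrow> v i p \<Longrightarrow> p < n"
      "\<And>i j. i < b \<Longrightarrow> j < b \<Longrightarrow> i \<noteq> j \<Longrightarrow> v i \<noteq> v j"
    interpret chunks n k K b D v
      using k B(2) b v by unfold_locales (auto intro: less_imp_le)
    have bK: "b * K \<le> B * K" using b by simp
    show "\<exists>P R. batch_prog n b (34 * D + 26) ?S R v P \<and> finite R \<and> RX ` {..n} \<subseteq> R \<and>
        RE ` {..<b} \<subseteq> R \<and> card R \<le> n + m"
    proof (rule batch)
      fix P assume P: "prog P (34 * D + 26) (18 * (b * K) + 18 * (K * k * 2 ^ k)) RR"
        "\<And>i. i < b \<Longrightarrow> run P (st off (\<lambda>j. j = i)) = st (v i) off"
        "\<And>x. (\<forall>p. x p \<longrightarrow> p \<le> n) \<Longrightarrow> (\<forall>i<b. x \<noteq> v i) \<Longrightarrow> run P (st x off) = st x off"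
      have "prog P (34 * D + 26) ?S RR" using P(1) by (rule prog_mono) (use bK in simp_all)
      then have "batch_prog n b (34 * D + 26) ?S RR v P" using P(2,3) by (simp add: batch_prog_def)
      moreover have "card RR \<le> n + m" using card_RR bK b anc by linarith
      ultimately show ?thesis using fin(12) RX_RE_mem by (intro exI[of _ P] exI[of _ RR]) simp
    qed
  qed
  then show ?thesis by (simp add: algebra_simps)
qed

text \<open>Each estimate below meets only one of the two summands of a claimed bound; this pads it
  with the other and raises the constant to the common one.\<close>

lemma absorb:
  fixes t c e x y :: real
  assumes "c \<le> e" "0 \<le> x" "0 \<le> y" "t \<le> c * x \<or> t \<le> c * y" "0 \<le> c"
  shows "t \<le> e * (x + y)"
proof -
  have "c * x \<le> c * (x + y)" "c * y \<le> c * (x + y)" using assms by (intro mult_left_mono; simp)+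
  moreover have "c * (x + y) \<le> e * (x + y)" using assms by (intro mult_right_mono) simp_all
  ultimately show ?thesis using assms(4) by linarith
qed

lemma log2_values: "log 2 4 = (2 :: real)" "log 2 8192 = (13 :: real)"
  using log_pow_cancel[of "2 :: real" 2] log_pow_cancel[of "2 :: real" 13] by simp_all

lemma exists_pow2_ge:
  assumes "M \<ge> (1::nat)"
  obtains D where "M \<le> 2 ^ D" "real D \<le> log 2 (real M) + 1"
proof -
  define D where "D = (LEAST D. M \<le> 2 ^ D)"
  have "M \<le> 2 ^ M" using less_exp[of M] by simp
  then have 1: "M \<le> 2 ^ D" unfolding D_def by (rule LeastI)
  have "real D \<le> log 2 (real M) + 1"
  proof (cases D)
    case 0
    then show ?thesis using assms by simp
  next
    case (Suc D0)
    then have "\<not> M \<le> 2 ^ D0" using not_less_Least[of D0 "\<lambda>D. M \<le> 2 ^ D"] by (simp add: D_def)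
    then have "2 ^ D0 \<le> real M" by (metis nat_le_linear of_nat_le_iff of_nat_numeral of_nat_power)
    then have "real D0 \<le> log 2 (real M)" by (rule le_log_of_power) simp
    then show ?thesis using Suc by simp
  qed
  with 1 show ?thesis by (rule that)
qed

lemma exists_pow4_bracket:
  assumes "x \<ge> (4::nat)"
  obtains k where "k \<ge> 1" "4 ^ k \<le> x" "x < 4 ^ (k + 1)"
proof -
  obtain k where k: "4 ^ k \<le> x" "x < 4 ^ (k + 1)" using ex_power_ivl1[of 4 x] assms by auto
  moreover have "k \<noteq> 0" using k assms by (intro notI) simp
  ultimately show ?thesis using that[of k] by simp
qed

text \<open>Needed for the block length: \<open>4 ^ k <= d <= 2 ^ n\<close> implies that a block is
  no longer than the string, \<open>k <= n\<close>.\<close>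

lemma card_distinct_strings:
  fixes q :: "nat \<Rightarrow> bool list"
  assumes "\<forall>i<d. length (q i) = n" "\<forall>i<d. \<forall>j<d. i \<noteq> j \<longrightarrow> q i \<noteq> q j"
  shows "d \<le> 2 ^ n"
proof -
  have "inj_on q {..<d}" using assms(2) by (auto simp: inj_on_def)
  then have "d = card (q ` {..<d})" by (simp add: card_image)
  also have "\<dots> \<le> card {xs :: bool list. set xs \<subseteq> UNIV \<and> length xs = n}"
    using assms(1) finite_lists_length_eq[of "UNIV :: bool set" n] by (intro card_mono) auto
  also have "\<dots> = 2 ^ n" using card_lists_length_eq[of "UNIV :: bool set" n] by simp
  finally show ?thesis .
qed

text \<open>The regime of few ancillas per qubit or few basis states: with \<open>m / n\<close> or \<open>d\<close> bounded,
  the claimed size is linear in \<open>n d\<close>, so the basis states can be added one at a time.\<close>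

lemma singly_bounds:
  fixes n d m D :: nat
  assumes n: "n \<ge> 1" and d: "d \<ge> 2" and m: "m \<ge> 6 * n" and few: "m div n < 8192 \<or> d < 4"
    and D: "real D \<le> log 2 (real (n + 1)) + 1"
  shows "real (d * (90 * D + 96)) \<le> 100000000 *
      (real n * real d * log 2 (real m) / (real m * log 2 (real m / real n)) + log 2 (real n * real d))"
    "real (187 * n * d) \<le> 100000000 *
      (real n * real d / log 2 (real m / real n) + real n * real d / log 2 (real d))"
proof -
  define lr where "lr = log 2 (real m / real n)"
  have mn: "real m \<ge> 6 * real n" "real n \<ge> 1" "real d \<ge> 2" "real m \<ge> 6" using n m d by simp_all
  have "real m / real n \<ge> 6" using mn by (simp add: field_simps)
  then have lr: "lr \<ge> 1" unfolding lr_def by (subst le_log_iff) simp_all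
  have ld: "log 2 (real d) \<ge> 1" using mn by (subst le_log_iff) simp_all
  have ln: "log 2 (real n) \<ge> 0" using mn by simp
  have lnd: "log 2 (real n * real d) = log 2 (real n) + log 2 (real d)"
    using mn by (simp add: log_mult)
  have lm: "log 2 (real m) \<ge> 1" "log 2 (real n) \<le> log 2 (real m)"
    using mn by (subst le_log_iff, simp_all)
  have "log 2 (real (n + 1)) \<le> log 2 (2 * real n)" using mn by simp
  also have "\<dots> = 1 + log 2 (real n)" using mn by (simp add: log_mult)
  finally have D2: "real D \<le> log 2 (real n) + 2" using D by simp
  have pos: "0 \<le> real n * real d * log 2 (real m) / (real m * lr)" "0 \<le> real n * real d / lr"
    "0 \<le> real n * real d / log 2 (real d)"
    using lr lm ld by simp_all
  \<comment> \<open>Here 13 is the binary logarithm of the threshold 8192.\<close>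
  have small: "real m / real n \<le> 8192 \<and> lr \<le> 13" if "\<not> d < 4"
  proof -
    have "m div n < 8192" using few that by blast
    then have "m < 8192 * n" using n by (simp add: div_less_iff_less_mult mult.commute)
    then have "real m < 8192 * real n" by (metis of_nat_less_iff of_nat_mult of_nat_numeral)
    then have "real m / real n \<le> 8192" using mn by (simp add: field_simps)
    moreover from this have "lr \<le> log 2 8192" unfolding lr_def using mn by simp
    ultimately show ?thesis by (simp add: log2_values)
  qed
  show "real (d * (90 * D + 96)) \<le> 100000000 *
      (real n * real d * log 2 (real m) / (real m * log 2 (real m / real n)) + log 2 (real n * real d))"
    unfolding lr_def[symmetric]
  proof (cases "d < 4")
    case True
    \<comment> \<open>A bounded number of rounds of depth \<open>O(log n)\<close>, absorbed by the
      summand \<open>log (n d)\<close>.\<close>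
    have "real d * (90 * real D + 96) \<le> 3 * (90 * (log 2 (real n) + 2) + 96)"
      using True D2 ln by (intro mult_mono) simp_all
    also have "\<dots> \<le> 1098 * log 2 (real n * real d)" unfolding lnd using ln ld by simp
    finally show "real (d * (90 * D + 96)) \<le> 100000000 *
      (real n * real d * log 2 (real m) / (real m * lr) + log 2 (real n * real d))"
      using pos(1) lnd ln ld by (intro absorb[of 1098]) simp_all
  next
    case False
    \<comment> \<open>With \<open>106496 = 8192 * 13\<close>, the first summand is at least a
      constant fraction of \<open>d * log m\<close>, the cost of \<open>d\<close> rounds of depth
      \<open>O(log m)\<close>.\<close>
    have "real m * lr \<le> (8192 * real n) * 13"
      using small[OF False] lr mn by (intro mult_mono) (simp_all add: field_simps)
    then have "real n * real d * log 2 (real m) / ((8192 * real n) * 13) \<le>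
        real n * real d * log 2 (real m) / (real m * lr)"
      using mn lr lm by (intro divide_left_mono mult_pos_pos) simp_all
    then have 1: "real d * log 2 (real m) \<le> 106496 * (real n * real d * log 2 (real m) / (real m * lr))"
      using mn by (simp add: field_simps)
    have "90 * real D + 96 \<le> 366 * log 2 (real m)" using D2 lm by simp
    then have "real d * (90 * real D + 96) \<le> real d * (366 * log 2 (real m))"
      by (rule mult_left_mono) simp
    also have "\<dots> \<le> 366 * (106496 * (real n * real d * log 2 (real m) / (real m * lr)))"
      by (subst mult.left_commute) (intro mult_left_mono 1, simp)
    finally show "real (d * (90 * D + 96)) \<le> 100000000 *
      (real n * real d * log 2 (real m) / (real m * lr) + log 2 (real n * real d))"
      using pos(1) lnd ln ld by (intro absorb[of "366 * 106496"]) (simp_all only: mult.assoc of_nat_mult of_nat_add of_nat_numeral, simp_all)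
  qed
  show "real (187 * n * d) \<le> 100000000 *
      (real n * real d / log 2 (real m / real n) + real n * real d / log 2 (real d))"
    unfolding lr_def[symmetric]
  proof (cases "d < 4")
    case True
    then have "log 2 (real d) \<le> log 2 4" using mn by simp
    then have "log 2 (real d) \<le> 2" by (simp add: log2_values)
    then have "real n * real d / 2 \<le> real n * real d / log 2 (real d)"
      using ld by (intro divide_left_mono mult_pos_pos) (use mn in simp_all)
    then show "real (187 * n * d) \<le> 100000000 * (real n * real d / lr + real n * real d / log 2 (real d))"
      using pos(2,3) by (intro absorb[of 374]) simp_all
  next
    case False
    then have "real n * real d / 13 \<le> real n * real d / lr"
      using small lr by (intro divide_left_mono mult_pos_pos) (use mn in simp_all)
    then show "real (187 * n * d) \<le> 100000000 * (real n * real d / lr + real n * real d / log 2 (real d))"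
      using pos(2,3) by (intro absorb[of 2431]) simp_all
  qed
qed

text \<open>\<open>B\<close> is the ancilla budget \<open>r * k / 40\<close>, capped by
  \<open>d\<close>. The table of a batch costs no more than its strings up to a factor
  (\<open>k2B\<close>), so a batch has size \<open>O(B K)\<close>; with
  \<open>K * k <= 2 * n\<close> and \<open>T * B <= 2 * d\<close> the total is
  \<open>O(n d / k)\<close>. For the depth, either \<open>B = d\<close> and \<open>T = 2\<close>, or
  \<open>T\<close> is \<open>O(d / (r k))\<close>.\<close>

lemma batched_parameters:
  fixes n d m :: nat
  assumes n: "n \<ge> 1" and d: "d \<ge> 4" "d \<le> 2 ^ n" and m: "m div n \<ge> 8192"
  obtains k K B T D where "k \<ge> 1" "n < K * k" "k \<le> D" "K \<le> 2 ^ D"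
    "B \<ge> 1" "B + 1 \<le> 2 ^ D" "d \<le> T * B"
    "K * k + B + 4 * (B * K) + 6 * (K * k * 2 ^ k) \<le> n + m"
    "real (1 + T * (514 * D + 391)) \<le> 100000000 *
      (real n * real d * log 2 (real m) / (real m * log 2 (real m / real n)) + log 2 (real n * real d))"
    "real (1 + T * (15 * (18 * (B * K) + 18 * (K * k * 2 ^ k)) + 5 * B + 1)) \<le> 100000000 *
      (real n * real d / log 2 (real m / real n) + real n * real d / log 2 (real d))"
proof -
  define r where "r = m div n"
  have r: "r \<ge> 8192" using m by (simp add: r_def)
  have rn: "r * n \<le> m" unfolding r_def by simp
  have mr: "m \<le> 2 * (r * n)"
  proof -
    have "m = r * n + m mod n" by (simp add: r_def)
    moreover have "m mod n < n" using n by simp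
    moreover have "n \<le> r * n" using r by simp
    ultimately show ?thesis by linarith
  qed
  have nm: "8192 * n \<le> m" using rn mult_le_mono1[OF r, of n] by linarith
  have rd4: "min r d \<ge> 4" using r d by simp
  obtain k where k: "k \<ge> 1" "4 ^ k \<le> min r d" "min r d < 4 ^ (k + 1)"
    by (rule exists_pow4_bracket[OF rd4]) (rule that)
  have p4: "2 ^ k * 2 ^ k = (4 ^ k :: nat)" by (simp flip: power_mult_distrib)
  have "2 ^ (2 * k) \<le> (2 ^ n :: nat)" using k(2) d(2) by (simp add: power_mult)
  then have kn: "k \<le> n" by simp
  have kk: "k \<le> 2 ^ k" using less_exp[of k] by simp
  \<comment> \<open>Either \<open>64 <= 2 ^ k\<close>, and then
    \<open>64 * 2 ^ k <= 4 ^ k <= r\<close>, or the threshold 8192 is large enough by itself, being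
    at least \<open>64 * 64\<close>.\<close>
  have p64: "64 * 2 ^ k \<le> r"
  proof (cases "64 \<le> (2 ^ k :: nat)")
    case True
    then have "64 * 2 ^ k \<le> 2 ^ k * (2 ^ k :: nat)" by (rule mult_le_mono1)
    then show ?thesis using p4 k(2) by simp
  qed (use r in simp)
  have pd: "2 ^ k \<le> d" "k * 2 ^ k \<le> d"
  proof -
    have "k * 2 ^ k \<le> 2 ^ k * 2 ^ k" using kk by (rule mult_le_mono1)
    then show "k * 2 ^ k \<le> d" using p4 k(2) by simp
    then show "2 ^ k \<le> d" using k(1) by (metis le_trans mult_le_mono1 mult_1)
  qed
  \<comment> \<open>The added 1 makes the blocks cover the flag position \<open>n\<close> even if
    \<open>k\<close> divides \<open>n\<close>.\<close>
  define K where "K = n div k + 1"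
  have Kk: "n < K * k" "K * k \<le> 2 * n"
  proof -
    have "n = n div k * k + n mod k" "n mod k < k" using k(1) by simp_all
    moreover have "K * k = n div k * k + k" by (simp add: K_def)
    ultimately show "n < K * k" "K * k \<le> 2 * n" using kn by linarith+
  qed
  have K1: "K \<ge> 1" "K \<le> n + 1" by (simp_all add: K_def)
  \<comment> \<open>The divisor 40 yields \<open>20 * (B * K) <= m\<close>, since
    \<open>r * k * K <= 2 * r * n <= 2 * m\<close>. With \<open>32 * KK <= m\<close> this leaves
    room for the multiplicities 5 and 6 in \<open>anc\<close>.\<close>
  define B where "B = min d (r * k div 40)"
  have rk: "8192 \<le> r * k" using mult_le_mono[OF r k(1)] by simp
  have B1: "B \<ge> 1" using d(1) rk by (simp add: B_def)
  have B40: "40 * B \<le> r * k" by (simp add: B_def)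
  have Bd: "B \<le> d" by (simp add: B_def)
  have B80: "r * k \<le> 80 * B" if "B \<noteq> d"
  proof -
    have "B = r * k div 40" using that by (auto simp: B_def min_def split: if_splits)
    then have "r * k < 40 * (B + 1)" by simp
    then show ?thesis using B1 by simp
  qed
  \<comment> \<open>The amortization of the table: multiplied by \<open>K\<close>, it bounds the
    table cost by twice the string cost. If \<open>B = d\<close> it rests on
    \<open>4 ^ k <= d\<close>, otherwise on \<open>p64\<close> and \<open>B80\<close>.\<close>
  have k2B: "k * 2 ^ k \<le> 2 * B"
  proof (cases "B = d")
    case False
    have "64 * (k * 2 ^ k) \<le> r * k" using mult_le_mono1[OF p64, of k] by (simp add: ac_simps)
    then show ?thesis using B80[OF False] by linarith
  qed (use pd(2) in simp)
  define BK KK where "BK = B * K" and "KK = K * k * 2 ^ k"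
  have BK: "B \<le> BK" "1 \<le> BK" using K1 B1 by (simp_all add: BK_def)
  have BKm: "20 * BK \<le> m"
  proof -
    have "40 * BK \<le> (r * k) * K" using mult_le_mono1[OF B40, of K] by (simp add: BK_def)
    also have "\<dots> = r * (K * k)" by simp
    also have "\<dots> \<le> r * (2 * n)" using Kk(2) by (rule mult_le_mono2)
    also have "\<dots> = 2 * (r * n)" by simp
    finally show ?thesis using rn by linarith
  qed
  have KKm: "32 * KK \<le> m"
  proof -
    have "64 * KK = (K * k) * (64 * 2 ^ k)" by (simp add: KK_def)
    also have "\<dots> \<le> (2 * n) * r" using Kk(2) p64 by (rule mult_le_mono)
    also have "\<dots> = 2 * (r * n)" by simp
    finally show ?thesis using rn by linarith
  qed
  have anc: "K * k + B + 4 * (B * K) + 6 * (K * k * 2 ^ k) \<le> n + m"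
    unfolding BK_def[symmetric] KK_def[symmetric] using Kk(2) BK BKm KKm nm by linarith
  \<comment> \<open>A single sum dominating all tree widths of a batch: \<open>B + 1\<close>,
    \<open>K <= n + 1\<close> and \<open>2 ^ k\<close>.\<close>
  define M where "M = B + n + 1 + 2 ^ k"
  have M1: "M \<ge> 1" by (simp add: M_def)
  obtain D where D: "M \<le> 2 ^ D" "real D \<le> log 2 (real M) + 1"
    by (rule exists_pow2_ge[OF M1]) (rule that)
  have D': "K \<le> 2 ^ D" "B + 1 \<le> 2 ^ D" using D(1) K1 n unfolding M_def by linarith+
  have "2 ^ k \<le> (2 ^ D :: nat)" using D(1) unfolding M_def by linarith
  then have kD: "k \<le> D" by simp
  have D1: "D \<ge> 1" using kD k(1) by simp
  define T where "T = d div B + 1"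
  have T: "d \<le> T * B" "T * B \<le> 2 * d" "T \<ge> 1"
  proof -
    have "d = d div B * B + d mod B" "d mod B < B" using B1 by simp_all
    moreover have "T * B = d div B * B + B" by (simp add: T_def)
    ultimately show "d \<le> T * B" "T * B \<le> 2 * d" using Bd by linarith+
  qed (simp add: T_def)
  define lr where "lr = log 2 (real m / real n)"
  have nz: "real n \<ge> 1" "real d \<ge> 4" "real r \<ge> 8192" "real k \<ge> 1" "real m \<ge> 8192"
    using n d r k nm by simp_all
  have mn: "real m / real n \<ge> real r" "real m / real n \<le> 2 * real r"
  proof -
    have "real r * real n \<le> real m" "real m \<le> 2 * (real r * real n)"
      using rn mr by (metis of_nat_le_iff of_nat_mult, metis of_nat_le_iff of_nat_mult of_nat_numeral)
    then show "real m / real n \<ge> real r" "real m / real n \<le> 2 * real r"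
      using nz by (simp_all add: field_simps)
  qed
  have lr1: "lr \<ge> 1" unfolding lr_def using mn nz by (subst le_log_iff) simp_all
  have lr2: "lr \<le> 2 * log 2 (real r)"
  proof -
    have "real m / real n \<le> real r * real r" using mn nz mult_right_mono[of 2 "real r" "real r"] by linarith
    then have "lr \<le> log 2 (real r * real r)" unfolding lr_def using mn nz by simp
    then show ?thesis using nz by (simp add: log_mult)
  qed
  have ld: "log 2 (real d) \<ge> 1" using nz by (subst le_log_iff) simp_all
  have lm: "log 2 (real m) \<ge> 1" using nz by (subst le_log_iff) simp_all
  have lnd: "log 2 (real n * real d) \<ge> 2"
  proof -
    have "4 \<le> real n * real d" using nz mult_mono[of 1 "real n" 4 "real d"] by simp
    then show ?thesis using nz by (subst le_log_iff) simp_all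
  qed
  \<comment> \<open>As \<open>k >= 1\<close>, the upper bracket \<open>4 ^ (k + 1)\<close> is at
    most \<open>2 ^ (4 * k)\<close>, so \<open>k\<close> has the order of the logarithm it stands
    for.\<close>
  have l4k: "log 2 (real (min r d)) \<le> 4 * real k"
  proof -
    have "(4 :: nat) ^ (k + 1) \<le> 4 ^ (2 * k)" using k(1) by (intro power_increasing) simp_all
    also have "\<dots> = 2 ^ (4 * k)" by (simp add: power_mult)
    finally have "min r d < 2 ^ (4 * k)" using k(3) by simp
    then have "log 2 (real (min r d)) < real (4 * k)" using r d by (intro log2_of_power_less) simp_all
    then show ?thesis by simp
  qed
  have pos: "0 \<le> real n * real d * log 2 (real m) / (real m * lr)" "0 \<le> real n * real d / lr"
    "0 \<le> real n * real d / log 2 (real d)"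
    using lr1 lm ld by simp_all
  have size: "real (1 + T * (15 * (18 * (B * K) + 18 * (K * k * 2 ^ k)) + 5 * B + 1)) \<le> 100000000 *
      (real n * real d / lr + real n * real d / log 2 (real d))"
  proof -
    let ?s = "1 + T * (15 * (18 * BK + 18 * KK) + 5 * B + 1)"
    have "?s \<le> T * (15 * (18 * BK + 18 * KK) + 5 * B + 2)" using T(3) by (simp add: algebra_simps)
    \<comment> \<open>\<open>277 = 270 + 5 + 2\<close>, using \<open>B <= BK\<close> and
      \<open>1 <= BK\<close>.\<close>
    also have "\<dots> \<le> T * (277 * BK + 270 * KK)" 
    proof (rule mult_le_mono2)
      have "15 * (18 * BK + 18 * KK) = 270 * BK + 270 * KK" by simp
      then show "15 * (18 * BK + 18 * KK) + 5 * B + 2 \<le> 277 * BK + 270 * KK" using BK by linarith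
    qed
    finally have s1: "?s \<le> T * (277 * BK + 270 * KK)" .
    \<comment> \<open>Multiplying by \<open>k\<close> brings in the product
      \<open>K * k <= 2 * n\<close>; then \<open>554 + 1080 = 1634\<close>, and
      \<open>T * B <= 2 * d\<close> doubles this to 3268.\<close>
    have "k * (277 * BK + 270 * KK) = 277 * (B * (K * k)) + 270 * ((K * k) * (k * 2 ^ k))"
      by (simp add: BK_def KK_def algebra_simps)
    also have "\<dots> \<le> 277 * (B * (2 * n)) + 270 * ((2 * n) * (2 * B))"
      by (rule add_mono[OF mult_le_mono2[OF mult_le_mono2[OF Kk(2)]] mult_le_mono2[OF mult_le_mono[OF Kk(2) k2B]]])
    also have "\<dots> = 1634 * n * B" by (simp add: algebra_simps)
    finally have s2: "k * (277 * BK + 270 * KK) \<le> 1634 * n * B" .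
    have "k * ?s \<le> T * (k * (277 * BK + 270 * KK))"
      using mult_le_mono2[OF s1, of k] by (simp only: mult.left_commute)
    also have "\<dots> \<le> T * (1634 * n * B)" using s2 by (rule mult_le_mono2)
    also have "\<dots> = 1634 * n * (T * B)" by simp
    also have "\<dots> \<le> 1634 * n * (2 * d)" using T(2) by (rule mult_le_mono2)
    finally have "k * ?s \<le> 3268 * (n * d)" by simp
    then have "real k * real ?s \<le> 3268 * (real n * real d)"
      by (metis of_nat_le_iff of_nat_mult of_nat_numeral)
    then have s3: "real ?s \<le> 3268 * (real n * real d / real k)" using nz by (simp add: field_simps)
    \<comment> \<open>The smaller of \<open>r\<close> and \<open>d\<close> determines
      \<open>k\<close>, and thereby which summand of the claimed size absorbs
      \<open>n d / k\<close>.\<close>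
    have "real n * real d / real k \<le> 8 * (real n * real d / lr + real n * real d / log 2 (real d))"
    proof (cases "r \<le> d")
      case True
      then have "lr \<le> 8 * real k" using l4k lr2 by simp
      then have "real n * real d / (8 * real k) \<le> real n * real d / lr"
        using lr1 nz by (intro divide_left_mono mult_pos_pos) simp_all
      then have "8 * (real n * real d / (8 * real k)) \<le> 8 * (real n * real d / lr)"
        by (rule mult_left_mono) simp
      then have "real n * real d / real k \<le> 8 * (real n * real d / lr)" by simp
      then show ?thesis using pos(2,3) by (intro absorb[of 8]) simp_all
    next
      case False
      then have "log 2 (real d) \<le> 8 * real k" using l4k nz by simp
      then have "real n * real d / (8 * real k) \<le> real n * real d / log 2 (real d)"
        using ld nz by (intro divide_left_mono mult_pos_pos) simp_all
      then have "8 * (real n * real d / (8 * real k)) \<le> 8 * (real n * real d / log 2 (real d))"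
        by (rule mult_left_mono) simp
      then have "real n * real d / real k \<le> 8 * (real n * real d / log 2 (real d))" by simp
      then show ?thesis using pos(2,3) by (intro absorb[of 8]) simp_all
    qed
    then have "3268 * (real n * real d / real k) \<le>
        3268 * (8 * (real n * real d / lr + real n * real d / log 2 (real d)))"
      by (rule mult_left_mono) simp
    also have "\<dots> = 26144 * (real n * real d / lr + real n * real d / log 2 (real d))"
      by simp
    also have "\<dots> \<le> 100000000 * (real n * real d / lr + real n * real d / log 2 (real d))"
      using pos(2,3) by (intro mult_right_mono) simp_all
    finally show ?thesis using s3 unfolding BK_def[symmetric] KK_def[symmetric] by (rule order_trans[rotated])
  qed
  have "1 + T * (514 * D + 391) \<le> T * (514 * D + 392)" using T(3) by (simp add: algebra_simps)
  also have "\<dots> \<le> T * (906 * D)" using D1 by (intro mult_le_mono2) linarith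
  finally have "real (1 + T * (514 * D + 391)) \<le> real (T * (906 * D))" by (rule of_nat_mono)
  then have dep: "real (1 + T * (514 * D + 391)) \<le> 906 * (real T * real D)" by simp
  have depth: "real (1 + T * (514 * D + 391)) \<le> 100000000 *
      (real n * real d * log 2 (real m) / (real m * lr) + log 2 (real n * real d))"
  proof (cases "B = d")
    case True
    \<comment> \<open>All strings fit into the first batch and the second one is empty, so the depth
      is \<open>O(log M)\<close> with \<open>M <= 4 * n * d\<close>.\<close>
    then have T2: "T = 2" using B1 by (simp add: T_def)
    have "n \<le> n * d" "d \<le> n * d" "1 \<le> n * d" using n d by simp_all
    then have "M \<le> 4 * (n * d)" using Bd pd(1) unfolding M_def by linarith
    then have "real M \<le> 4 * (real n * real d)"
      by (metis of_nat_le_iff of_nat_mult of_nat_numeral)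
    then have "log 2 (real M) \<le> log 2 (4 * (real n * real d))"
      using nz M1 by (subst log_le_cancel_iff) simp_all
    also have "\<dots> = 2 + log 2 (real n * real d)" using nz by (subst log_mult) (simp_all add: log2_values)
    finally have "real D \<le> 4 * log 2 (real n * real d)" using D(2) lnd by simp
    then have "real (1 + T * (514 * D + 391)) \<le> 7248 * log 2 (real n * real d)"
      using dep unfolding T2 by simp
    then show ?thesis using pos(1) lnd by (intro absorb[of 7248]) simp_all
  next
    case False
    have "40 * B \<le> m"
    proof -
      have "40 * B \<le> r * n" using B40 mult_le_mono2[OF kn, of r] by linarith
      then show ?thesis using rn by linarith
    qed
    moreover have "64 * 2 ^ k \<le> m" using p64 rn mult_le_mono2[OF n, of r] by linarith
    ultimately have "M \<le> m" using nm n unfolding M_def by linarith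
    then have "log 2 (real M) \<le> log 2 (real m)"
      using M1 by (subst log_le_cancel_iff) simp_all
    then have D2: "real D \<le> 2 * log 2 (real m)" using D(2) lm by simp
    have "T * (r * k) \<le> T * (80 * B)" using B80[OF False] by (rule mult_le_mono2)
    also have "\<dots> = 80 * (T * B)" by simp
    finally have "T * (r * k) \<le> 160 * d" using T(2) by linarith
    then have "real T * (real r * real k) \<le> 160 * real d"
      by (metis of_nat_le_iff of_nat_mult of_nat_numeral)
    then have T160: "real T \<le> 160 * (real d / (real r * real k))" using nz by (simp add: field_simps)
    \<comment> \<open>If \<open>r > d\<close>, then \<open>B\<close> being smaller than
      \<open>d\<close> still forces \<open>r <= 80 * d\<close>; since \<open>r >= 8192\<close>, this
      gives \<open>80 <= d\<close> and so \<open>r <= d * d\<close>, which makes the two logarithms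
      comparable.\<close>
    have lrk: "log 2 (real r) \<le> 8 * real k"
    proof (cases "r \<le> d")
      case True
      then show ?thesis using l4k nz by simp
    next
      case rd: False
      have "r \<le> r * k" using k(1) by simp
      then have "r \<le> 80 * d" using B80[OF False] Bd by linarith
      then have r80: "real r \<le> 80 * real d" by (metis of_nat_le_iff of_nat_mult of_nat_numeral)
      then have "80 \<le> real d" using nz by linarith
      then have "80 * real d \<le> real d * real d" by (rule mult_right_mono) simp
      then have "real r \<le> real d * real d" using r80 by linarith
      then have "log 2 (real r) \<le> log 2 (real d * real d)"
        using nz by (subst log_le_cancel_iff) simp_all
      also have "\<dots> = 2 * log 2 (real d)" using nz by (simp add: log_mult)
      finally show ?thesis using l4k rd by simp
    qed
    have "real m * lr \<le> (2 * (real r * real n)) * (16 * real k)"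
    proof (rule mult_mono)
      show "real m \<le> 2 * (real r * real n)" using mn(2) nz by (simp add: field_simps)
    qed (use lr1 lr2 lrk in simp_all)
    then have "real n * real d * log 2 (real m) / ((2 * (real r * real n)) * (16 * real k)) \<le>
        real n * real d * log 2 (real m) / (real m * lr)"
      using nz lr1 lm by (intro divide_left_mono mult_pos_pos) simp_all
    then have "32 * (real n * real d * log 2 (real m) / ((2 * (real r * real n)) * (16 * real k))) \<le>
        32 * (real n * real d * log 2 (real m) / (real m * lr))"
      by (rule mult_left_mono) simp
    moreover have "32 * (real n * real d * log 2 (real m) / ((2 * (real r * real n)) * (16 * real k))) =
        (real d / (real r * real k)) * log 2 (real m)"
      using nz by (simp add: field_simps)
    ultimately have X: "(real d / (real r * real k)) * log 2 (real m) \<le>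
        32 * (real n * real d * log 2 (real m) / (real m * lr))" by simp
    have "real T * real D \<le> (160 * (real d / (real r * real k))) * (2 * log 2 (real m))"
      using T160 D2 by (rule mult_mono) simp_all
    also have "\<dots> = 320 * ((real d / (real r * real k)) * log 2 (real m))" by simp
    also have "\<dots> \<le> 320 * (32 * (real n * real d * log 2 (real m) / (real m * lr)))"
      using X by (rule mult_left_mono) simp
    finally have "real (1 + T * (514 * D + 391)) \<le>
        9277440 * (real n * real d * log 2 (real m) / (real m * lr))"
      using dep by simp
    then show ?thesis using pos(1) lnd by (intro absorb[of 9277440]) simp_all
  qed
  show ?thesis
    by (rule that[OF k(1) Kk(1) kD D'(1) B1 D'(2) T(1) anc depth[unfolded lr_def] size[unfolded lr_def]])
qed

text \<open>The constant \<open>100000000\<close> exceeds every factor that arises; the largest is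
  \<open>366 * 106496\<close>, from the depth when strings are added one at a time.\<close>

theorem theorem1:
  shows "\<exists>C::real. C > 0 \<and>
    (\<forall>(n::nat) (d::nat) (m::nat) (q::nat \<Rightarrow> bool list) (\<alpha>::nat \<Rightarrow> complex).
      n \<ge> 1 \<longrightarrow> d \<ge> 2 \<longrightarrow> m \<ge> 6 * n \<longrightarrow>
      (\<forall>i<d. length (q i) = n) \<longrightarrow>
      (\<forall>i<d. \<forall>j<d. i \<noteq> j \<longrightarrow> q i \<noteq> q j) \<longrightarrow>
      (\<Sum>i<d. (cmod (\<alpha> i))\<^sup>2) = 1 \<longrightarrow>
      (\<exists>U::circuit. valid_circuit (n + m) U \<and>
         (\<forall>x. length x = n + m \<longrightarrow>
            run_circuit U (basis_state (replicate (n + m) False)) x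
            = (\<Sum>i<d. \<alpha> i * basis_state (q i @ replicate m False) x)) \<and>
         real (circuit_depth U) \<le>
           C * (real n * real d * log 2 (real m) / (real m * log 2 (real m / real n))
                + log 2 (real n * real d)) \<and>
         real (circuit_size U) \<le>
           C * (real n * real d / log 2 (real m / real n) + real n * real d / log 2 (real d))))"
proof (intro exI[of _ "100000000"] conjI allI impI)
  fix n d m :: nat and q :: "nat \<Rightarrow> bool list" and \<alpha> :: "nat \<Rightarrow> complex"
  assume n: "n \<ge> 1" and d: "d \<ge> 2" and m: "m \<ge> 6 * n" and len: "\<forall>i<d. length (q i) = n"
    and dist: "\<forall>i<d. \<forall>j<d. i \<noteq> j \<longrightarrow> q i \<noteq> q j" and \<alpha>: "(\<Sum>i<d. (cmod (\<alpha> i))\<^sup>2) = 1"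
  let ?depth = "100000000 * (real n * real d * log 2 (real m) / (real m * log 2 (real m / real n))
      + log 2 (real n * real d))"
  let ?size = "100000000 * (real n * real d / log 2 (real m / real n) + real n * real d / log 2 (real d))"
  have "\<exists>D S U. real D \<le> ?depth \<and> real S \<le> ?size \<and> valid_circuit (n + m) U \<and>
      run_circuit U (basis_state (replicate (n + m) False)) =
        (\<lambda>x. \<Sum>i<d. \<alpha> i * basis_state (q i @ replicate m False) x) \<and>
      circuit_depth U \<le> D \<and> circuit_size U \<le> S"
  proof (cases "m div n < 8192 \<or> d < 4")
    case True
    obtain D where D: "n + 1 \<le> 2 ^ D" "real D \<le> log 2 (real (n + 1)) + 1"
      by (rule exists_pow2_ge[of "n + 1"]) simp_all
    have "d \<ge> 1" using d by simp
    from prepare_singly[OF n this m D(1) len dist \<alpha>] singly_bounds[OF n d m True D(2)]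
    show ?thesis by blast
  next
    case False
    then have big: "d \<ge> 4" "m div n \<ge> 8192" by simp_all
    have m1: "m \<ge> 1" using n m by simp
    show ?thesis
    proof (rule batched_parameters[OF n big(1) card_distinct_strings[OF len dist] big(2)])
      fix k K B T D
      assume p: "k \<ge> 1" "n < K * k" "k \<le> D" "K \<le> 2 ^ D" "B \<ge> 1" "B + 1 \<le> 2 ^ D" "d \<le> T * B"
        "K * k + B + 4 * (B * K) + 6 * (K * k * 2 ^ k) \<le> n + m"
        and bounds: "real (1 + T * (514 * D + 391)) \<le> ?depth"
        "real (1 + T * (15 * (18 * (B * K) + 18 * (K * k * 2 ^ k)) + 5 * B + 1)) \<le> ?size"
      from prepare_batched[OF m1 p len dist \<alpha>] bounds show ?thesis by blast
    qed
  qed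
  then obtain D S U where U: "real D \<le> ?depth" "real S \<le> ?size" "valid_circuit (n + m) U"
      "run_circuit U (basis_state (replicate (n + m) False)) =
        (\<lambda>x. \<Sum>i<d. \<alpha> i * basis_state (q i @ replicate m False) x)"
      "circuit_depth U \<le> D" "circuit_size U \<le> S"
    by (elim exE conjE)
  have "real (circuit_depth U) \<le> ?depth" using U(1,5) by (meson of_nat_le_iff order_trans)
  moreover have "real (circuit_size U) \<le> ?size" using U(2,6) by (meson of_nat_le_iff order_trans)
  ultimately show "\<exists>U::circuit. valid_circuit (n + m) U \<and>
         (\<forall>x. length x = n + m \<longrightarrow>
            run_circuit U (basis_state (replicate (n + m) False)) x
            = (\<Sum>i<d. \<alpha> i * basis_state (q i @ replicate m False) x)) \<and>
         real (circuit_depth U) \<le> ?depth \<and> real (circuit_size U) \<le> ?size"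
    using U(3,4) by (intro exI[of _ U]) simp
qed simp

end
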